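(* Let $A,B$ be antisymmetric real $(3\times3)$-matrices with $[A,B]=AB-BA=0$ and $B\neq0$, let $W$ be a standard one-dimensional Wiener process, let $K\in\{\mathbb S^2,SO_3\}$, and consider the Stratonovich SDE $$dZ=AZ\,dt+BZ\circ dW$$ on $K$. With the orbit space $H$ and the measures $\mu_X$, $X\in H$, defined in the context, a Borel probability measure $\nu$ on $K$ is ergodic for this SDE if and only if there exists $X\in H$ such that $\nu=\mu_X$.
   Context: $SO_3$ is the group of orthogonal real $(3\times 3)$-matrices with determinant $1$; $\mathbb S^2\subset\mathbb R^3$ is the unit sphere, and matrices act on $K$ by left multiplication. Let $\rho=(\frac12\|B\|^2)^{1/2}$, where $\|B\|$ is the Euclidean (Frobenius) norm of $B$ in $\mathbb R^{3\times3}$. For $(x,y)\in\mathbb S^1\subset\mathbb R^2\cong\mathbb C$ put $$\mathbf s(x,y)=\frac{1-x}{\rho^2}B^2+\frac{y}{\rho}B+I,$$ and define $S:\mathbb S^1\times K\to K$, $S(p,Z)=\mathbf s(p)Z$. This is an action of the circle group $\mathbb S^1$ (complex multiplication) on $K$. For $Z\in K$ let $S^Z:\mathbb S^1\to K$, $S^Z(p)=S(p,Z)$. The orbit space is $H=\{S^Z[\mathbb S^1]:Z\in K\}$. For $X\in H$, $\mu_X$ is the image under $S^U$ of the normalized Haar measure on $\mathbb S^1$, where $U$ is any point of $X$ (the result does not depend on the choice of $U\in X$). A Borel probability measure $\nu$ on $K$ is invariant if $\int_K \mathbb P(Z^z(t)\in J)\,d\nu(z)=\nu(J)$ for all $t\ge0$,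 $J\in\mathscr B(K)$, where $Z^z$ is the solution started at $z\in K$. An invariant probability measure is called ergodic if it is an extremal point of the convex set of all invariant probability measures on $K$. *)

theory Defs
  imports "HOL-Probability.Probability"
begin

section \<open>Processes\<close>

text \<open>
  A process is a function \<open>X :: real \<Rightarrow> 'w \<Rightarrow> 'a\<close>; only its values at times \<open>t \<ge> 0\<close> matter.
  A filtration \<open>F\<close> is likewise indexed by \<^typ>\<open>real\<close>, of which only \<open>t \<ge> 0\<close> matters
  (extend by \<open>F t = F 0\<close> for \<open>t < 0\<close>).
\<close>

definition filtered_prob_space :: "'w measure \<Rightarrow> (real \<Rightarrow> 'w measure) \<Rightarrow> bool" where
  "filtered_prob_space P F \<longleftrightarrow>
     prob_space P \<and> filtration (space P) F \<and> (\<forall>t. subalgebra P (F t))"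

definition adapted :: "(real \<Rightarrow> 'w measure) \<Rightarrow> (real \<Rightarrow> 'w \<Rightarrow> 'a::topological_space) \<Rightarrow> bool" where
  "adapted F X \<longleftrightarrow> (\<forall>t\<ge>0. X t \<in> borel_measurable (F t))"

definition continuous_process :: "'w measure \<Rightarrow> (real \<Rightarrow> 'w \<Rightarrow> 'a::topological_space) \<Rightarrow> bool" where
  "continuous_process P X \<longleftrightarrow> (AE \<omega> in P. continuous_on {0..} (\<lambda>t. X t \<omega>))"

definition wiener_process ::
  "'w measure \<Rightarrow> (real \<Rightarrow> 'w measure) \<Rightarrow> (real \<Rightarrow> 'w \<Rightarrow> real) \<Rightarrow> bool" where
  "wiener_process P F W \<longleftrightarrow>
     adapted F W \<and> continuous_process P W \<and> (AE \<omega> in P. W 0 \<omega> = 0) \<and>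
     (\<forall>s t. 0 \<le> s \<and> s < t \<longrightarrow>
        distributed P lborel (\<lambda>\<omega>. W t \<omega> - W s \<omega>) (normal_density 0 (sqrt (t - s))) \<and>
        prob_space.indep_set P (sets (F s))
          (sets (vimage_algebra (space P) (\<lambda>\<omega>. W t \<omega> - W s \<omega>) borel)))"

section \<open>Continuous semimartingales\<close>

text \<open>The last clause says \<open>E[X t | F s] = X s\<close>, stated for vector-valued \<open>X\<close>.\<close>

definition martingale ::
  "'w measure \<Rightarrow> (real \<Rightarrow> 'w measure) \<Rightarrow> (real \<Rightarrow> 'w \<Rightarrow> 'a::euclidean_space) \<Rightarrow> bool" where
  "martingale P F X \<longleftrightarrow>
     adapted F X \<and> (\<forall>t\<ge>0. integrable P (X t)) \<and>
     (\<forall>s t. 0 \<le> s \<and> s \<le> t \<longrightarrow>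
        (\<forall>E\<in>sets (F s). set_lebesgue_integral P E (X t) = set_lebesgue_integral P E (X s)))"

definition local_martingale ::
  "'w measure \<Rightarrow> (real \<Rightarrow> 'w measure) \<Rightarrow> (real \<Rightarrow> 'w \<Rightarrow> 'a::euclidean_space) \<Rightarrow> bool" where
  "local_martingale P F X \<longleftrightarrow>
     adapted F X \<and>
     (\<exists>T :: nat \<Rightarrow> 'w \<Rightarrow> real.
        (\<forall>n. stopping_time F (T n) \<and> (\<forall>\<omega>\<in>space P. 0 \<le> T n \<omega>)) \<and>
        (AE \<omega> in P. incseq (\<lambda>n. T n \<omega>) \<and> filterlim (\<lambda>n. T n \<omega>) at_top sequentially) \<and>
        (\<forall>n. martingale P F (\<lambda>t \<omega>. X (min t (T n \<omega>)) \<omega> - X 0 \<omega>)))"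

text \<open>The points \<open>\<tau> 0 \<le> \<dots> \<le> \<tau> N\<close> form a partition of \<open>[0, t]\<close>.\<close>

definition partition_upto :: "real \<Rightarrow> (nat \<Rightarrow> real) \<Rightarrow> nat \<Rightarrow> bool" where
  "partition_upto t \<tau> N \<longleftrightarrow> \<tau> 0 = 0 \<and> \<tau> N = t \<and> (\<forall>k<N. \<tau> k \<le> \<tau> (Suc k))"

definition finite_variation_process ::
  "'w measure \<Rightarrow> (real \<Rightarrow> 'w measure) \<Rightarrow> (real \<Rightarrow> 'w \<Rightarrow> 'a::euclidean_space) \<Rightarrow> bool" where
  "finite_variation_process P F V \<longleftrightarrow>
     adapted F V \<and>
     (AE \<omega> in P. \<forall>t\<ge>0. \<exists>C. \<forall>\<tau> N. partition_upto t \<tau> N \<longrightarrow>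
        (\<Sum>k<N. norm (V (\<tau> (Suc k)) \<omega> - V (\<tau> k) \<omega>)) \<le> C)"

definition continuous_semimartingale ::
  "'w measure \<Rightarrow> (real \<Rightarrow> 'w measure) \<Rightarrow> (real \<Rightarrow> 'w \<Rightarrow> 'a::euclidean_space) \<Rightarrow> bool" where
  "continuous_semimartingale P F X \<longleftrightarrow>
     adapted F X \<and> continuous_process P X \<and>
     (\<exists>L V. local_martingale P F L \<and> continuous_process P L \<and>
            finite_variation_process P F V \<and> continuous_process P V \<and>
            (AE \<omega> in P. \<forall>t\<ge>0. X t \<omega> = L t \<omega> + V t \<omega>))"

section \<open>The Stratonovich integral and the equation\<close>

definition converges_in_prob ::
  "'w measure \<Rightarrow> (nat \<Rightarrow> 'w \<Rightarrow> 'a::euclidean_space) \<Rightarrow> ('w \<Rightarrow> 'a) \<Rightarrow> bool" where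
  "converges_in_prob P X L \<longleftrightarrow>
     (\<forall>n. X n \<in> borel_measurable P) \<and> L \<in> borel_measurable P \<and>
     (\<forall>\<epsilon>>0. (\<lambda>n. measure P {\<omega>\<in>space P. norm (X n \<omega> - L \<omega>) > \<epsilon>}) \<longlonglongrightarrow> 0)"

text \<open>
  \<open>I\<close> is (a version of) the Stratonovich integral of the continuous semimartingale \<open>Y\<close> against \<open>W\<close>
  over \<open>[0, t]\<close>: the limit in probability of the trapezoidal sums along every sequence of
  deterministic partitions whose mesh tends to 0.
\<close>

definition has_stratonovich_integral ::
  "'w measure \<Rightarrow> (real \<Rightarrow> 'w \<Rightarrow> 'a::euclidean_space) \<Rightarrow> (real \<Rightarrow> 'w \<Rightarrow> real) \<Rightarrow> real
     \<Rightarrow> ('w \<Rightarrow> 'a) \<Rightarrow> bool" where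
  "has_stratonovich_integral P Y W t I \<longleftrightarrow>
     (\<forall>\<tau> N. (\<forall>n. partition_upto t (\<tau> n) (N n)) \<and>
            (\<forall>\<delta>>0. \<forall>\<^sub>F n in sequentially. \<forall>k<N n. \<tau> n (Suc k) - \<tau> n k < \<delta>) \<longrightarrow>
        converges_in_prob P
          (\<lambda>n \<omega>. \<Sum>k<N n. (W (\<tau> n (Suc k)) \<omega> - W (\<tau> n k) \<omega>) *\<^sub>R
                    ((1/2) *\<^sub>R (Y (\<tau> n k) \<omega> + Y (\<tau> n (Suc k)) \<omega>)))
          I)"

text \<open>
  \<open>Z\<close> is a \<open>K\<close>-valued solution of \<open>dZ = AZ dt + BZ \<circ> dW\<close> with \<open>Z 0 = z\<close>. The parameter
  \<open>act\<close> is left multiplication by a matrix, i.e. \<open>(*v)\<close> for vectors and \<open>(**)\<close> for matrices.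
\<close>

definition stratonovich_solution ::
  "'w measure \<Rightarrow> (real \<Rightarrow> 'w measure) \<Rightarrow> (real \<Rightarrow> 'w \<Rightarrow> real) \<Rightarrow>
   (real^3^3 \<Rightarrow> 'a \<Rightarrow> 'a::euclidean_space) \<Rightarrow> 'a set \<Rightarrow> real^3^3 \<Rightarrow> real^3^3 \<Rightarrow>
   'a \<Rightarrow> (real \<Rightarrow> 'w \<Rightarrow> 'a) \<Rightarrow> bool" where
  "stratonovich_solution P F W act K A B z Z \<longleftrightarrow>
     continuous_semimartingale P F Z \<and>
     (\<forall>t\<ge>0. \<forall>\<omega>\<in>space P. Z t \<omega> \<in> K) \<and>
     (\<forall>t\<ge>0. \<exists>I. has_stratonovich_integral P (\<lambda>s \<omega>. act B (Z s \<omega>)) W t I \<and>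
        (AE \<omega> in P. Z t \<omega> = z + integral {0..t} (\<lambda>s. act A (Z s \<omega>)) + I \<omega>))"

section \<open>Invariant and ergodic measures\<close>

definition borel_prob_on :: "'a::topological_space set \<Rightarrow> 'a measure \<Rightarrow> bool" where
  "borel_prob_on K \<nu> \<longleftrightarrow> sets \<nu> = sets (restrict_space borel K) \<and> prob_space \<nu>"

text \<open>\<open>Z z\<close> is the solution started at \<open>z \<in> K\<close>.\<close>

definition invariant_prob ::
  "'w measure \<Rightarrow> ('a::topological_space \<Rightarrow> real \<Rightarrow> 'w \<Rightarrow> 'a) \<Rightarrow> 'a set \<Rightarrow> 'a measure \<Rightarrow> bool" where
  "invariant_prob P Z K \<nu> \<longleftrightarrow>
     borel_prob_on K \<nu> \<and>
     (\<forall>t\<ge>0. \<forall>J\<in>sets (restrict_space borel K).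
        (\<integral>z. measure P {\<omega>\<in>space P. Z z t \<omega> \<in> J} \<partial>\<nu>) = measure \<nu> J)"

definition convex_combination :: "real \<Rightarrow> 'a measure \<Rightarrow> 'a measure \<Rightarrow> 'a measure \<Rightarrow> bool" where
  "convex_combination u \<nu>1 \<nu>2 \<nu> \<longleftrightarrow>
     (\<forall>J\<in>sets \<nu>. measure \<nu> J = (1 - u) * measure \<nu>1 J + u * measure \<nu>2 J)"

definition ergodic ::
  "'w measure \<Rightarrow> ('a::topological_space \<Rightarrow> real \<Rightarrow> 'w \<Rightarrow> 'a) \<Rightarrow> 'a set \<Rightarrow> 'a measure \<Rightarrow> bool" where
  "ergodic P Z K \<nu> \<longleftrightarrow>
     invariant_prob P Z K \<nu> \<and>
     (\<forall>\<nu>1 \<nu>2 u. invariant_prob P Z K \<nu>1 \<and> invariant_prob P Z K \<nu>2 \<and> 0 < u \<and> u < 1 \<and>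
        convex_combination u \<nu>1 \<nu>2 \<nu> \<longrightarrow> \<nu>1 = \<nu>2)"

section \<open>The circle action, its orbits and orbit measures\<close>

abbreviation circle :: "complex set" where
  "circle \<equiv> sphere 0 1"

definition is_haar_circle :: "complex measure \<Rightarrow> bool" where
  "is_haar_circle \<mu> \<longleftrightarrow> borel_prob_on circle \<mu> \<and> (\<forall>p\<in>circle. distr \<mu> \<mu> (\<lambda>q. p * q) = \<mu>)"

definition haar_circle :: "complex measure" where
  "haar_circle = (THE \<mu>. is_haar_circle \<mu>)"

text \<open>The norm on \<^typ>\<open>real^3^3\<close> is the Frobenius norm.\<close>

definition rho :: "real^3^3 \<Rightarrow> real" where
  "rho B = sqrt ((1/2) * (norm B)\<^sup>2)"

definition s_matrix :: "real^3^3 \<Rightarrow> complex \<Rightarrow> real^3^3" where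
  "s_matrix B p = ((1 - Re p) / (rho B)\<^sup>2) *\<^sub>R (B ** B) + (Im p / rho B) *\<^sub>R B + mat 1"

definition S_map :: "(real^3^3 \<Rightarrow> 'a \<Rightarrow> 'a) \<Rightarrow> real^3^3 \<Rightarrow> complex \<Rightarrow> 'a \<Rightarrow> 'a" where
  "S_map act B p z = act (s_matrix B p) z"

definition orbit_space :: "(real^3^3 \<Rightarrow> 'a \<Rightarrow> 'a) \<Rightarrow> real^3^3 \<Rightarrow> 'a set \<Rightarrow> 'a set set" where
  "orbit_space act B K = {(\<lambda>p. S_map act B p z) ` circle | z. z \<in> K}"

text \<open>The choice of the base point in the orbit \<open>X\<close> is immaterial.\<close>

definition orbit_measure ::
  "(real^3^3 \<Rightarrow> 'a \<Rightarrow> 'a::topological_space) \<Rightarrow> real^3^3 \<Rightarrow> 'a set \<Rightarrow> 'a set \<Rightarrow> 'a measure" where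
  "orbit_measure act B K X =
     distr haar_circle (restrict_space borel K) (\<lambda>p. S_map act B p (SOME u. u \<in> X))"

definition S2 :: "(real^3) set" where
  "S2 = sphere 0 1"

definition SO3 :: "(real^3^3) set" where
  "SO3 = {Q. rotation_matrix Q}"

end

theory Submission
  imports Defs
begin

text \<open>
  Commuting antisymmetric \<open>3 \<times> 3\<close> matrices are proportional, so \<open>A = a B\<close> and the solution is
  \<open>Z t = s(exp(i \<rho> (W t + a t))) z\<close>: a Brownian motion with drift moving along the circle orbit of \<open>z\<close>.
  Stratonovich calculus is avoided: a linear functional diagonalising \<open>B\<close> turns the equation into
  \<open>d\<zeta> = i \<kappa> \<zeta> (a dt + \<circ>dW)\<close>, and \<open>exp(- i \<kappa> (W t + a t)) \<zeta> t\<close> is shown to be constant directly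
  from the convergence of trapezoidal sums. Since Gaussian increments have full support, the maximum
  principle makes every invariant measure invariant under the whole circle action, and
  conversely. Finally, an extremal measure takes only the values 0 and 1 on invariant sets; tubes around the
  orbit of a point of its support then force it to live on that orbit, where the Haar
  image is the only invariant probability.
\<close>

section \<open>Almost sure convergence along subsequences\<close>

text \<open>The equation says little about a single path: the integral is known only as a limit in
  probability, separately for each time, and square integrability of the martingale part of
  \<open>Z\<close> is not given. On a grid, the product of \<zeta> with the inverse exponential
  telescopes into error terms. Most of them vanish by the Ito isometry, by uniform continuity, or
  because the trapezoidal rule for the exponential has an error of third order. The exception is the
  difference between fine and coarse covariation of \<open>W\<close> and \<zeta>, which is bounded
  but need not be small in total variation; it vanishes only in a weak sense, because fine and
  coarse trapezoids have the same limit. Even its bound comes from expectations, hence by Fatou only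
  on infinitely many scales that depend on the path. This dictates the order of the choices: one
  deterministic sequence of scales makes countably many errors converge almost surely, and then each
  path thins it out for itself. The identity B^3 = - rho^2 B supplies functionals for the
  eigenvalues i rho and 0, enough to recover every coordinate of the solution.\<close>

context prob_space begin

text \<open>The k-th index is chosen so that the first k + 1 sequences exceed \<open>(1/2)^k\<close>
  only with total probability below \<open>(1/2)^k\<close>; Borel-Cantelli then treats all sequences
  at once. \<open>s\<close> tends to infinity but need not be increasing.\<close>

lemma AE_diagonal_subsequence:
  fixes X :: "nat \<Rightarrow> nat \<Rightarrow> 'a \<Rightarrow> real"
  assumes meas: "\<And>i n. X i n \<in> borel_measurable M"
    and conv: "\<And>i \<epsilon>. \<epsilon> > 0 \<Longrightarrow> (\<lambda>n. prob {\<omega>\<in>space M. \<bar>X i n \<omega>\<bar> > \<epsilon>}) \<longlonglongrightarrow> 0"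
  shows "\<exists>s. filterlim s at_top sequentially \<and> (AE \<omega> in M. \<forall>i. (\<lambda>n. X i (s n) \<omega>) \<longlonglongrightarrow> 0)"
proof -
  note [measurable] = meas
  define A where "A k n = (\<Union>i\<le>k. {\<omega>\<in>space M. \<bar>X i n \<omega>\<bar> > (1/2)^k})" for k n
  have A[measurable]: "A k n \<in> sets M" for k n
    unfolding A_def by measurable
  have "\<exists>n\<ge>k. prob (A k n) < (1/2)^k" for k
  proof -
    have "(\<lambda>n. \<Sum>i\<le>k. prob {\<omega>\<in>space M. \<bar>X i n \<omega>\<bar> > (1/2)^k}) \<longlonglongrightarrow> (\<Sum>i\<le>k. 0)"
      by (intro tendsto_sum conv) simp
    then have "\<forall>\<^sub>F n in sequentially. (\<Sum>i\<le>k. prob {\<omega>\<in>space M. \<bar>X i n \<omega>\<bar> > (1/2)^k}) < (1/2)^k"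
      by (rule order_tendstoD) simp
    then obtain n where n: "n \<ge> k" "(\<Sum>i\<le>k. prob {\<omega>\<in>space M. \<bar>X i n \<omega>\<bar> > (1/2)^k}) < (1/2)^k"
      by (metis (no_types, lifting) eventually_sequentially le_cases order_refl)
    have "prob (A k n) \<le> (\<Sum>i\<le>k. prob {\<omega>\<in>space M. \<bar>X i n \<omega>\<bar> > (1/2)^k})"
      unfolding A_def by (rule finite_measure_subadditive_finite) auto
    also have "\<dots> < (1/2)^k" by (rule n)
    finally show ?thesis using n(1) by blast
  qed
  then obtain s where s: "\<And>k. s k \<ge> k" "\<And>k. prob (A k (s k)) < (1/2)^k"
    by metis
  have lim: "filterlim s at_top sequentially"
    using s(1) by (auto simp: filterlim_at_top eventually_sequentially intro: le_trans)
  have "AE \<omega> in M. \<forall>\<^sub>F k in sequentially. \<omega> \<in> space M - A k (s k)"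
  proof (rule borel_cantelli_AE1)
    show "summable (\<lambda>n. prob (A n (s n)))"
      using s(2) by (intro summable_comparison_test[OF _ summable_geometric[of "1/2"]])
        (auto intro!: exI[of _ 0] less_imp_le)
  qed (simp_all add: less_top[symmetric])
  then have "AE \<omega> in M. \<forall>i. (\<lambda>n. X i (s n) \<omega>) \<longlonglongrightarrow> 0"
  proof (rule AE_mp, intro AE_I2 impI allI)
    fix \<omega> i assume \<omega>: "\<omega> \<in> space M" and ev: "\<forall>\<^sub>F k in sequentially. \<omega> \<in> space M - A k (s k)"
    have "\<forall>\<^sub>F k in sequentially. \<bar>X i (s k) \<omega>\<bar> \<le> (1/2)^k"
      using ev eventually_ge_at_top[of i] by eventually_elim (auto simp: A_def \<omega> not_less)
    then have "\<forall>\<^sub>F k in sequentially. norm (X i (s k) \<omega>) \<le> (1/2)^k" by simp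
    then show "(\<lambda>n. X i (s n) \<omega>) \<longlonglongrightarrow> 0"
      by (rule Lim_null_comparison) (rule LIMSEQ_power_zero, simp)
  qed
  with lim show ?thesis by blast
qed

text \<open>By Fatou the liminf has finite expectation, hence is finite almost surely. This bounds
  only infinitely many terms, and which ones depends on \<omega>; an almost sure bound on all terms
  would be false in general.\<close>

lemma AE_frequently_bounded:
  fixes X :: "nat \<Rightarrow> 'a \<Rightarrow> real"
  assumes [measurable]: "\<And>n. X n \<in> borel_measurable M"
    and pos: "\<And>n \<omega>. \<omega> \<in> space M \<Longrightarrow> X n \<omega> \<ge> 0"
    and int: "\<And>n. integrable M (X n)" and bound: "\<And>n. expectation (X n) \<le> C"
  shows "AE \<omega> in M. \<exists>K. \<exists>\<^sub>F n in sequentially. X n \<omega> \<le> K"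
proof -
  have "(\<integral>\<^sup>+\<omega>. liminf (\<lambda>n. ennreal (X n \<omega>)) \<partial>M) \<le> liminf (\<lambda>n. \<integral>\<^sup>+\<omega>. ennreal (X n \<omega>) \<partial>M)"
    by (rule nn_integral_liminf) measurable
  also have "\<dots> = liminf (\<lambda>n. ennreal (expectation (X n)))"
    by (simp add: nn_integral_eq_integral int pos AE_I2)
  also have "\<dots> \<le> liminf (\<lambda>n::nat. ennreal C)"
    by (intro Liminf_mono always_eventually allI ennreal_leI bound)
  also have "\<dots> < \<infinity>" by (simp add: Liminf_const)
  finally have "(\<integral>\<^sup>+\<omega>. liminf (\<lambda>n. ennreal (X n \<omega>)) \<partial>M) \<noteq> \<infinity>" by simp
  then have "AE \<omega> in M. liminf (\<lambda>n. ennreal (X n \<omega>)) \<noteq> \<infinity>"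
    by (intro nn_integral_PInf_AE) measurable
  then show ?thesis
  proof (rule AE_mp, intro AE_I2 impI)
    fix \<omega> assume \<omega>: "\<omega> \<in> space M" "liminf (\<lambda>n. ennreal (X n \<omega>)) \<noteq> \<infinity>"
    show "\<exists>K. \<exists>\<^sub>F n in sequentially. X n \<omega> \<le> K"
    proof (rule ccontr)
      assume "\<not> (\<exists>K. \<exists>\<^sub>F n in sequentially. X n \<omega> \<le> K)"
      then have ev: "\<forall>\<^sub>F n in sequentially. X n \<omega> > K" for K
        by (auto simp: not_frequently not_le)
      have "ennreal K \<le> liminf (\<lambda>n. ennreal (X n \<omega>))" for K
        by (rule Liminf_bounded) (use ev[of K] in eventually_elim, simp add: ennreal_leI)
      then have "liminf (\<lambda>n. ennreal (X n \<omega>)) = \<infinity>"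
        by (metis ennreal_cases ennreal_less_iff gt_ex infinity_ennreal_def leD linorder_le_cases order.trans top.extremum_unique)
      with \<omega> show False by simp
    qed
  qed
qed

lemma tendsto_prob_of_expectation:
  fixes X :: "nat \<Rightarrow> 'a \<Rightarrow> real"
  assumes int: "\<And>n. integrable M (X n)" and pos: "\<And>n \<omega>. \<omega> \<in> space M \<Longrightarrow> X n \<omega> \<ge> 0"
    and lim: "(\<lambda>n. expectation (X n)) \<longlonglongrightarrow> 0" and "\<epsilon> > 0"
  shows "(\<lambda>n. prob {\<omega>\<in>space M. \<bar>X n \<omega>\<bar> > \<epsilon>}) \<longlonglongrightarrow> 0"
proof (rule tendsto_sandwich[OF _ _ tendsto_const])
  show "\<forall>\<^sub>F n in sequentially. prob {\<omega>\<in>space M. \<bar>X n \<omega>\<bar> > \<epsilon>} \<le> expectation (X n) / \<epsilon>"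
  proof (intro always_eventually allI)
    fix n
    have [measurable]: "X n \<in> borel_measurable M" using int by simp
    have "prob {\<omega>\<in>space M. \<bar>X n \<omega>\<bar> > \<epsilon>} \<le> prob {\<omega>\<in>space M. X n \<omega> \<ge> \<epsilon>}"
      by (rule finite_measure_mono) (use pos in auto)
    also have "\<dots> \<le> expectation (X n) / \<epsilon>"
      by (rule integral_Markov_inequality_measure[where A="{}"]) (use int pos \<open>\<epsilon> > 0\<close> in auto)
    finally show "prob {\<omega>\<in>space M. \<bar>X n \<omega>\<bar> > \<epsilon>} \<le> expectation (X n) / \<epsilon>" .
  qed
  show "(\<lambda>n. expectation (X n) / \<epsilon>) \<longlonglongrightarrow> 0"
    using tendsto_divide[OF lim tendsto_const[of \<epsilon>]] \<open>\<epsilon> > 0\<close> by simp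
qed simp

end

section \<open>Truncated quadratic variation and the Ito isometry\<close>

text \<open>The Huber function of robust statistics: the square on [-c, c], continued by its tangent
  lines. It is convex with derivative bounded by 2 c.\<close>

definition huber :: "real \<Rightarrow> real \<Rightarrow> real" where
  "huber c x = (if \<bar>x\<bar> \<le> c then x\<^sup>2 else 2 * c * \<bar>x\<bar> - c\<^sup>2)"

lemma huber_nonneg: "c \<ge> 0 \<Longrightarrow> huber c x \<ge> 0"
proof -
  assume "c \<ge> 0"
  moreover have "2 * c * \<bar>x\<bar> - c\<^sup>2 \<ge> 0" if "\<bar>x\<bar> > c"
  proof -
    have "c * c \<le> c * \<bar>x\<bar>" "0 \<le> c * \<bar>x\<bar>"
      using mult_left_mono[of c "\<bar>x\<bar>" c] that \<open>c \<ge> 0\<close> by simp_all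
    then show ?thesis by (simp add: power2_eq_square)
  qed
  ultimately show ?thesis by (simp add: huber_def)
qed

lemma huber_le: "c \<ge> 0 \<Longrightarrow> huber c x \<le> 2 * c * \<bar>x\<bar>"
proof -
  assume c: "c \<ge> 0"
  have "x\<^sup>2 \<le> 2 * c * \<bar>x\<bar>" if "\<bar>x\<bar> \<le> c"
  proof -
    have "\<bar>x\<bar> * \<bar>x\<bar> \<le> c * \<bar>x\<bar>" "0 \<le> c * \<bar>x\<bar>"
      using mult_right_mono[of "\<bar>x\<bar>" c "\<bar>x\<bar>"] that c by simp_all
    then show ?thesis by (simp add: power2_eq_square)
  qed
  then show ?thesis by (simp add: huber_def)
qed

text \<open>\<open>2 * max (- c) (min c x)\<close> is the derivative of \<open>huber c\<close> at
  \<open>x\<close>, so this is the supporting line inequality. Between two points of [-c, c], where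
  the function is the square, the gap is exactly \<open>(y - x)\<^sup>2\<close>.\<close>

lemma huber_convex:
  assumes "c \<ge> 0"
  shows "huber c x + 2 * max (- c) (min c x) * (y - x) + (if \<bar>x\<bar> \<le> c \<and> \<bar>y\<bar> \<le> c then (y - x)\<^sup>2 else 0)
    \<le> huber c y"
proof (cases "\<bar>x\<bar> \<le> c")
  case x: True
  then have m: "max (- c) (min c x) = x" by auto
  show ?thesis
  proof (cases "\<bar>y\<bar> \<le> c")
    case True
    then show ?thesis using x m by (simp add: huber_def power2_eq_square algebra_simps)
  next
    case False
    have "x * y \<le> \<bar>x\<bar> * \<bar>y\<bar>" by (metis abs_ge_self abs_mult)
    \<comment> \<open>After \<open>x * y\<close> is replaced by its upper bound, the gap factors
      into these two nonnegative terms.\<close>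
    moreover have "0 \<le> (c - \<bar>x\<bar>) * (2 * \<bar>y\<bar> - c - \<bar>x\<bar>)"
      using x False by (intro mult_nonneg_nonneg) auto
    moreover have "\<bar>x\<bar> * \<bar>x\<bar> = x * x" by simp
    ultimately show ?thesis using x False m
      by (simp add: huber_def power2_eq_square algebra_simps)
  qed
next
  case x: False
  have "huber c x + 2 * max (- c) (min c x) * (y - x) = 2 * sgn x * c * y - c\<^sup>2"
    using x assms by (auto simp: huber_def sgn_if max_def min_def power2_eq_square algebra_simps)
  also have "\<dots> \<le> huber c y"
  proof -
    have "0 \<le> (y - c)\<^sup>2" "0 \<le> (y + c)\<^sup>2" by auto
    moreover have "c * y \<le> c * \<bar>y\<bar>" "- (c * y) \<le> c * \<bar>y\<bar>"
      using mult_left_mono[of y "\<bar>y\<bar>" c] mult_left_mono[of "- y" "\<bar>y\<bar>" c] assms by auto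
    ultimately show ?thesis using x assms
      by (auto simp: huber_def sgn_if power2_eq_square algebra_simps)
  qed
  finally show ?thesis using x by simp
qed

lemma borel_measurable_huber [measurable]: "huber c \<in> borel_measurable borel"
  unfolding huber_def by measurable

locale filtered_prob = prob_space P for P :: "'w measure" +
  fixes F :: "real \<Rightarrow> 'w measure"
  assumes space_F [simp]: "space (F t) = space P"
    and sets_F: "sets (F t) \<subseteq> sets P"
    and sets_F_mono: "s \<le> t \<Longrightarrow> sets (F s) \<subseteq> sets (F t)"
begin

lemma measurable_F: "f \<in> measurable (F t) N \<Longrightarrow> f \<in> measurable P N"
  using sets_F[of t] by (auto simp: measurable_def)

lemma measurable_F_mono: "f \<in> measurable (F s) N \<Longrightarrow> s \<le> t \<Longrightarrow> f \<in> measurable (F t) N"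
  using sets_F_mono[of s t] by (auto simp: measurable_def)

lemma subalgebra_F: "subalgebra P (F t)"
  using sets_F by (simp add: subalgebra_def)

text \<open>Hypothesis \<open>z\<close> says that the conditional expectation of \<open>d\<close>
  given \<open>F s\<close> vanishes, and a bounded \<open>F s\<close>-measurable factor can be
  pulled out of it.\<close>

lemma expectation_mult_eq_0:
  fixes d \<psi> :: "'w \<Rightarrow> real"
  assumes d: "integrable P d" and z: "\<And>E. E \<in> sets (F s) \<Longrightarrow> set_lebesgue_integral P E d = 0"
    and \<psi>: "\<psi> \<in> borel_measurable (F s)" and b: "\<And>\<omega>. \<omega> \<in> space P \<Longrightarrow> \<bar>\<psi> \<omega>\<bar> \<le> c"
  shows "integrable P (\<lambda>\<omega>. \<psi> \<omega> * d \<omega>)" "expectation (\<lambda>\<omega>. \<psi> \<omega> * d \<omega>) = 0"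
proof -
  interpret finite_measure_subalgebra P "F s"
    by unfold_locales (rule subalgebra_F)
  have [measurable]: "\<psi> \<in> borel_measurable P" using \<psi> by (rule measurable_F)
  show int: "integrable P (\<lambda>\<omega>. \<psi> \<omega> * d \<omega>)"
  proof (rule Bochner_Integration.integrable_bound)
    show "integrable P (\<lambda>\<omega>. c * \<bar>d \<omega>\<bar>)" using d by auto
    show "AE \<omega> in P. norm (\<psi> \<omega> * d \<omega>) \<le> norm (c * \<bar>d \<omega>\<bar>)"
    proof (rule AE_I2)
      fix \<omega> assume "\<omega> \<in> space P"
      from b[OF this] show "norm (\<psi> \<omega> * d \<omega>) \<le> norm (c * \<bar>d \<omega>\<bar>)"
        by (auto simp: abs_mult intro!: mult_right_mono)
    qed
  qed (use d in measurable)
  have "AE \<omega> in P. real_cond_exp P (F s) d \<omega> = 0"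
    by (rule real_cond_exp_charact) (use d z in \<open>auto simp: set_lebesgue_integral_def\<close>)
  then have "expectation (\<lambda>\<omega>. \<psi> \<omega> * real_cond_exp P (F s) d \<omega>) = expectation (\<lambda>\<omega>. 0)"
    by (intro integral_cong_AE) (use \<psi> in \<open>auto intro: measurable_F\<close>)
  then show "expectation (\<lambda>\<omega>. \<psi> \<omega> * d \<omega>) = 0"
    using real_cond_exp_intg(2)[OF int \<psi>] d by simp
qed

text \<open>
  The convex Huber function of a martingale is a submartingale; its compensator dominates the squared increments
  between values bounded by \<open>c\<close>, while its growth is only linear, so integrability of \<open>m\<close> is enough.
\<close>

lemma martingale_truncated_quadratic_variation:
  fixes m :: "real \<Rightarrow> 'w \<Rightarrow> real" and \<tau> :: "nat \<Rightarrow> real"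
  assumes m: "martingale P F m" and c: "c \<ge> 0"
    and \<tau>: "\<And>k. k < N \<Longrightarrow> \<tau> k \<le> \<tau> (Suc k)" "\<tau> 0 = 0"
  defines "Q \<equiv> \<lambda>\<omega>. \<Sum>k<N. if \<bar>m (\<tau> k) \<omega>\<bar> \<le> c \<and> \<bar>m (\<tau> (Suc k)) \<omega>\<bar> \<le> c
      then (m (\<tau> (Suc k)) \<omega> - m (\<tau> k) \<omega>)\<^sup>2 else 0"
  shows "integrable P Q" "expectation Q \<le> 2 * c * expectation (\<lambda>\<omega>. \<bar>m (\<tau> N) \<omega>\<bar>)"
proof -
  have \<tau>0: "0 \<le> \<tau> k" if "k \<le> N" for k
    using that by (induction k) (use \<tau> in \<open>auto intro: order_trans simp: Suc_le_eq less_imp_le\<close>)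
  have mF: "m s \<in> borel_measurable (F s)" if "0 \<le> s" for s
    using m that by (auto simp: martingale_def adapted_def)
  have int: "integrable P (m s)" if "0 \<le> s" for s
    using m that by (auto simp: martingale_def)
  have mP: "m s \<in> borel_measurable P" if "0 \<le> s" for s
    using mF[OF that] by (rule measurable_F)
  define q where "q k \<omega> = (if \<bar>m (\<tau> k) \<omega>\<bar> \<le> c \<and> \<bar>m (\<tau> (Suc k)) \<omega>\<bar> \<le> c
      then (m (\<tau> (Suc k)) \<omega> - m (\<tau> k) \<omega>)\<^sup>2 else 0)" for k \<omega>
  have Q: "Q = (\<lambda>\<omega>. \<Sum>k<N. q k \<omega>)" by (simp add: Q_def q_def)
  have q_int: "integrable P (q k)" if "k < N" for k
  proof (rule integrable_const_bound[where B="(2 * c)\<^sup>2"])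
    have [measurable]: "m (\<tau> k) \<in> borel_measurable P" "m (\<tau> (Suc k)) \<in> borel_measurable P"
      using that by (auto intro!: mP \<tau>0)
    show "q k \<in> borel_measurable P" unfolding q_def by measurable
    show "AE \<omega> in P. norm (q k \<omega>) \<le> (2 * c)\<^sup>2"
    proof (rule AE_I2)
      fix \<omega>
      have "(m (\<tau> (Suc k)) \<omega> - m (\<tau> k) \<omega>)\<^sup>2 \<le> (2 * c)\<^sup>2"
        if "\<bar>m (\<tau> k) \<omega>\<bar> \<le> c" "\<bar>m (\<tau> (Suc k)) \<omega>\<bar> \<le> c"
        by (subst abs_le_square_iff[symmetric]) (use that in linarith)
      then show "norm (q k \<omega>) \<le> (2 * c)\<^sup>2" by (simp add: q_def)
    qed
  qed
  show "integrable P Q" unfolding Q by (intro Bochner_Integration.integrable_sum q_int) auto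
  have hub_int: "integrable P (\<lambda>\<omega>. huber c (m s \<omega>))" if "0 \<le> s" for s
  proof (rule Bochner_Integration.integrable_bound)
    show "integrable P (\<lambda>\<omega>. 2 * c * \<bar>m s \<omega>\<bar>)" using int[OF that] by auto
    show "AE \<omega> in P. norm (huber c (m s \<omega>)) \<le> norm (2 * c * \<bar>m s \<omega>\<bar>)"
      using huber_le[OF c] huber_nonneg[OF c] c by (auto simp: abs_mult)
    show "(\<lambda>\<omega>. huber c (m s \<omega>)) \<in> borel_measurable P"
      using mP[OF that] by measurable
  qed
  have step: "expectation (\<lambda>\<omega>. huber c (m (\<tau> k) \<omega>)) + expectation (q k)
      \<le> expectation (\<lambda>\<omega>. huber c (m (\<tau> (Suc k)) \<omega>))" if k: "k < N" for k
  proof -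
    \<comment> \<open>\<open>?\<psi>\<close> is the derivative of the Huber function at the left
      value: known at time \<open>\<tau> k\<close> and bounded by 2 c, so the linear term of
      \<open>huber_convex\<close> has mean 0.\<close>
    let ?\<psi> = "\<lambda>\<omega>. 2 * max (- c) (min c (m (\<tau> k) \<omega>))" and ?d = "\<lambda>\<omega>. m (\<tau> (Suc k)) \<omega> - m (\<tau> k) \<omega>"
    have k': "0 \<le> \<tau> k" "0 \<le> \<tau> (Suc k)" "\<tau> k \<le> \<tau> (Suc k)" using k \<tau>0 \<tau> by auto
    have "?\<psi> \<in> borel_measurable (F (\<tau> k))" using mF[OF k'(1)] by measurable
    moreover have "integrable P ?d" using k' int by auto
    moreover have "\<bar>?\<psi> \<omega>\<bar> \<le> 2 * c" for \<omega> using c by auto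
    moreover have "set_lebesgue_integral P E ?d = 0" if E: "E \<in> sets (F (\<tau> k))" for E
    proof -
      have "E \<in> sets P" using E sets_F by auto
      then have "set_integrable P E (m s)" if "s \<ge> 0" for s
        unfolding set_integrable_def using int[OF that] by (rule integrable_mult_indicator)
      then show ?thesis using m k' E by (simp add: martingale_def set_integral_diff)
    qed
    ultimately have \<psi>: "integrable P (\<lambda>\<omega>. ?\<psi> \<omega> * ?d \<omega>)" "expectation (\<lambda>\<omega>. ?\<psi> \<omega> * ?d \<omega>) = 0"
      using expectation_mult_eq_0[of ?d "\<tau> k" ?\<psi> "2 * c"] by blast+
    have "expectation (\<lambda>\<omega>. huber c (m (\<tau> k) \<omega>) + ?\<psi> \<omega> * ?d \<omega> + q k \<omega>)
        \<le> expectation (\<lambda>\<omega>. huber c (m (\<tau> (Suc k)) \<omega>))"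
    proof (rule integral_mono)
      show "integrable P (\<lambda>\<omega>. huber c (m (\<tau> k) \<omega>) + ?\<psi> \<omega> * ?d \<omega> + q k \<omega>)"
        using hub_int[OF k'(1)] \<psi>(1) q_int[OF k] by (intro Bochner_Integration.integrable_add)
    qed (use hub_int[OF k'(2)] huber_convex[OF c] in \<open>simp_all add: q_def\<close>)
    also have "expectation (\<lambda>\<omega>. huber c (m (\<tau> k) \<omega>) + ?\<psi> \<omega> * ?d \<omega> + q k \<omega>) =
      expectation (\<lambda>\<omega>. huber c (m (\<tau> k) \<omega>)) + expectation (q k)"
      using \<psi> hub_int[OF k'(1)] q_int[OF k] by simp
    finally show ?thesis .
  qed
  have "expectation (\<lambda>\<omega>. \<Sum>k<n. q k \<omega>) \<le> expectation (\<lambda>\<omega>. huber c (m (\<tau> n) \<omega>))" if "n \<le> N" for n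
    using that
  proof (induction n)
    case 0
    then show ?case using huber_nonneg[OF c] by simp
  next
    case (Suc n)
    have "expectation (\<lambda>\<omega>. \<Sum>k<Suc n. q k \<omega>) = expectation (\<lambda>\<omega>. \<Sum>k<n. q k \<omega>) + expectation (q n)"
      unfolding sum.lessThan_Suc
      using Suc.prems by (intro Bochner_Integration.integral_add Bochner_Integration.integrable_sum q_int) auto
    then show ?case using step[of n] Suc by simp
  qed
  from this[of N] have "expectation Q \<le> expectation (\<lambda>\<omega>. huber c (m (\<tau> N) \<omega>))" by (simp add: Q)
  also have "\<dots> \<le> expectation (\<lambda>\<omega>. 2 * c * \<bar>m (\<tau> N) \<omega>\<bar>)"
    using huber_le[OF c] \<tau>0[of N] int hub_int by (intro integral_mono) auto
  finally show "expectation Q \<le> 2 * c * expectation (\<lambda>\<omega>. \<bar>m (\<tau> N) \<omega>\<bar>)" by simp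
qed

end

section \<open>Wiener increments: independence, moments and the discrete Ito isometry\<close>

locale wiener_filtered = filtered_prob P F for P :: "'w measure" and F +
  fixes W :: "real \<Rightarrow> 'w \<Rightarrow> real"
  assumes wiener: "wiener_process P F W"
begin

lemma W_measurable_F: "0 \<le> t \<Longrightarrow> W t \<in> borel_measurable (F t)"
  using wiener by (auto simp: wiener_process_def adapted_def)

lemma W_measurable: "0 \<le> t \<Longrightarrow> W t \<in> borel_measurable P"
  using W_measurable_F measurable_F by blast

lemma W_distributed:
  "0 \<le> s \<Longrightarrow> s < t \<Longrightarrow> distributed P lborel (\<lambda>\<omega>. W t \<omega> - W s \<omega>) (normal_density 0 (sqrt (t - s)))"
  using wiener by (auto simp: wiener_process_def)

lemma W_increment_indep:
  fixes \<xi> :: "'w \<Rightarrow> real"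
  assumes "0 \<le> s" "s < t" and \<xi>: "\<xi> \<in> borel_measurable (F s)"
  shows "indep_var borel \<xi> borel (\<lambda>\<omega>. W t \<omega> - W s \<omega>)"
proof -
  have ind: "indep_set (sets (F s)) (sets (vimage_algebra (space P) (\<lambda>\<omega>. W t \<omega> - W s \<omega>) borel))"
    using wiener assms by (auto simp: wiener_process_def)
  have "sigma_sets (space P) {\<xi> -` A \<inter> space P |A. A \<in> sets borel} \<subseteq> sets (F s)"
    using measurable_sets[OF \<xi>] sets.top[of "F s"]
    by (intro sets.sigma_sets_subset') auto
  then have "indep_set (sigma_sets (space P) {\<xi> -` A \<inter> space P |A. A \<in> sets borel})
      (sets (vimage_algebra (space P) (\<lambda>\<omega>. W t \<omega> - W s \<omega>) borel))"
    unfolding indep_set_def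
    by (intro indep_sets_mono_sets[OF ind[unfolded indep_set_def]]) (auto split: bool.split)
  then show ?thesis
    using \<xi> W_measurable assms
    by (auto simp: indep_var_eq sets_vimage_algebra intro!: measurable_F[OF \<xi>])
qed

lemma W_increment_moments:
  assumes "0 \<le> s" "s \<le> t"
  shows "integrable P (\<lambda>\<omega>. W t \<omega> - W s \<omega>)" "expectation (\<lambda>\<omega>. W t \<omega> - W s \<omega>) = 0"
    "integrable P (\<lambda>\<omega>. (W t \<omega> - W s \<omega>)\<^sup>2)" "expectation (\<lambda>\<omega>. (W t \<omega> - W s \<omega>)\<^sup>2) = t - s"
proof -
  have "integrable P (\<lambda>\<omega>. W t \<omega> - W s \<omega>) \<and> expectation (\<lambda>\<omega>. W t \<omega> - W s \<omega>) = 0 \<and>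
    integrable P (\<lambda>\<omega>. (W t \<omega> - W s \<omega>)\<^sup>2) \<and> expectation (\<lambda>\<omega>. (W t \<omega> - W s \<omega>)\<^sup>2) = t - s"
  proof (cases "s = t")
    case False
    then have st: "sqrt (t - s) > 0" using assms by simp
    have d: "distributed P lborel (\<lambda>\<omega>. W t \<omega> - W s \<omega>) (normal_density 0 (sqrt (t - s)))"
      using W_distributed assms False by simp
    have "integrable P (\<lambda>\<omega>. (W t \<omega> - W s \<omega>) ^ k)" for k
      using distributed_integrable[OF d, of "\<lambda>x. x ^ k"] integrable_normal_moment[OF st, of 0 k]
      by (simp add: normal_density_nonneg)
    note int = this[of 1] this[of 2]
    have "(\<integral>x. normal_density 0 (sqrt (t - s)) x * x ^ k \<partial>lborel) = expectation (\<lambda>\<omega>. (W t \<omega> - W s \<omega>) ^ k)" for k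
      using distributed_integral[OF d, of "\<lambda>x. x ^ k"] by (simp add: normal_density_nonneg)
    from this[of 1] this[of 2] show ?thesis
      using int integral_normal_moment_odd[OF st, of 0 0] integral_normal_moment_even[OF st, of 0 1] assms
      by (simp add: fact_2)
  qed simp
  then show "integrable P (\<lambda>\<omega>. W t \<omega> - W s \<omega>)" "expectation (\<lambda>\<omega>. W t \<omega> - W s \<omega>) = 0"
    "integrable P (\<lambda>\<omega>. (W t \<omega> - W s \<omega>)\<^sup>2)" "expectation (\<lambda>\<omega>. (W t \<omega> - W s \<omega>)\<^sup>2) = t - s"
    by auto
qed

text \<open>Mixed terms vanish: the partial sum before step i, times \<open>\<xi> i\<close>, is
  \<open>F (\<tau> i)\<close>-measurable and hence independent of the next increment, which has mean
  0. Measurability and integrability of the partial sums therefore travel through the induction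
  together with the variance.\<close>

lemma ito_isometry:
  fixes \<xi> :: "nat \<Rightarrow> 'w \<Rightarrow> real" and \<tau> :: "nat \<Rightarrow> real"
  assumes \<tau>: "\<And>k. \<tau> k \<le> \<tau> (Suc k)" "0 \<le> \<tau> 0"
    and \<xi>: "\<And>k. k < n \<Longrightarrow> \<xi> k \<in> borel_measurable (F (\<tau> k))"
    and b: "\<And>k \<omega>. k < n \<Longrightarrow> \<omega> \<in> space P \<Longrightarrow> \<bar>\<xi> k \<omega>\<bar> \<le> c"
  defines "S \<equiv> \<lambda>\<omega>. \<Sum>k<n. \<xi> k \<omega> * (W (\<tau> (Suc k)) \<omega> - W (\<tau> k) \<omega>)"
  shows "integrable P (\<lambda>\<omega>. (S \<omega>)\<^sup>2)"
    "expectation (\<lambda>\<omega>. (S \<omega>)\<^sup>2) = (\<Sum>k<n. expectation (\<lambda>\<omega>. (\<xi> k \<omega>)\<^sup>2) * (\<tau> (Suc k) - \<tau> k))"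
proof -
  have \<tau>0: "0 \<le> \<tau> k" for k by (induction k) (use \<tau> order_trans in blast)+
  define d where "d k \<omega> = W (\<tau> (Suc k)) \<omega> - W (\<tau> k) \<omega>" for k \<omega>
  have dF: "d k \<in> borel_measurable (F (\<tau> (Suc k)))" for k
    using W_measurable_F[OF \<tau>0[of "Suc k"]] measurable_F_mono[OF W_measurable_F[OF \<tau>0[of k]] \<tau>(1)]
    unfolding d_def by measurable
  have dm: "integrable P (d k)" "expectation (d k) = 0"
    "integrable P (\<lambda>\<omega>. (d k \<omega>)\<^sup>2)" "expectation (\<lambda>\<omega>. (d k \<omega>)\<^sup>2) = \<tau> (Suc k) - \<tau> k" for k
    using W_increment_moments[OF \<tau>0 \<tau>(1)] unfolding d_def by blast+
  \<comment> \<open>Thanks to independence, integrability of \<open>\<psi>\<close> is enough; the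
    factor \<open>S' i \<omega> * \<xi> i \<omega>\<close> to which this is applied has no uniform
    bound at hand.\<close>
  have product: "integrable P (\<lambda>\<omega>. \<psi> \<omega> * d k \<omega>) \<and> expectation (\<lambda>\<omega>. \<psi> \<omega> * d k \<omega>) = 0"
    "integrable P (\<lambda>\<omega>. \<psi> \<omega> * (d k \<omega>)\<^sup>2) \<and>
     expectation (\<lambda>\<omega>. \<psi> \<omega> * (d k \<omega>)\<^sup>2) = expectation \<psi> * (\<tau> (Suc k) - \<tau> k)"
    if \<psi>: "\<psi> \<in> borel_measurable (F (\<tau> k))" "integrable P \<psi>" for \<psi> :: "'w \<Rightarrow> real" and k
  proof -
    have "(integrable P (\<lambda>\<omega>. \<psi> \<omega> * d k \<omega>) \<and> expectation (\<lambda>\<omega>. \<psi> \<omega> * d k \<omega>) = 0) \<and>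
      integrable P (\<lambda>\<omega>. \<psi> \<omega> * (d k \<omega>)\<^sup>2) \<and>
      expectation (\<lambda>\<omega>. \<psi> \<omega> * (d k \<omega>)\<^sup>2) = expectation \<psi> * (\<tau> (Suc k) - \<tau> k)"
    \<comment> \<open>Grid points may coincide, while \<open>wiener_process\<close> speaks only of s
      < t; a zero increment is treated separately.\<close>
    proof (cases "\<tau> k = \<tau> (Suc k)")
      case True
      then have "d k = (\<lambda>\<omega>. 0)" by (simp add: d_def fun_eq_iff)
      then show ?thesis using True by simp
    next
      case False
      then have "indep_var borel \<psi> borel (d k)"
        using W_increment_indep[OF \<tau>0 _ \<psi>(1)] \<tau>(1)[of k] unfolding d_def by (simp add: less_le)
      moreover from indep_var_compose[OF this, of "\<lambda>x. x" borel "\<lambda>x. x\<^sup>2" borel]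
      have "indep_var borel \<psi> borel (\<lambda>\<omega>. (d k \<omega>)\<^sup>2)" by (simp add: comp_def)
      ultimately show ?thesis
        using indep_var_lebesgue_integral[of \<psi> "d k"] indep_var_integrable[of \<psi> "d k"]
          indep_var_lebesgue_integral[of \<psi> "\<lambda>\<omega>. (d k \<omega>)\<^sup>2"] indep_var_integrable[of \<psi> "\<lambda>\<omega>. (d k \<omega>)\<^sup>2"]
          \<psi>(2) dm[of k] by simp
    qed
    then show "integrable P (\<lambda>\<omega>. \<psi> \<omega> * d k \<omega>) \<and> expectation (\<lambda>\<omega>. \<psi> \<omega> * d k \<omega>) = 0"
      "integrable P (\<lambda>\<omega>. \<psi> \<omega> * (d k \<omega>)\<^sup>2) \<and>
      expectation (\<lambda>\<omega>. \<psi> \<omega> * (d k \<omega>)\<^sup>2) = expectation \<psi> * (\<tau> (Suc k) - \<tau> k)" by auto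
  qed
  have int_\<xi>: "integrable P (\<lambda>\<omega>. \<xi> k \<omega> ^ p)" if "k < n" for k p
    using b[OF that] measurable_F[OF \<xi>[OF that]]
    by (intro integrable_const_bound[where B="c ^ p"]) (auto simp: power_abs intro!: power_mono)
  define S' where "S' i \<omega> = (\<Sum>k<i. \<xi> k \<omega> * d k \<omega>)" for i \<omega>
  have "S' i \<in> borel_measurable (F (\<tau> i)) \<and> integrable P (S' i) \<and> integrable P (\<lambda>\<omega>. (S' i \<omega>)\<^sup>2) \<and>
    expectation (\<lambda>\<omega>. (S' i \<omega>)\<^sup>2) = (\<Sum>k<i. expectation (\<lambda>\<omega>. (\<xi> k \<omega>)\<^sup>2) * (\<tau> (Suc k) - \<tau> k))"
    if "i \<le> n" for i
    using that
  proof (induction i)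
    case 0
    show ?case by (simp add: S'_def)
  next
    case (Suc i)
    then have i: "i < n" and IH: "S' i \<in> borel_measurable (F (\<tau> i))" "integrable P (S' i)"
      "integrable P (\<lambda>\<omega>. (S' i \<omega>)\<^sup>2)"
      "expectation (\<lambda>\<omega>. (S' i \<omega>)\<^sup>2) = (\<Sum>k<i. expectation (\<lambda>\<omega>. (\<xi> k \<omega>)\<^sup>2) * (\<tau> (Suc k) - \<tau> k))"
      by auto
    have S': "S' (Suc i) = (\<lambda>\<omega>. S' i \<omega> + \<xi> i \<omega> * d i \<omega>)" by (simp add: S'_def fun_eq_iff)
    have 1: "S' (Suc i) \<in> borel_measurable (F (\<tau> (Suc i)))"
      using measurable_F_mono[OF IH(1) \<tau>(1)] measurable_F_mono[OF \<xi>[OF i] \<tau>(1)] dF[of i]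
      unfolding S' by measurable
    have p1: "integrable P (\<lambda>\<omega>. \<xi> i \<omega> * d i \<omega>)"
      using product(1)[OF \<xi>[OF i]] int_\<xi>[OF i, of 1] by simp
    have "integrable P (\<lambda>\<omega>. (S' i \<omega> * \<xi> i \<omega>))"
    proof (rule Bochner_Integration.integrable_bound)
      show "integrable P (\<lambda>\<omega>. c * \<bar>S' i \<omega>\<bar>)" using IH(2) by auto
      show "(\<lambda>\<omega>. S' i \<omega> * \<xi> i \<omega>) \<in> borel_measurable P"
        using measurable_F[OF IH(1)] measurable_F[OF \<xi>[OF i]] by measurable
      show "AE \<omega> in P. norm (S' i \<omega> * \<xi> i \<omega>) \<le> norm (c * \<bar>S' i \<omega>\<bar>)"
      proof (rule AE_I2)
        fix \<omega> assume "\<omega> \<in> space P"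
        from b[OF i this] show "norm (S' i \<omega> * \<xi> i \<omega>) \<le> norm (c * \<bar>S' i \<omega>\<bar>)"
          by (auto simp: abs_mult mult.commute[of c] intro!: mult_left_mono)
      qed
    qed
    moreover have "(\<lambda>\<omega>. S' i \<omega> * \<xi> i \<omega>) \<in> borel_measurable (F (\<tau> i))"
      using IH(1) \<xi>[OF i] by measurable
    ultimately have p2: "integrable P (\<lambda>\<omega>. S' i \<omega> * \<xi> i \<omega> * d i \<omega>)"
      "expectation (\<lambda>\<omega>. S' i \<omega> * \<xi> i \<omega> * d i \<omega>) = 0"
      using product(1) by blast+
    have "(\<lambda>\<omega>. (\<xi> i \<omega>)\<^sup>2) \<in> borel_measurable (F (\<tau> i))" using \<xi>[OF i] by measurable
    then have p3: "integrable P (\<lambda>\<omega>. (\<xi> i \<omega>)\<^sup>2 * (d i \<omega>)\<^sup>2)"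
      "expectation (\<lambda>\<omega>. (\<xi> i \<omega>)\<^sup>2 * (d i \<omega>)\<^sup>2) = expectation (\<lambda>\<omega>. (\<xi> i \<omega>)\<^sup>2) * (\<tau> (Suc i) - \<tau> i)"
      using product(2) int_\<xi>[OF i, of 2] by blast+
    have sq: "(\<lambda>\<omega>. (S' (Suc i) \<omega>)\<^sup>2) = (\<lambda>\<omega>. (S' i \<omega>)\<^sup>2 + 2 * (S' i \<omega> * \<xi> i \<omega> * d i \<omega>) + (\<xi> i \<omega>)\<^sup>2 * (d i \<omega>)\<^sup>2)"
      unfolding S' by (simp add: fun_eq_iff power2_eq_square algebra_simps)
    show ?case
      unfolding sq using 1 IH p1 p2 p3 by (simp add: S')
  qed
  from this[of n] show "integrable P (\<lambda>\<omega>. (S \<omega>)\<^sup>2)"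
    "expectation (\<lambda>\<omega>. (S \<omega>)\<^sup>2) = (\<Sum>k<n. expectation (\<lambda>\<omega>. (\<xi> k \<omega>)\<^sup>2) * (\<tau> (Suc k) - \<tau> k))"
    by (simp_all add: S_def S'_def d_def)
qed

end

section \<open>Pathwise analysis of the trapezoidal sums\<close>

definition trapezoid :: "(real \<Rightarrow> real) \<Rightarrow> (real \<Rightarrow> complex) \<Rightarrow> real \<Rightarrow> nat \<Rightarrow> complex" where
  "trapezoid w z d J = (\<Sum>k<J. (w (real (Suc k) * d) - w (real k * d)) *\<^sub>R
     ((1/2) *\<^sub>R (z (real k * d) + z (real (Suc k) * d))))"

text \<open>Block \<open>j\<close> consists of \<open>m\<close> steps of length \<open>d\<close>.
  This is its left-point sum minus the one-step left-point sum: the oscillation of \<open>z\<close>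
  inside the block, integrated against \<open>w\<close>.\<close>

definition ito_error :: "(real \<Rightarrow> real) \<Rightarrow> (real \<Rightarrow> complex) \<Rightarrow> real \<Rightarrow> nat \<Rightarrow> nat \<Rightarrow> complex" where
  "ito_error w z d m j = (\<Sum>r<m. (w (real (Suc (j * m + r)) * d) - w (real (j * m + r) * d)) *\<^sub>R
     (z (real (j * m + r) * d) - z (real (j * m) * d)))"

text \<open>The change of the discrete covariation of \<open>w\<close> and \<open>z\<close> when
  block \<open>j\<close> is coarsened to a single step.\<close>

definition covariation_error :: "(real \<Rightarrow> real) \<Rightarrow> (real \<Rightarrow> complex) \<Rightarrow> real \<Rightarrow> nat \<Rightarrow> nat \<Rightarrow> complex" where
  "covariation_error w z d m j = (\<Sum>r<m. (w (real (Suc (j * m + r)) * d) - w (real (j * m + r) * d)) *\<^sub>R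
       (z (real (Suc (j * m + r)) * d) - z (real (j * m + r) * d)))
     - (w (real (Suc j * m) * d) - w (real (j * m) * d)) *\<^sub>R (z (real (Suc j * m) * d) - z (real (j * m) * d))"

definition quad_sum :: "(real \<Rightarrow> real) \<Rightarrow> (real \<Rightarrow> complex) \<Rightarrow> real \<Rightarrow> nat \<Rightarrow> real" where
  "quad_sum w z d M = (\<Sum>k<M. (w (real (Suc k) * d) - w (real k * d))\<^sup>2 +
     (norm (z (real (Suc k) * d) - z (real k * d)))\<^sup>2)"

lemma sum_blocks:
  fixes f :: "nat \<Rightarrow> 'b::comm_monoid_add"
  shows "(\<Sum>k<n * m. f k) = (\<Sum>j<n. \<Sum>r<m. f (j * m + r))"
proof (induction n)
  have sum_add: "(\<Sum>k<a + m. f k) = (\<Sum>k<a. f k) + (\<Sum>r<m. f (a + r))" for a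
    by (induction m) (simp_all add: add.assoc)
  case (Suc n)
  have "(\<Sum>k<Suc n * m. f k) = (\<Sum>k<n * m + m. f k)" by (simp add: add.commute)
  also have "\<dots> = (\<Sum>k<n * m. f k) + (\<Sum>r<m. f (n * m + r))"
    by (rule sum_add)
  finally show ?case by (simp add: Suc)
qed simp

text \<open>A trapezoidal sum is the left-point sum plus half the discrete covariation; comparing
  either part on the fine and on the coarse grid gives the two errors.\<close>

lemma trapezoid_block:
  "(\<Sum>r<m. (w (real (Suc (j * m + r)) * d) - w (real (j * m + r) * d)) *\<^sub>R
      ((1/2) *\<^sub>R (z (real (j * m + r) * d) + z (real (Suc (j * m + r)) * d))))
    - (w (real (Suc j * m) * d) - w (real (j * m) * d)) *\<^sub>R
        ((1/2) *\<^sub>R (z (real (j * m) * d) + z (real (Suc j * m) * d)))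
   = ito_error w z d m j + (1/2) *\<^sub>R covariation_error w z d m j"
proof -
  let ?W = "\<lambda>k. w (real k * d)" and ?Z = "\<lambda>k. z (real k * d)"
  have "f (a + m) - f a = (\<Sum>r<m. f (Suc (a + r)) - f (a + r))" for f :: "nat \<Rightarrow> real" and a
    by (induction m) auto
  from this[of ?W "j * m"] have W: "?W (Suc j * m) - ?W (j * m) = (\<Sum>r<m. ?W (Suc (j * m + r)) - ?W (j * m + r))"
    by (simp add: add.commute)
  have "(\<Sum>r<m. (?W (Suc (j * m + r)) - ?W (j * m + r)) *\<^sub>R ((1/2) *\<^sub>R (?Z (j * m + r) + ?Z (Suc (j * m + r))))) =
    (\<Sum>r<m. (?W (Suc (j * m + r)) - ?W (j * m + r)) *\<^sub>R (?Z (j * m + r) - ?Z (j * m))) +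
    (?W (Suc j * m) - ?W (j * m)) *\<^sub>R ?Z (j * m) +
    (1/2) *\<^sub>R (\<Sum>r<m. (?W (Suc (j * m + r)) - ?W (j * m + r)) *\<^sub>R (?Z (Suc (j * m + r)) - ?Z (j * m + r)))"
    unfolding W scaleR_sum_left scaleR_sum_right sum.distrib[symmetric]
    by (intro sum.cong refl) (simp add: algebra_simps scaleR_conv_of_real)
  then show ?thesis
    unfolding ito_error_def covariation_error_def
    by (simp add: algebra_simps scaleR_conv_of_real del: of_nat_Suc of_nat_mult of_nat_add mult_Suc)
qed

lemma trapezoid_refine:
  "trapezoid w z d (n * m) - trapezoid w z (real m * d) n =
    (\<Sum>j<n. ito_error w z d m j + (1/2) *\<^sub>R covariation_error w z d m j)"
  unfolding trapezoid_block[symmetric] trapezoid_def sum_blocks sum_subtractf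
  by (simp add: mult.assoc del: of_nat_Suc mult_Suc)

text \<open>Each product of increments is at most the sum of their squares, so one pathwise bound on
  the quadratic sums at both scales controls the total variation of the covariation errors.\<close>

lemma sum_covariation_error_le:
  "(\<Sum>j<n. norm (covariation_error w z d m j)) \<le>
    quad_sum w z d (n * m) + quad_sum w z (real m * d) n"
proof -
  have amgm: "norm (x *\<^sub>R y) \<le> x\<^sup>2 + (norm y)\<^sup>2" for x :: real and y :: complex
  proof -
    have "0 \<le> (\<bar>x\<bar> - norm y)\<^sup>2" "0 \<le> \<bar>x\<bar> * norm y" by auto
    moreover have "(\<bar>x\<bar> - norm y)\<^sup>2 = x\<^sup>2 + (norm y)\<^sup>2 - 2 * (\<bar>x\<bar> * norm y)"
      by (simp add: power2_diff)
    ultimately show ?thesis unfolding norm_scaleR by linarith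
  qed
  have "norm (covariation_error w z d m j) \<le>
    (\<Sum>r<m. (w (real (Suc (j * m + r)) * d) - w (real (j * m + r) * d))\<^sup>2 +
       (norm (z (real (Suc (j * m + r)) * d) - z (real (j * m + r) * d)))\<^sup>2) +
    ((w (real (Suc j * m) * d) - w (real (j * m) * d))\<^sup>2 +
      (norm (z (real (Suc j * m) * d) - z (real (j * m) * d)))\<^sup>2)" for j
    unfolding covariation_error_def
    by (intro order_trans[OF norm_triangle_ineq4] add_mono order_trans[OF norm_sum] sum_mono amgm)
  then have "(\<Sum>j<n. norm (covariation_error w z d m j)) \<le> (\<Sum>j<n.
    (\<Sum>r<m. (w (real (Suc (j * m + r)) * d) - w (real (j * m + r) * d))\<^sup>2 +
       (norm (z (real (Suc (j * m + r)) * d) - z (real (j * m + r) * d)))\<^sup>2) +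
    ((w (real (Suc j * m) * d) - w (real (j * m) * d))\<^sup>2 +
      (norm (z (real (Suc j * m) * d) - z (real (j * m) * d)))\<^sup>2))"
    by (intro sum_mono)
  then show ?thesis
    unfolding quad_sum_def sum_blocks
    by (simp add: sum.distrib mult.assoc del: of_nat_Suc mult_Suc)
qed

text \<open>With x = 2 y the expression is \<open>cis (- y)\<close> times 2 i (y cos y - sin y), and
  the derivative of y cos y - sin y is - y sin y, of second order. Averaging the two end values is
  what gains the third order; the left-point rule would leave a second order term.\<close>

lemma norm_cis_trapezoid_error:
  "norm (cis (- x) - 1 + \<i> * of_real x * ((1 + cis (- x)) / 2)) \<le> \<bar>x\<bar> ^ 3"
proof -
  define y where "y = x / 2"
  have x: "x = 2 * y" by (simp add: y_def)
  have "cis (- y) * (\<i> * of_real (2 * (y * cos y - sin y))) =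
      cis (- x) - 1 + \<i> * of_real x * ((1 + cis (- x)) / 2)"
  proof -
    have c: "cis (- y) * of_real (cos y) = (1 + cis (- x)) / 2"
      "cis (- y) * (\<i> * of_real (sin y)) = (1 - cis (- x)) / 2"
      using sin_cos_squared_add[of y]
      by (auto simp: complex_eq_iff x cos_double sin_double power2_eq_square)
    have "cis (- y) * (\<i> * of_real (2 * (y * cos y - sin y))) =
      \<i> * of_real x * (cis (- y) * of_real (cos y)) - 2 * (cis (- y) * (\<i> * of_real (sin y)))"
      by (simp add: x algebra_simps)
    also have "\<dots> = cis (- x) - 1 + \<i> * of_real x * ((1 + cis (- x)) / 2)"
      unfolding c by (simp add: field_simps)
    finally show ?thesis .
  qed
  then have "norm (cis (- x) - 1 + \<i> * of_real x * ((1 + cis (- x)) / 2)) = norm (of_real (2 * (y * cos y - sin y)) :: complex)"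
    by (metis norm_cis norm_ii norm_mult mult_1)
  also have "\<dots> = 2 * \<bar>y * cos y - sin y\<bar>" by (simp only: norm_of_real abs_mult abs_numeral)
  also have "\<bar>y * cos y - sin y\<bar> \<le> y\<^sup>2 * \<bar>y\<bar>"
  proof -
    have "norm ((\<lambda>y. y * cos y - sin y) y - (\<lambda>y. y * cos y - sin y) 0) \<le> y\<^sup>2 * norm (y - 0)"
    proof (rule field_differentiable_bound[where S="closed_segment 0 y" and f'="\<lambda>y. - (y * sin y)"])
      show "((\<lambda>y. y * cos y - sin y) has_field_derivative - (s * sin s)) (at s within closed_segment 0 y)" for s
        by (auto intro!: derivative_eq_intros)
      show "norm (- (s * sin s)) \<le> y\<^sup>2" if "s \<in> closed_segment 0 y" for s
      proof -
        have "\<bar>s\<bar> \<le> \<bar>y\<bar>" using that by (auto simp: closed_segment_eq_real_ivl split: if_splits)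
        moreover have "\<bar>sin s\<bar> \<le> \<bar>s\<bar>" by (rule abs_sin_x_le_abs_x)
        ultimately have "\<bar>s\<bar> * \<bar>sin s\<bar> \<le> \<bar>y\<bar> * \<bar>y\<bar>" by (intro mult_mono) auto
        then show ?thesis by (simp add: abs_mult power2_eq_square)
      qed
    qed auto
    then show ?thesis by simp
  qed
  also have "2 * (y\<^sup>2 * \<bar>y\<bar>) \<le> \<bar>x\<bar> ^ 3"
  proof -
    have "\<bar>x\<bar> ^ 3 = 8 * (y\<^sup>2 * \<bar>y\<bar>)"
      by (simp add: x power3_eq_cube power2_eq_square abs_mult)
    then show ?thesis by simp
  qed
  finally show ?thesis by simp
qed

text \<open>The product rule with averaged factors is exact for increments. In front of
  \<open>g\<close> and \<open>c\<close> the average of \<open>p\<close> and \<open>q\<close> is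
  rewritten as \<open>p + (q - p) / 2\<close>: the left-end weight suits the isometry and the block
  argument, and the remainder carries a small factor. The term \<open>h * Y\<close> is subtracted
  from the drift and returned to the last summand, which is the error of the chain rule.\<close>

lemma product_increment_split:
  fixes p q y y' Y :: complex
  assumes dz: "y' - y = \<i> * (k * a) * J + \<i> * k * (dw * Y + R + g + (1/2) * c)" and Y: "Y = (y + y') / 2"
  shows "q * y' - p * y = \<i> * k * ((p + q) / 2 * R + p * g + (q - p) * g / 2 + p * ((1/2) * c) + (q - p) * c / 4)
    + \<i> * (k * a) * ((p + q) / 2 * (J - h * Y)) + Y * ((q - p) + \<i> * (k * (dw + a * h)) * ((p + q) / 2))"
proof -
  have eq: "q * y' - p * y = (p + q) / 2 * (y' - y) + Y * (q - p)"
    by (simp add: Y field_simps)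
  show ?thesis unfolding eq dz by (simp add: field_simps)
qed

text \<open>
  The Stratonovich integral over a coarse interval, being a limit of fine trapezoidal sums, differs from the coarse
  trapezoid by \<open>ito_error + covariation_error / 2\<close>. The first part is small in square mean; the second one has
  bounded total variation and small sums over dyadic blocks, so weighting it by the continuous factor \<open>u\<close>,
  nearly constant on such blocks, does no harm.
\<close>

lemma pathwise_solution:
  fixes w :: "real \<Rightarrow> real" and z I :: "real \<Rightarrow> complex" and l m :: "nat \<Rightarrow> nat" and a \<kappa> t K :: real
  defines "h \<equiv> \<lambda>i. t / 2 ^ l i" and "d \<equiv> \<lambda>i. t / 2 ^ l i / real (m i)"
    and "u \<equiv> \<lambda>s. cis (- (\<kappa> * (w s + a * s)))"
  assumes t: "t > 0" and cw: "continuous_on {0..t} w" and cz: "continuous_on {0..t} z"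
    and l: "filterlim l at_top sequentially" and m: "\<And>i. m i \<ge> 1"
    and eq: "\<And>b J. J \<le> 2 ^ b \<Longrightarrow> z (real J * (t / 2 ^ b)) =
      z 0 + \<i> * of_real (\<kappa> * a) * integral {0..real J * (t / 2 ^ b)} z + \<i> * of_real \<kappa> * I (real J * (t / 2 ^ b))"
    and fine: "(\<lambda>i. \<Sum>J\<le>2 ^ l i. norm (I (real J * h i) - trapezoid w z (d i) (J * m i))) \<longlonglongrightarrow> 0"
    and ito_u: "(\<lambda>i. norm (\<Sum>j<2 ^ l i. u (real j * h i) * ito_error w z (d i) (m i) j)) \<longlonglongrightarrow> 0"
    and ito_sq: "(\<lambda>i. \<Sum>j<2 ^ l i. (norm (ito_error w z (d i) (m i) j))\<^sup>2) \<longlonglongrightarrow> 0"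
    and coarse: "\<And>b B. B \<le> 2 ^ b \<Longrightarrow>
      (\<lambda>i. norm (trapezoid w z (h i) (B * 2 ^ (l i - b)) - I (real B * (t / 2 ^ b)))) \<longlonglongrightarrow> 0"
    and ito_block: "\<And>b B. B \<le> 2 ^ b \<Longrightarrow>
      (\<lambda>i. norm (\<Sum>j<B * 2 ^ (l i - b). ito_error w z (d i) (m i) j)) \<longlonglongrightarrow> 0"
    and quad: "\<And>i. quad_sum w z (d i) (2 ^ l i * m i) + quad_sum w z (h i) (2 ^ l i) \<le> K"
  shows "u t * z t = u 0 * z 0"
proof -
  define x where "x i j = real j * h i" for i j
  have h0: "h i > 0" for i using t by (simp add: h_def)
  have hd: "h i = real (m i) * d i" for i using m[of i] by (simp add: h_def d_def)
  have x_fine: "real (j * m i) * d i = x i j" for i j by (simp add: x_def hd mult.assoc)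
  have xN: "x i (2 ^ l i) = t" and x0: "x i 0 = 0" for i by (simp_all add: x_def h_def)
  have x_mono: "x i j \<le> x i k" if "j \<le> k" for i j k
    using that h0[of i] by (simp add: x_def)
  have x_in: "x i j \<in> {0..t}" if "j \<le> 2 ^ l i" for i j
    using x_mono[OF that, of i] x_mono[of 0 j i] xN x0 by auto
  have hlim: "h \<longlonglongrightarrow> 0"
  proof -
    have "filterlim (\<lambda>i. (2::real) ^ l i) at_infinity sequentially"
      by (rule filterlim_compose[OF filterlim_realpow_sequentially_gt1 l]) simp
    then show ?thesis unfolding h_def by (intro tendsto_divide_0[OF tendsto_const])
  qed
  have small_h: "\<forall>\<^sub>F i in sequentially. h i < \<epsilon>" if "\<epsilon> > 0" for \<epsilon>
    using order_tendstoD(2)[OF hlim that] .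
  have osc: "\<exists>\<delta>>0. \<forall>r\<in>{0..t}. \<forall>s\<in>{0..t}. \<bar>r - s\<bar> < \<delta> \<longrightarrow> norm (f r - f s) < \<epsilon>"
    if "continuous_on {0..t} f" "\<epsilon> > 0" for f :: "real \<Rightarrow> 'b::real_normed_vector" and \<epsilon>
    using compact_uniformly_continuous[OF that(1)] that(2)
    unfolding uniformly_continuous_on_def dist_norm by (metis compact_Icc real_norm_def)
  have osc_step: "\<forall>\<^sub>F i in sequentially. \<forall>j<2 ^ l i. \<forall>r\<in>{x i j..x i (Suc j)}. \<forall>s\<in>{x i j..x i (Suc j)}. norm (f r - f s) < \<epsilon>"
    if f: "continuous_on {0..t} f" "\<epsilon> > 0" for f :: "real \<Rightarrow> 'b::real_normed_vector" and \<epsilon>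
  proof -
    obtain \<delta> where \<delta>: "\<delta> > 0" "\<And>r s. r\<in>{0..t} \<Longrightarrow> s\<in>{0..t} \<Longrightarrow> \<bar>r - s\<bar> < \<delta> \<Longrightarrow> norm (f r - f s) < \<epsilon>"
      using osc[OF f] by metis
    show ?thesis
      using small_h[OF \<delta>(1)]
    proof eventually_elim
      case (elim i)
      show ?case
      proof (intro allI impI ballI)
        fix j r s assume j: "j < 2 ^ l i" and rs: "r \<in> {x i j..x i (Suc j)}" "s \<in> {x i j..x i (Suc j)}"
        have "x i (Suc j) - x i j = h i" by (simp add: x_def algebra_simps)
        then have "\<bar>r - s\<bar> < \<delta>" using rs elim by auto
        moreover have "r \<in> {0..t}" "s \<in> {0..t}"
          using rs x_in[of j i] x_in[of "Suc j" i] j by auto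
        ultimately show "norm (f r - f s) < \<epsilon>" using \<delta>(2) by blast
      qed
    qed
  qed
  have cu: "continuous_on {0..t} u"
    unfolding u_def cis_conv_exp by (intro continuous_intros cw)
  have cv: "continuous_on {0..t} (\<lambda>s. \<kappa> * (w s + a * s))" by (intro continuous_intros cw)
  obtain C where C: "C > 0" "\<And>s. s \<in> {0..t} \<Longrightarrow> norm (z s) \<le> C"
    using compact_imp_bounded[OF compact_continuous_image[OF cz compact_Icc]]
    by (auto simp: bounded_pos)
  have nu [simp]: "norm (u s) = 1" for s by (simp add: u_def)
  \<comment> \<open>For the coarse interval from \<open>x i j\<close> to \<open>x i (Suc j)\<close>,
    the prefix m marks the average of the two end values and the prefix d the increment.\<close>
  define U where "U i j = u (x i j)" for i j
  define Z where "Z i j = z (x i j)" for i j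
  define dw where "dw i j = w (x i (Suc j)) - w (x i j)" for i j
  define mU where "mU i j = (1/2) *\<^sub>R (U i j + U i (Suc j))" for i j
  define mZ where "mZ i j = (1/2) *\<^sub>R (Z i j + Z i (Suc j))" for i j
  define dU where "dU i j = U i (Suc j) - U i j" for i j
  define J where "J i j = integral {x i j..x i (Suc j)} z" for i j
  define g where "g i j = ito_error w z (d i) (m i) j" for i j
  define c where "c i j = covariation_error w z (d i) (m i) j" for i j
  \<comment> \<open>Error of the fine trapezoid at a coarse point. Hypothesis \<open>fine\<close>
    lets the sum of these errors over all coarse points vanish, so their differences may be
    estimated by the triangle inequality alone.\<close>
  define R where "R i j = I (x i j) - trapezoid w z (d i) (j * m i)" for i j
  define N where "N i = (2::nat) ^ l i" for i
  have nU [simp]: "norm (U i j) = 1" for i j by (simp add: U_def)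
  have nmU: "norm (mU i j) \<le> 1" for i j
    using norm_triangle_ineq[of "U i j" "U i (Suc j)"] by (simp add: mU_def)
  have nmZ: "norm (mZ i j) \<le> C" if "j < N i" for i j
    using norm_triangle_ineq[of "Z i j" "Z i (Suc j)"] C(2)[OF x_in[of j i]] C(2)[OF x_in[of "Suc j" i]] that
    by (simp add: mZ_def Z_def N_def)
  have zint: "z integrable_on {r..s}" if "0 \<le> r" "s \<le> t" for r s
    by (rule integrable_continuous_interval, rule continuous_on_subset[OF cz]) (use that in auto)
  have dZ: "Z i (Suc j) - Z i j = \<i> * of_real (\<kappa> * a) * J i j + \<i> * of_real \<kappa> * (I (x i (Suc j)) - I (x i j))"
    if "j < N i" for i j
  proof -
    have "integral {0..x i j} z + J i j = integral {0..x i (Suc j)} z"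
      unfolding J_def
      by (rule Henstock_Kurzweil_Integration.integral_combine)
         (use that x_in[of j i] x_in[of "Suc j" i] x_mono[of j "Suc j" i] in \<open>auto intro!: zint simp: N_def\<close>)
    moreover have "Z i k = z 0 + \<i> * of_real (\<kappa> * a) * integral {0..x i k} z + \<i> * of_real \<kappa> * I (x i k)"
      if "k \<le> N i" for k using eq[of k "l i"] that by (simp add: Z_def x_def h_def N_def)
    from this[of j] this[of "Suc j"]
    have "Z i (Suc j) - Z i j = \<i> * of_real (\<kappa> * a) * (integral {0..x i (Suc j)} z - integral {0..x i j} z)
      + \<i> * of_real \<kappa> * (I (x i (Suc j)) - I (x i j))"
      using \<open>j < N i\<close> by (simp add: algebra_simps)
    ultimately show ?thesis by (metis add_diff_cancel_left')
  qed
  \<comment> \<open>The integral is exchanged for its fine trapezoid at the cost of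
    \<open>R\<close>, and \<open>trapezoid_block\<close> exchanges the block of the fine trapezoid
    for the coarse one.\<close>
  have dI: "I (x i (Suc j)) - I (x i j) = dw i j *\<^sub>R mZ i j + (R i (Suc j) - R i j) + g i j + (1/2) *\<^sub>R c i j" for i j
  proof -
    have "trapezoid w z (d i) (Suc j * m i) = trapezoid w z (d i) (j * m i) +
      (\<Sum>r<m i. (w (real (Suc (j * m i + r)) * d i) - w (real (j * m i + r) * d i)) *\<^sub>R
      ((1/2) *\<^sub>R (z (real (j * m i + r) * d i) + z (real (Suc (j * m i + r)) * d i))))"
      unfolding trapezoid_def sum_blocks by simp
    also note trapezoid_block[where m="m i" and w=w and j=j and d="d i" and z=z, unfolded diff_eq_eq]
    finally show ?thesis
      unfolding x_fine R_def g_def c_def by (simp add: dw_def mZ_def Z_def algebra_simps)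
  qed
  \<comment> \<open>Increment of the phase \<open>\<kappa> * (w s + a * s)\<close> over one coarse
    interval.\<close>
  define V where "V i j = \<kappa> * (dw i j + a * h i)" for i j
  have dU: "U i (Suc j) = U i j * cis (- V i j)" for i j
    unfolding U_def u_def cis_mult V_def dw_def
    by (rule arg_cong[where f=cis]) (simp add: x_def algebra_simps)
  \<comment> \<open>From (x + y)^2 \<le> 2 x^2 + 2 y^2: the squares of \<open>dw\<close> add up to
    at most \<open>K\<close>, and h^2 \<le> t h adds up to at most t^2.\<close>
  define D where "D = 2 * \<kappa>\<^sup>2 * (K + a\<^sup>2 * t\<^sup>2)"
  have sumh: "(\<Sum>j<N i. h i) = t" for i by (simp add: N_def h_def)
  have dw2: "(\<Sum>j<N i. (dw i j)\<^sup>2) \<le> K" for i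
  proof -
    have "(\<Sum>j<N i. (dw i j)\<^sup>2) \<le> quad_sum w z (h i) (N i)"
      unfolding quad_sum_def by (intro sum_mono) (simp add: dw_def x_def)
    moreover have "0 \<le> quad_sum w z (d i) (2 ^ l i * m i)"
      unfolding quad_sum_def by (intro sum_nonneg) auto
    ultimately show ?thesis using quad[of i] by (simp add: N_def)
  qed
  have V2: "(\<Sum>j<N i. (V i j)\<^sup>2) \<le> D" for i
  proof -
    have "(V i j)\<^sup>2 \<le> 2 * \<kappa>\<^sup>2 * (dw i j)\<^sup>2 + 2 * \<kappa>\<^sup>2 * a\<^sup>2 * t * h i" if "j < N i" for j
    proof -
      have "h i \<le> t" using t by (simp add: h_def field_simps)
      then have "h i * h i \<le> t * h i" using h0[of i] by (intro mult_right_mono) auto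
      then have "2 * \<kappa>\<^sup>2 * a\<^sup>2 * (h i * h i) \<le> 2 * \<kappa>\<^sup>2 * a\<^sup>2 * (t * h i)" by (intro mult_left_mono) auto
      moreover have "(V i j)\<^sup>2 \<le> \<kappa>\<^sup>2 * (2 * (dw i j)\<^sup>2 + 2 * (a * h i)\<^sup>2)"
        unfolding V_def power_mult_distrib[of \<kappa>]
        using sum_squares_bound[of "dw i j" "a * h i"]
        by (intro mult_left_mono) (auto simp: power2_sum)
      ultimately show ?thesis by (simp add: power2_eq_square algebra_simps)
    qed
    then have "(\<Sum>j<N i. (V i j)\<^sup>2) \<le> (\<Sum>j<N i. 2 * \<kappa>\<^sup>2 * (dw i j)\<^sup>2 + 2 * \<kappa>\<^sup>2 * a\<^sup>2 * t * h i)"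
      by (intro sum_mono) auto
    also have "\<dots> = 2 * \<kappa>\<^sup>2 * (\<Sum>j<N i. (dw i j)\<^sup>2) + 2 * \<kappa>\<^sup>2 * a\<^sup>2 * t * (\<Sum>j<N i. h i)"
      by (simp only: sum.distrib sum_distrib_left)
    also have "\<dots> \<le> 2 * \<kappa>\<^sup>2 * K + 2 * \<kappa>\<^sup>2 * a\<^sup>2 * t * t"
      unfolding sumh using dw2 by (intro add_right_mono mult_left_mono) auto
    finally show ?thesis by (simp add: D_def distrib_left power2_eq_square mult.assoc)
  qed
  have D0: "D \<ge> 0" by (rule order_trans[OF sum_nonneg V2]) simp
  have K0: "K \<ge> 0" by (rule order_trans[OF sum_nonneg dw2]) simp
  have ndU: "norm (dU i j) \<le> \<bar>V i j\<bar>" for i j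
  proof -
    have "dU i j = U i j * (cis (- V i j) - 1)" by (simp add: dU_def dU algebra_simps)
    then have "norm (dU i j) = norm (cis (- V i j) - 1)" by (simp add: norm_mult)
    also have "\<dots> \<le> \<bar>V i j\<bar>"
      using iexp_approx1[of "- V i j" 0] by (simp add: cis_conv_exp)
    finally show ?thesis .
  qed
  have c_sum: "(\<Sum>j<N i. norm (c i j)) \<le> K" for i
    using order_trans[OF sum_covariation_error_le quad[of i, unfolded hd]] by (simp add: c_def N_def)
  have to0: "f \<longlonglongrightarrow> 0" if "\<And>\<epsilon>. \<epsilon> > 0 \<Longrightarrow> \<forall>\<^sub>F i in sequentially. norm (f i) \<le> B * \<epsilon>" and "B \<ge> 0"
    for f :: "nat \<Rightarrow> complex" and B :: real
  proof (rule tendstoI)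
    fix \<epsilon> :: real assume "\<epsilon> > 0"
    then have "\<epsilon> / (B + 1) > 0" using that(2) by simp
    from that(1)[OF this] show "\<forall>\<^sub>F i in sequentially. dist (f i) 0 < \<epsilon>"
    proof eventually_elim
      case (elim i)
      also have "B * (\<epsilon> / (B + 1)) < \<epsilon>" using \<open>\<epsilon> > 0\<close> that(2) by (simp add: field_simps)
      finally show ?case by simp
    qed
  qed
  \<comment> \<open>Cauchy-Schwarz: the squares of \<open>dU\<close> have sum at most
    \<open>D\<close>, and the squares of the Ito errors have sums tending to 0.\<close>
  have ito: "(\<lambda>i. \<Sum>j<N i. dU i j * g i j) \<longlonglongrightarrow> 0"
  proof (rule Lim_null_comparison)
    show "\<forall>\<^sub>F i in sequentially. norm (\<Sum>j<N i. dU i j * g i j) \<le>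
        sqrt D * sqrt (\<Sum>j<2 ^ l i. (norm (ito_error w z (d i) (m i) j))\<^sup>2)"
    proof (intro always_eventually allI)
      fix i
      have "norm (\<Sum>j<N i. dU i j * g i j) \<le> (\<Sum>j<N i. \<bar>\<bar>V i j\<bar>\<bar> * \<bar>norm (g i j)\<bar>)"
        by (rule order_trans[OF norm_sum]) (auto simp: norm_mult intro!: sum_mono mult_right_mono ndU)
      also have "\<dots> \<le> L2_set (\<lambda>j. \<bar>V i j\<bar>) {..<N i} * L2_set (\<lambda>j. norm (g i j)) {..<N i}"
        by (rule L2_set_mult_ineq)
      also have "\<dots> \<le> sqrt D * sqrt (\<Sum>j<N i. (norm (g i j))\<^sup>2)"
        unfolding L2_set_def using V2[of i] D0 by (intro mult_mono) (auto intro: sum_nonneg)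
      finally show "norm (\<Sum>j<N i. dU i j * g i j) \<le>
        sqrt D * sqrt (\<Sum>j<2 ^ l i. (norm (ito_error w z (d i) (m i) j))\<^sup>2)"
        by (simp add: N_def g_def)
    qed
    show "(\<lambda>i. sqrt D * sqrt (\<Sum>j<2 ^ l i. (norm (ito_error w z (d i) (m i) j))\<^sup>2)) \<longlonglongrightarrow> 0"
      using tendsto_mult[OF tendsto_const[of "sqrt D"] tendsto_real_sqrt[OF ito_sq]] by simp
  qed
  have osc_dU: "\<forall>\<^sub>F i in sequentially. \<forall>j<N i. norm (dU i j) \<le> \<epsilon>" if "\<epsilon> > 0" for \<epsilon>
    using osc_step[OF cu that]
  proof eventually_elim
    case (elim i)
    show ?case
    proof (intro allI impI)
      fix j assume "j < N i"
      then show "norm (dU i j) \<le> \<epsilon>"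
        using elim x_mono[of j "Suc j" i] by (simp add: dU_def U_def N_def less_imp_le)
    qed
  qed
  \<comment> \<open>The weights \<open>dU\<close> become uniformly small, while the total variation
    of \<open>c\<close> stays below \<open>K\<close>.\<close>
  have cov1: "(\<lambda>i. \<Sum>j<N i. dU i j * c i j) \<longlonglongrightarrow> 0"
  proof (rule to0[of _ "K"])
    fix \<epsilon> :: real assume "\<epsilon> > 0"
    then have "\<forall>\<^sub>F i in sequentially. \<forall>j<N i. norm (dU i j) \<le> \<epsilon>" by (rule osc_dU)
    then show "\<forall>\<^sub>F i in sequentially. norm (\<Sum>j<N i. dU i j * c i j) \<le> K * \<epsilon>"
    proof eventually_elim
      case (elim i)
      have "norm (\<Sum>j<N i. dU i j * c i j) \<le> (\<Sum>j<N i. \<epsilon> * norm (c i j))"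
        by (rule order_trans[OF norm_sum]) (use elim in \<open>auto simp: norm_mult intro!: sum_mono mult_right_mono\<close>)
      also have "\<dots> \<le> \<epsilon> * K"
        unfolding sum_distrib_left[symmetric] using c_sum \<open>\<epsilon> > 0\<close> by (intro mult_left_mono) auto
      finally show ?case by (simp add: mult.commute)
    qed
  qed (rule K0)
  have errR: "(\<lambda>i. \<Sum>j<N i. mU i j * (R i (Suc j) - R i j)) \<longlonglongrightarrow> 0"
  proof (rule Lim_null_comparison)
    show "(\<lambda>i. 2 * (\<Sum>J\<le>2 ^ l i. norm (I (real J * h i) - trapezoid w z (d i) (J * m i)))) \<longlonglongrightarrow> 0"
      using tendsto_mult[OF tendsto_const[of 2] fine] by simp
    show "\<forall>\<^sub>F i in sequentially. norm (\<Sum>j<N i. mU i j * (R i (Suc j) - R i j)) \<le>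
      2 * (\<Sum>J\<le>2 ^ l i. norm (I (real J * h i) - trapezoid w z (d i) (J * m i)))"
    proof (intro always_eventually allI)
      fix i
      have "norm (mU i j * (R i (Suc j) - R i j)) \<le> norm (R i (Suc j)) + norm (R i j)" for j
      proof -
        have "norm (mU i j) * norm (R i (Suc j) - R i j) \<le> 1 * (norm (R i (Suc j)) + norm (R i j))"
          by (intro mult_mono nmU norm_triangle_ineq4) auto
        then show ?thesis by (simp add: norm_mult)
      qed
      then have "norm (\<Sum>j<N i. mU i j * (R i (Suc j) - R i j)) \<le> (\<Sum>j<N i. norm (R i (Suc j)) + norm (R i j))"
        by (intro order_trans[OF norm_sum] sum_mono)
      also have "\<dots> \<le> (\<Sum>j\<le>N i. norm (R i j)) + (\<Sum>j\<le>N i. norm (R i j))"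
        unfolding sum.distrib
      proof (rule add_mono)
        show "(\<Sum>j<N i. norm (R i j)) \<le> (\<Sum>j\<le>N i. norm (R i j))" by (intro sum_mono2) auto
        have "(\<Sum>j<N i. norm (R i (Suc j))) = (\<Sum>j\<in>Suc ` {..<N i}. norm (R i j))"
          by (simp add: sum.reindex)
        also have "\<dots> \<le> (\<Sum>j\<le>N i. norm (R i j))" by (intro sum_mono2) auto
        finally show "(\<Sum>j<N i. norm (R i (Suc j))) \<le> (\<Sum>j\<le>N i. norm (R i j))" .
      qed
      finally show "norm (\<Sum>j<N i. mU i j * (R i (Suc j) - R i j)) \<le>
        2 * (\<Sum>J\<le>2 ^ l i. norm (I (real J * h i) - trapezoid w z (d i) (J * m i)))"
        by (simp add: R_def x_def N_def)
    qed
  qed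
  \<comment> \<open>By \<open>trapezoid_refine\<close> the partial sums of c / 2 are the fine
    trapezoid minus the coarse one minus the Ito errors. At a dyadic point of fixed level both
    trapezoids converge to the same integral, so the sum of \<open>c\<close> between two such points
    vanishes, although the sum of the norms need not.\<close>
  have block: "(\<lambda>i. norm (\<Sum>r<2 ^ (l i - b). (1/2) *\<^sub>R c i (B * 2 ^ (l i - b) + r))) \<longlonglongrightarrow> 0" if "B < 2 ^ b" for b B
  proof -
    \<comment> \<open>Number of coarse intervals in a block of level \<open>b\<close>. The
      subtraction truncates for finitely many \<open>i\<close> only, because \<open>l\<close> tends
      to infinity.\<close>
    define q where "q i = (2::nat) ^ (l i - b)" for i
    define S where "S i k = trapezoid w z (d i) (k * m i) - trapezoid w z (h i) k - (\<Sum>j<k. g i j)" for i k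
    have S: "S i k = (\<Sum>j<k. (1/2) *\<^sub>R c i j)" for i k
      using trapezoid_refine[of w z "d i" k "m i"] by (simp add: S_def hd c_def g_def sum.distrib)
    have lim: "(\<lambda>i. S i (B * q i)) \<longlonglongrightarrow> 0" if B: "B \<le> 2 ^ b" for B
    proof -
      have "(\<lambda>i. (trapezoid w z (d i) (B * q i * m i) - I (real B * (t / 2 ^ b)))
         - (trapezoid w z (h i) (B * q i) - I (real B * (t / 2 ^ b))) - (\<Sum>j<B * q i. g i j)) \<longlonglongrightarrow> 0 - 0 - 0"
      proof (intro tendsto_diff)
        show "(\<lambda>i. trapezoid w z (h i) (B * q i) - I (real B * (t / 2 ^ b))) \<longlonglongrightarrow> 0"
          using coarse[OF B] unfolding q_def by (rule tendsto_norm_zero_cancel)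
        show "(\<lambda>i. \<Sum>j<B * q i. g i j) \<longlonglongrightarrow> 0"
          using ito_block[OF B] unfolding q_def g_def by (rule tendsto_norm_zero_cancel)
        show "(\<lambda>i. trapezoid w z (d i) (B * q i * m i) - I (real B * (t / 2 ^ b))) \<longlonglongrightarrow> 0"
        proof (rule Lim_null_comparison[OF _ fine])
          have "\<forall>\<^sub>F i in sequentially. l i \<ge> b" using l by (simp add: filterlim_at_top)
          then show "\<forall>\<^sub>F i in sequentially. norm (trapezoid w z (d i) (B * q i * m i) - I (real B * (t / 2 ^ b)))
            \<le> (\<Sum>J\<le>2 ^ l i. norm (I (real J * h i) - trapezoid w z (d i) (J * m i)))"
          proof eventually_elim
            case (elim i)
            then have p: "(2::nat) ^ l i = 2 ^ b * q i" by (simp add: q_def power_add[symmetric])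
            have "(2::real) ^ l i = 2 ^ b * real (q i)" using elim by (simp add: q_def power_add[symmetric])
            then have "real B * (t / 2 ^ b) = real (B * q i) * h i"
              using p by (simp add: h_def q_def)
            then have "norm (trapezoid w z (d i) (B * q i * m i) - I (real B * (t / 2 ^ b))) =
                norm (I (real (B * q i) * h i) - trapezoid w z (d i) (B * q i * m i))"
              by (simp add: norm_minus_commute)
            also have "\<dots> \<le> (\<Sum>J\<le>2 ^ l i. norm (I (real J * h i) - trapezoid w z (d i) (J * m i)))"
              by (rule member_le_sum[where f="\<lambda>J. norm (I (real J * h i) - trapezoid w z (d i) (J * m i))"])
                 (use B p in auto)
            finally show ?case .
          qed
        qed
      qed
      then show ?thesis by (simp add: S_def algebra_simps)
    qed
    have "(\<Sum>r<q i. (1/2) *\<^sub>R c i (B * q i + r)) = S i (Suc B * q i) - S i (B * q i)" for i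
    proof -
      have "(\<Sum>j<Suc B * q i. (1/2) *\<^sub>R c i j) = (\<Sum>j<B * q i. (1/2) *\<^sub>R c i j) + (\<Sum>r<q i. (1/2) *\<^sub>R c i (B * q i + r))"
        unfolding sum_blocks by simp
      then show ?thesis by (simp add: S del: mult_Suc)
    qed
    moreover have "(\<lambda>i. S i (Suc B * q i) - S i (B * q i)) \<longlonglongrightarrow> 0 - 0"
      using that by (intro tendsto_diff lim) auto
    ultimately show ?thesis unfolding q_def by (intro tendsto_norm_zero) simp
  qed
  have cov0: "(\<lambda>i. \<Sum>j<N i. U i j * ((1/2) *\<^sub>R c i j)) \<longlonglongrightarrow> 0"
  proof (rule to0[of _ "K + 1"])
    fix \<epsilon> :: real assume \<epsilon>: "\<epsilon> > 0"
    obtain \<delta> where \<delta>: "\<delta> > 0" "\<And>r s. r\<in>{0..t} \<Longrightarrow> s\<in>{0..t} \<Longrightarrow> \<bar>r - s\<bar> < \<delta> \<Longrightarrow> norm (u r - u s) < \<epsilon>"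
      using osc[OF cu \<epsilon>] by metis
    obtain b :: nat where b: "t / 2 ^ b < \<delta>"
    proof -
      obtain b :: nat where "t / \<delta> < 2 ^ b" using real_arch_pow[of 2 "t / \<delta>"] by auto
      then have "t / 2 ^ b < \<delta>" using \<delta>(1) by (simp add: field_simps)
      then show ?thesis using that by blast
    qed
    define q where "q i = (2::nat) ^ (l i - b)" for i
    have "(\<lambda>i. \<Sum>B<2 ^ b. norm (\<Sum>r<q i. (1/2) *\<^sub>R c i (B * q i + r))) \<longlonglongrightarrow> (\<Sum>B<(2::nat) ^ b. 0)"
      unfolding q_def by (intro tendsto_sum block) auto
    then have "\<forall>\<^sub>F i in sequentially. (\<Sum>B<2 ^ b. norm (\<Sum>r<q i. (1/2) *\<^sub>R c i (B * q i + r))) < \<epsilon>"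
      using \<epsilon> by (intro order_tendstoD(2)) auto
    moreover have "\<forall>\<^sub>F i in sequentially. l i \<ge> b" using l by (simp add: filterlim_at_top)
    ultimately show "\<forall>\<^sub>F i in sequentially. norm (\<Sum>j<N i. U i j * ((1/2) *\<^sub>R c i j)) \<le> (K + 1) * \<epsilon>"
    proof eventually_elim
      case (elim i)
      then have p: "N i = 2 ^ b * q i" by (simp add: q_def N_def power_add[symmetric])
      then have p': "(2::real) ^ l i = 2 ^ b * real (q i)" using elim by (simp add: q_def power_add[symmetric])
      have qh: "real (q i) * h i = t / 2 ^ b" using p' by (simp add: h_def q_def)
      let ?cc = "\<lambda>j. (1/2) *\<^sub>R c i j"
      have "(\<Sum>j<N i. U i j * ?cc j) = (\<Sum>B<2 ^ b. \<Sum>r<q i. U i (B * q i + r) * ?cc (B * q i + r))"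
        unfolding p by (rule sum_blocks)
      also have "\<dots> = (\<Sum>B<2 ^ b. U i (B * q i) * (\<Sum>r<q i. ?cc (B * q i + r))) +
          (\<Sum>B<2 ^ b. \<Sum>r<q i. (U i (B * q i + r) - U i (B * q i)) * ?cc (B * q i + r))"
        unfolding sum.distrib[symmetric] sum_distrib_left
        by (intro sum.cong refl) (simp add: algebra_simps)
      finally have "norm (\<Sum>j<N i. U i j * ?cc j) = norm ((\<Sum>B<2 ^ b. U i (B * q i) * (\<Sum>r<q i. ?cc (B * q i + r))) +
          (\<Sum>B<2 ^ b. \<Sum>r<q i. (U i (B * q i + r) - U i (B * q i)) * ?cc (B * q i + r)))"
        by (rule arg_cong)
      also have "\<dots> \<le> (\<Sum>B<2 ^ b. norm (\<Sum>r<q i. ?cc (B * q i + r))) +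
          (\<Sum>B<2 ^ b. \<Sum>r<q i. \<epsilon> * norm (c i (B * q i + r)))"
      proof (rule order_trans[OF norm_triangle_ineq], rule add_mono)
        show "norm (\<Sum>B<2 ^ b. U i (B * q i) * (\<Sum>r<q i. ?cc (B * q i + r)))
          \<le> (\<Sum>B<2 ^ b. norm (\<Sum>r<q i. ?cc (B * q i + r)))"
          by (rule order_trans[OF norm_sum]) (simp add: norm_mult)
        show "norm (\<Sum>B<2 ^ b. \<Sum>r<q i. (U i (B * q i + r) - U i (B * q i)) * ?cc (B * q i + r))
          \<le> (\<Sum>B<2 ^ b. \<Sum>r<q i. \<epsilon> * norm (c i (B * q i + r)))"
        proof (intro order_trans[OF norm_sum] sum_mono)
          fix B r assume B: "B \<in> {..<(2::nat) ^ b}" and r: "r \<in> {..<q i}"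
          have "B * q i + r \<le> Suc B * q i" using r by simp
          also have "\<dots> \<le> 2 ^ b * q i" using B by (intro mult_right_mono) auto
          finally have in1: "B * q i + r \<le> N i" by (simp add: p)
          have "x i (B * q i + r) - x i (B * q i) = real r * h i" by (simp add: x_def algebra_simps)
          also have "\<dots> \<le> real (q i) * h i" using r h0[of i] by (intro mult_right_mono) auto
          finally have "\<bar>x i (B * q i + r) - x i (B * q i)\<bar> < \<delta>"
            using x_mono[of "B * q i" "B * q i + r" i] b unfolding qh by simp
          then have "norm (U i (B * q i + r) - U i (B * q i)) < \<epsilon>"
            unfolding U_def using in1 by (intro \<delta>(2) x_in) (auto simp: N_def)
          moreover have "norm (?cc (B * q i + r)) \<le> norm (c i (B * q i + r))" by simp
          ultimately show "norm ((U i (B * q i + r) - U i (B * q i)) * ?cc (B * q i + r)) \<le> \<epsilon> * norm (c i (B * q i + r))"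
            unfolding norm_mult using \<epsilon> by (intro mult_mono) auto
        qed
      qed
      also have "\<dots> \<le> \<epsilon> + \<epsilon> * K"
      proof (rule add_mono)
        have "(\<Sum>B<2 ^ b. \<Sum>r<q i. \<epsilon> * norm (c i (B * q i + r))) = (\<Sum>j<2 ^ b * q i. \<epsilon> * norm (c i j))"
          by (rule sum_blocks[symmetric])
        also have "\<dots> = \<epsilon> * (\<Sum>j<N i. norm (c i j))"
          by (simp only: p sum_distrib_left)
        also have "\<dots> \<le> \<epsilon> * K" using c_sum \<epsilon> by (intro mult_left_mono) auto
        finally show "(\<Sum>B<2 ^ b. \<Sum>r<q i. \<epsilon> * norm (c i (B * q i + r))) \<le> \<epsilon> * K" .
      qed (use elim in simp)
      finally show ?case by (simp add: algebra_simps)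
    qed
  qed (use K0 in simp)
  have drift: "(\<lambda>i. \<Sum>j<N i. mU i j * (J i j - h i *\<^sub>R mZ i j)) \<longlonglongrightarrow> 0"
  proof (rule to0[of _ "t"])
    fix \<epsilon> :: real assume \<epsilon>: "\<epsilon> > 0"
    show "\<forall>\<^sub>F i in sequentially. norm (\<Sum>j<N i. mU i j * (J i j - h i *\<^sub>R mZ i j)) \<le> t * \<epsilon>"
      using osc_step[OF cz \<epsilon>]
    proof eventually_elim
      case (elim i)
      have "norm (J i j - h i *\<^sub>R mZ i j) \<le> h i * \<epsilon>" if j: "j < N i" for j
      proof -
        let ?S = "{x i j..x i (Suc j)}"
        have h: "x i (Suc j) - x i j = h i" by (simp add: x_def algebra_simps)
        have le: "x i j \<le> x i (Suc j)" by (rule x_mono) simp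
        have zi: "z integrable_on ?S"
          using x_in[of j i] x_in[of "Suc j" i] j by (intro zint) (auto simp: N_def)
        have "((\<lambda>s. z s - mZ i j) has_integral (J i j - h i *\<^sub>R mZ i j)) ?S"
          unfolding J_def using has_integral_diff[OF integrable_integral[OF zi] has_integral_const_real[of "mZ i j" "x i j" "x i (Suc j)"]] le h
          by (simp add: content_real)
        moreover have "norm (z s - mZ i j) \<le> \<epsilon>" if s: "s \<in> ?S" for s
        proof -
          have "z s - mZ i j = (1/2) *\<^sub>R ((z s - Z i j) + (z s - Z i (Suc j)))"
            by (simp add: mZ_def scaleR_conv_of_real field_simps)
          also have "norm \<dots> \<le> (norm (z s - Z i j) + norm (z s - Z i (Suc j))) / 2"
            using norm_triangle_ineq[of "z s - Z i j" "z s - Z i (Suc j)"] by simp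
          also have "\<dots> \<le> \<epsilon>"
          proof -
            have "norm (z s - Z i j) < \<epsilon>" "norm (z s - Z i (Suc j)) < \<epsilon>"
              unfolding Z_def using elim j s le by (auto simp: N_def)
            then show ?thesis by simp
          qed
          finally show "norm (z s - mZ i j) \<le> \<epsilon>" .
        qed
        ultimately have "norm (J i j - h i *\<^sub>R mZ i j) \<le> \<epsilon> * Henstock_Kurzweil_Integration.content (cbox (x i j) (x i (Suc j)))"
          using \<epsilon> by (intro has_integral_bound[where f="\<lambda>s. z s - mZ i j"]) auto
        then show ?thesis using h le by (simp add: mult.commute)
      qed
      note J_bound = this
      have "norm (mU i j * (J i j - h i *\<^sub>R mZ i j)) \<le> h i * \<epsilon>" if "j < N i" for j
      proof -
        have "norm (mU i j) * norm (J i j - h i *\<^sub>R mZ i j) \<le> 1 * (h i * \<epsilon>)"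
          using J_bound[OF that] h0[of i] \<epsilon> by (intro mult_mono nmU) auto
        then show ?thesis by (simp add: norm_mult)
      qed
      then have "norm (\<Sum>j<N i. mU i j * (J i j - h i *\<^sub>R mZ i j)) \<le> (\<Sum>j<N i. h i * \<epsilon>)"
        by (intro order_trans[OF norm_sum] sum_mono) auto
      also have "\<dots> = t * \<epsilon>" unfolding sum_distrib_right[symmetric] sumh ..
      finally show ?case .
    qed
  qed (use t in simp)
  \<comment> \<open>Error of the chain rule for \<open>u\<close>, of third order in
    \<open>V\<close>: one factor is uniformly small, the squares of \<open>V\<close> add up to at
    most \<open>D\<close>.\<close>
  have cubic: "(\<lambda>i. \<Sum>j<N i. mZ i j * (dU i j + \<i> * of_real (V i j) * mU i j)) \<longlonglongrightarrow> 0"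
  proof (rule to0[of _ "C * D"])
    fix \<epsilon> :: real assume \<epsilon>: "\<epsilon> > 0"
    show "\<forall>\<^sub>F i in sequentially. norm (\<Sum>j<N i. mZ i j * (dU i j + \<i> * of_real (V i j) * mU i j)) \<le> C * D * \<epsilon>"
      using osc_step[OF cv \<epsilon>]
    proof eventually_elim
      case (elim i)
      have "norm (mZ i j * (dU i j + \<i> * of_real (V i j) * mU i j)) \<le> C * ((V i j)\<^sup>2 * \<epsilon>)" if j: "j < N i" for j
      proof -
        have "V i j = \<kappa> * (w (x i (Suc j)) + a * x i (Suc j)) - \<kappa> * (w (x i j) + a * x i j)"
          by (simp add: V_def dw_def x_def algebra_simps)
        then have V: "\<bar>V i j\<bar> < \<epsilon>"
          using elim j x_mono[of j "Suc j" i] by (auto simp: N_def)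
        have "dU i j + \<i> * of_real (V i j) * mU i j =
            U i j * (cis (- V i j) - 1 + \<i> * of_real (V i j) * ((1 + cis (- V i j)) / 2))"
          by (simp add: dU_def mU_def dU scaleR_conv_of_real field_simps)
        then have "norm (dU i j + \<i> * of_real (V i j) * mU i j) \<le> \<bar>V i j\<bar> ^ 3"
          using norm_cis_trapezoid_error[of "V i j"] by (simp add: norm_mult)
        also have "\<dots> = (V i j)\<^sup>2 * \<bar>V i j\<bar>" by (simp add: power3_eq_cube power2_eq_square)
        also have "\<dots> \<le> (V i j)\<^sup>2 * \<epsilon>" using V by (intro mult_left_mono) auto
        finally show ?thesis
          unfolding norm_mult using nmZ[OF j] C(1) by (intro mult_mono) auto
      qed
      then have "norm (\<Sum>j<N i. mZ i j * (dU i j + \<i> * of_real (V i j) * mU i j)) \<le> (\<Sum>j<N i. C * ((V i j)\<^sup>2 * \<epsilon>))"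
        by (intro order_trans[OF norm_sum] sum_mono) auto
      also have "\<dots> = C * (\<epsilon> * (\<Sum>j<N i. (V i j)\<^sup>2))"
        by (simp add: sum_distrib_left mult_ac)
      also have "\<dots> \<le> C * (\<epsilon> * D)" using V2[of i] C(1) \<epsilon> by (intro mult_left_mono) auto
      finally show ?case by (simp add: mult_ac)
    qed
  qed (use C(1) D0 in simp)
  have ito_u': "(\<lambda>i. \<Sum>j<N i. U i j * g i j) \<longlonglongrightarrow> 0"
    using ito_u unfolding U_def g_def x_def N_def by (rule tendsto_norm_zero_cancel)
  \<comment> \<open>An exact identity at every scale. Its left side does not depend on
    \<open>i\<close>, and all seven sums on the right tend to 0.\<close>
  have split: "u t * z t - u 0 * z 0 =
     \<i> * of_real \<kappa> * ((\<Sum>j<N i. mU i j * (R i (Suc j) - R i j)) + (\<Sum>j<N i. U i j * g i j) + (\<Sum>j<N i. dU i j * g i j) / 2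
       + (\<Sum>j<N i. U i j * ((1/2) *\<^sub>R c i j)) + (\<Sum>j<N i. dU i j * c i j) / 4)
     + \<i> * of_real (\<kappa> * a) * (\<Sum>j<N i. mU i j * (J i j - h i *\<^sub>R mZ i j))
     + (\<Sum>j<N i. mZ i j * (dU i j + \<i> * of_real (V i j) * mU i j))" for i
  proof -
    have "u t * z t - u 0 * z 0 = U i (N i) * Z i (N i) - U i 0 * Z i 0"
      by (simp add: U_def Z_def N_def xN x0)
    also have "\<dots> = (\<Sum>j<N i. U i (Suc j) * Z i (Suc j) - U i j * Z i j)"
      by (rule sum_lessThan_telescope[symmetric])
    also have "\<dots> = (\<Sum>j<N i. \<i> * of_real \<kappa> * (mU i j * (R i (Suc j) - R i j) + U i j * g i j + dU i j * g i j / 2 +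
        U i j * ((1/2) *\<^sub>R c i j) + dU i j * c i j / 4)
      + \<i> * of_real (\<kappa> * a) * (mU i j * (J i j - h i *\<^sub>R mZ i j))
      + mZ i j * (dU i j + \<i> * of_real (V i j) * mU i j))"
    proof (intro sum.cong refl)
      fix j assume "j \<in> {..<N i}"
      then have j: "j < N i" by simp
      have "Z i (Suc j) - Z i j = \<i> * (of_real \<kappa> * of_real a) * J i j +
          \<i> * of_real \<kappa> * (of_real (dw i j) * mZ i j + (R i (Suc j) - R i j) + g i j + (1/2) * c i j)"
        unfolding dZ[OF j] dI by (simp add: scaleR_conv_of_real)
      moreover have "mZ i j = (Z i j + Z i (Suc j)) / 2" by (simp add: mZ_def scaleR_conv_of_real)
      ultimately show "U i (Suc j) * Z i (Suc j) - U i j * Z i j =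
        \<i> * of_real \<kappa> * (mU i j * (R i (Suc j) - R i j) + U i j * g i j + dU i j * g i j / 2 +
        U i j * ((1/2) *\<^sub>R c i j) + dU i j * c i j / 4)
      + \<i> * of_real (\<kappa> * a) * (mU i j * (J i j - h i *\<^sub>R mZ i j))
      + mZ i j * (dU i j + \<i> * of_real (V i j) * mU i j)"
        using product_increment_split[where y="Z i j" and y'="Z i (Suc j)" and p="U i j" and q="U i (Suc j)"
          and k="of_real \<kappa>" and a="of_real a" and J="J i j" and dw="of_real (dw i j)" and Y="mZ i j"
          and R="R i (Suc j) - R i j" and g="g i j" and c="c i j" and h="of_real (h i)"]
        by (simp only: mU_def dU_def V_def scaleR_conv_of_real of_real_mult of_real_add of_real_divide of_real_1 of_real_numeral) simp
    qed
    finally have eq: "u t * z t - u 0 * z 0 = (\<Sum>j<N i. \<i> * of_real \<kappa> * (mU i j * (R i (Suc j) - R i j) + U i j * g i j + dU i j * g i j / 2 +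
        U i j * ((1/2) *\<^sub>R c i j) + dU i j * c i j / 4)
      + \<i> * of_real (\<kappa> * a) * (mU i j * (J i j - h i *\<^sub>R mZ i j))
      + mZ i j * (dU i j + \<i> * of_real (V i j) * mU i j))" .
    show ?thesis unfolding eq by (simp add: sum.distrib flip: sum_distrib_left sum_divide_distrib)
  qed
  have "(\<lambda>i. \<i> * of_real \<kappa> * ((\<Sum>j<N i. mU i j * (R i (Suc j) - R i j)) + (\<Sum>j<N i. U i j * g i j) + (\<Sum>j<N i. dU i j * g i j) / 2
       + (\<Sum>j<N i. U i j * ((1/2) *\<^sub>R c i j)) + (\<Sum>j<N i. dU i j * c i j) / 4)
     + \<i> * of_real (\<kappa> * a) * (\<Sum>j<N i. mU i j * (J i j - h i *\<^sub>R mZ i j))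
     + (\<Sum>j<N i. mZ i j * (dU i j + \<i> * of_real (V i j) * mU i j))) \<longlonglongrightarrow>
     \<i> * of_real \<kappa> * (0 + 0 + 0 / 2 + 0 + 0 / 4) + \<i> * of_real (\<kappa> * a) * 0 + 0"
    by (intro tendsto_add tendsto_mult tendsto_divide tendsto_const errR ito_u' ito cov0 cov1 drift cubic) auto
  then have "(\<lambda>i::nat. u t * z t - u 0 * z 0) \<longlonglongrightarrow> 0"
    unfolding split[symmetric] by simp
  then have "u t * z t - u 0 * z 0 = 0"
    by (simp add: LIMSEQ_const_iff)
  then show ?thesis by simp
qed

section \<open>Solution of the scalar equation\<close>

lemma (in prob_space) tendsto_prob_sum:
  fixes X :: "'j \<Rightarrow> nat \<Rightarrow> 'a \<Rightarrow> real"
  assumes S: "finite S" and [measurable]: "\<And>j n. j \<in> S \<Longrightarrow> X j n \<in> borel_measurable M"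
    and lim: "\<And>j \<epsilon>. j \<in> S \<Longrightarrow> \<epsilon> > 0 \<Longrightarrow> (\<lambda>n. prob {\<omega>\<in>space M. \<bar>X j n \<omega>\<bar> > \<epsilon>}) \<longlonglongrightarrow> 0"
    and "\<epsilon> > 0"
  shows "(\<lambda>n. prob {\<omega>\<in>space M. (\<Sum>j\<in>S. \<bar>X j n \<omega>\<bar>) > \<epsilon>}) \<longlonglongrightarrow> 0"
proof (rule tendsto_sandwich[OF _ _ tendsto_const])
  \<comment> \<open>Equal shares for the union bound; the 1 covers an empty
    \<open>S\<close>.\<close>
  define \<delta> where "\<delta> = \<epsilon> / (real (card S) + 1)"
  have \<delta>: "\<delta> > 0" using \<open>\<epsilon> > 0\<close> by (simp add: \<delta>_def)
  show "\<forall>\<^sub>F n in sequentially. prob {\<omega>\<in>space M. (\<Sum>j\<in>S. \<bar>X j n \<omega>\<bar>) > \<epsilon>} \<le>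
    (\<Sum>j\<in>S. prob {\<omega>\<in>space M. \<bar>X j n \<omega>\<bar> > \<delta>})"
  proof (intro always_eventually allI)
    fix n
    have "{\<omega>\<in>space M. (\<Sum>j\<in>S. \<bar>X j n \<omega>\<bar>) > \<epsilon>} \<subseteq> (\<Union>j\<in>S. {\<omega>\<in>space M. \<bar>X j n \<omega>\<bar> > \<delta>})"
    proof
      fix \<omega> assume \<omega>: "\<omega> \<in> {\<omega>\<in>space M. (\<Sum>j\<in>S. \<bar>X j n \<omega>\<bar>) > \<epsilon>}"
      have "\<exists>j\<in>S. \<bar>X j n \<omega>\<bar> > \<delta>"
      proof (rule ccontr)
        assume "\<not> (\<exists>j\<in>S. \<bar>X j n \<omega>\<bar> > \<delta>)"
        then have "(\<Sum>j\<in>S. \<bar>X j n \<omega>\<bar>) \<le> (\<Sum>j\<in>S. \<delta>)" by (intro sum_mono) auto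
        also have "\<dots> \<le> \<epsilon>" using \<open>\<epsilon> > 0\<close> by (simp add: \<delta>_def field_simps)
        finally show False using \<omega> by simp
      qed
      then show "\<omega> \<in> (\<Union>j\<in>S. {\<omega>\<in>space M. \<bar>X j n \<omega>\<bar> > \<delta>})" using \<omega> by auto
    qed
    then have "prob {\<omega>\<in>space M. (\<Sum>j\<in>S. \<bar>X j n \<omega>\<bar>) > \<epsilon>} \<le> prob (\<Union>j\<in>S. {\<omega>\<in>space M. \<bar>X j n \<omega>\<bar> > \<delta>})"
      by (intro finite_measure_mono sets.finite_UN S) auto
    also have "\<dots> \<le> (\<Sum>j\<in>S. prob {\<omega>\<in>space M. \<bar>X j n \<omega>\<bar> > \<delta>})"
      by (intro finite_measure_subadditive_finite S) auto
    finally show "prob {\<omega>\<in>space M. (\<Sum>j\<in>S. \<bar>X j n \<omega>\<bar>) > \<epsilon>} \<le> (\<Sum>j\<in>S. prob {\<omega>\<in>space M. \<bar>X j n \<omega>\<bar> > \<delta>})" .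
  qed
  have "(\<lambda>n. \<Sum>j\<in>S. prob {\<omega>\<in>space M. \<bar>X j n \<omega>\<bar> > \<delta>}) \<longlonglongrightarrow> (\<Sum>j\<in>S. 0)"
    by (intro tendsto_sum lim \<delta>)
  then show "(\<lambda>n. \<Sum>j\<in>S. prob {\<omega>\<in>space M. \<bar>X j n \<omega>\<bar> > \<delta>}) \<longlonglongrightarrow> 0" by simp
qed simp

lemma (in wiener_filtered) ito_isometry_complex:
  fixes \<xi> :: "nat \<Rightarrow> 'w \<Rightarrow> complex" and \<tau> :: "nat \<Rightarrow> real"
  assumes \<tau>: "\<And>k. \<tau> k \<le> \<tau> (Suc k)" "0 \<le> \<tau> 0"
    and \<xi>: "\<And>k. k < n \<Longrightarrow> \<xi> k \<in> borel_measurable (F (\<tau> k))"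
    and b: "\<And>k \<omega>. k < n \<Longrightarrow> \<omega> \<in> space P \<Longrightarrow> norm (\<xi> k \<omega>) \<le> c"
  defines "S \<equiv> \<lambda>\<omega>. \<Sum>k<n. (W (\<tau> (Suc k)) \<omega> - W (\<tau> k) \<omega>) *\<^sub>R \<xi> k \<omega>"
  shows "integrable P (\<lambda>\<omega>. (norm (S \<omega>))\<^sup>2)"
    "expectation (\<lambda>\<omega>. (norm (S \<omega>))\<^sup>2) = (\<Sum>k<n. expectation (\<lambda>\<omega>. (norm (\<xi> k \<omega>))\<^sup>2) * (\<tau> (Suc k) - \<tau> k))"
proof -
  let ?R = "\<lambda>\<omega>. \<Sum>k<n. Re (\<xi> k \<omega>) * (W (\<tau> (Suc k)) \<omega> - W (\<tau> k) \<omega>)"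
  let ?I = "\<lambda>\<omega>. \<Sum>k<n. Im (\<xi> k \<omega>) * (W (\<tau> (Suc k)) \<omega> - W (\<tau> k) \<omega>)"
  have S: "(\<lambda>\<omega>. (norm (S \<omega>))\<^sup>2) = (\<lambda>\<omega>. (?R \<omega>)\<^sup>2 + (?I \<omega>)\<^sup>2)"
    by (simp add: S_def cmod_power2 mult.commute)
  have R: "integrable P (\<lambda>\<omega>. (?R \<omega>)\<^sup>2)"
    "expectation (\<lambda>\<omega>. (?R \<omega>)\<^sup>2) = (\<Sum>k<n. expectation (\<lambda>\<omega>. (Re (\<xi> k \<omega>))\<^sup>2) * (\<tau> (Suc k) - \<tau> k))"
    by (rule ito_isometry[where c=c and \<xi>="\<lambda>k \<omega>. Re (\<xi> k \<omega>)" and \<tau>=\<tau> and n=n];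
      use \<tau> \<xi> b in \<open>auto intro: order_trans[OF abs_Re_le_cmod] borel_measurable_Re[THEN measurable_compose[rotated]]\<close>)+
  have I: "integrable P (\<lambda>\<omega>. (?I \<omega>)\<^sup>2)"
    "expectation (\<lambda>\<omega>. (?I \<omega>)\<^sup>2) = (\<Sum>k<n. expectation (\<lambda>\<omega>. (Im (\<xi> k \<omega>))\<^sup>2) * (\<tau> (Suc k) - \<tau> k))"
    by (rule ito_isometry[where c=c and \<xi>="\<lambda>k \<omega>. Im (\<xi> k \<omega>)" and \<tau>=\<tau> and n=n];
      use \<tau> \<xi> b in \<open>auto intro: order_trans[OF abs_Im_le_cmod] borel_measurable_Im[THEN measurable_compose[rotated]]\<close>)+
  show "integrable P (\<lambda>\<omega>. (norm (S \<omega>))\<^sup>2)" unfolding S using R I by simp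
  have sq: "integrable P (\<lambda>\<omega>. (Re (\<xi> k \<omega>))\<^sup>2) \<and> integrable P (\<lambda>\<omega>. (Im (\<xi> k \<omega>))\<^sup>2)" if k: "k < n" for k
  proof -
    have [measurable]: "\<xi> k \<in> borel_measurable P" using \<xi>[OF k] by (rule measurable_F)
    have "norm ((Re (\<xi> k \<omega>))\<^sup>2) \<le> c\<^sup>2 \<and> norm ((Im (\<xi> k \<omega>))\<^sup>2) \<le> c\<^sup>2" if "\<omega> \<in> space P" for \<omega>
      using order_trans[OF abs_Re_le_cmod b[OF k that]] order_trans[OF abs_Im_le_cmod b[OF k that]]
      by (auto simp: abs_le_square_iff[symmetric])
    then show ?thesis
      by (intro conjI integrable_const_bound[where B="c\<^sup>2"] AE_I2) auto
  qed
  show "expectation (\<lambda>\<omega>. (norm (S \<omega>))\<^sup>2) = (\<Sum>k<n. expectation (\<lambda>\<omega>. (norm (\<xi> k \<omega>))\<^sup>2) * (\<tau> (Suc k) - \<tau> k))"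
  proof -
    have "expectation (\<lambda>\<omega>. (norm (\<xi> k \<omega>))\<^sup>2) = expectation (\<lambda>\<omega>. (Re (\<xi> k \<omega>))\<^sup>2) + expectation (\<lambda>\<omega>. (Im (\<xi> k \<omega>))\<^sup>2)"
      if "k < n" for k using sq[OF that] by (simp add: cmod_power2)
    then show ?thesis
      unfolding S using R I by (simp add: sum.distrib[symmetric] distrib_right[symmetric])
  qed
qed

text \<open>What a scalar projection of a solution offers: a bounded, adapted, continuous \<zeta>, a
  process \<open>I\<close> approached in probability by uniform trapezoids, and the equation at each
  fixed time outside a null set. The exact value of \<open>I\<close> at time 0 matches the empty
  trapezoidal sum at the first grid point.\<close>

locale stratonovich_functional = wiener_filtered P F W
  for P :: "'w measure" and F W +
  fixes \<zeta> :: "real \<Rightarrow> 'w \<Rightarrow> complex" and I :: "real \<Rightarrow> 'w \<Rightarrow> complex" and C a \<kappa> :: real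
  assumes \<zeta>_measurable_F: "0 \<le> s \<Longrightarrow> \<zeta> s \<in> borel_measurable (F s)"
    and \<zeta>_bounded: "0 \<le> s \<Longrightarrow> \<omega> \<in> space P \<Longrightarrow> norm (\<zeta> s \<omega>) \<le> C"
    and \<zeta>_continuous: "AE \<omega> in P. continuous_on {0..} (\<lambda>s. \<zeta> s \<omega>)"
    \<comment> \<open>By Fatou, the quadratic sums are bounded only along a subsequence depending on the path.\<close>
    and quad_frequently: "\<And>t d e n N. t > 0 \<Longrightarrow> (\<And>i::nat. d i \<ge> 0 \<and> e i \<ge> 0 \<and> real (n i) * d i = t \<and> real (N i) * e i = t) \<Longrightarrow>
      AE \<omega> in P. \<exists>K. \<exists>\<^sub>F i in sequentially.
        quad_sum (\<lambda>s. W s \<omega>) (\<lambda>s. \<zeta> s \<omega>) (d i) (n i) + quad_sum (\<lambda>s. W s \<omega>) (\<lambda>s. \<zeta> s \<omega>) (e i) (N i) \<le> K"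
    and I_measurable: "0 \<le> s \<Longrightarrow> I s \<in> borel_measurable P"
    and I_0: "I 0 \<omega> = 0"
    and I_limit: "\<And>s \<epsilon> N. 0 < s \<Longrightarrow> \<epsilon> > 0 \<Longrightarrow> filterlim N at_top sequentially \<Longrightarrow> (\<And>n::nat. N n > 0) \<Longrightarrow>
      (\<lambda>n. prob {\<omega>\<in>space P. norm (trapezoid (\<lambda>s. W s \<omega>) (\<lambda>s. \<zeta> s \<omega>) (s / real (N n)) (N n) - I s \<omega>) > \<epsilon>}) \<longlonglongrightarrow> 0"
    and equation: "0 \<le> s \<Longrightarrow> AE \<omega> in P. \<zeta> s \<omega> = \<zeta> 0 \<omega> + \<i> * of_real (\<kappa> * a) * integral {0..s} (\<lambda>s. \<zeta> s \<omega>) + \<i> * of_real \<kappa> * I s \<omega>"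
begin

lemma \<zeta>_measurable: "0 \<le> s \<Longrightarrow> \<zeta> s \<in> borel_measurable P"
  using \<zeta>_measurable_F measurable_F by blast

lemma trapezoid_measurable:
  assumes "0 \<le> d"
  shows "(\<lambda>\<omega>. trapezoid (\<lambda>s. W s \<omega>) (\<lambda>s. \<zeta> s \<omega>) d J) \<in> borel_measurable P"
proof -
  have [measurable]: "W (real k * d) \<in> borel_measurable P" "\<zeta> (real k * d) \<in> borel_measurable P" for k
    using assms by (auto intro!: W_measurable \<zeta>_measurable)
  show ?thesis unfolding trapezoid_def by measurable
qed

lemma ito_error_measurable:
  assumes "0 \<le> d"
  shows "(\<lambda>\<omega>. ito_error (\<lambda>s. W s \<omega>) (\<lambda>s. \<zeta> s \<omega>) d m j) \<in> borel_measurable P"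
proof -
  have [measurable]: "W (real k * d) \<in> borel_measurable P" "\<zeta> (real k * d) \<in> borel_measurable P" for k
    using assms by (auto intro!: W_measurable \<zeta>_measurable)
  show ?thesis unfolding ito_error_def by measurable
qed

text \<open>\<open>k div m * m\<close> is the first index of the block that contains
  \<open>k\<close>, so this is the squared L2 norm of the oscillation of \<zeta> within blocks. Its
  expectation is the second moment that the isometry assigns to the sum of all Ito errors.\<close>

definition osc_sum :: "real \<Rightarrow> nat \<Rightarrow> nat \<Rightarrow> 'w \<Rightarrow> real" where
  "osc_sum d n m \<omega> = (\<Sum>k<n * m. (norm (\<zeta> (real k * d) \<omega> - \<zeta> (real (k div m * m) * d) \<omega>))\<^sup>2 * d)"

lemma integrable_\<zeta>_diff:
  assumes "0 \<le> r" "0 \<le> s"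
  shows "integrable P (\<lambda>\<omega>. (norm (\<zeta> r \<omega> - \<zeta> s \<omega>))\<^sup>2)"
proof (rule integrable_const_bound[where B="(2 * C)\<^sup>2"])
  have [measurable]: "\<zeta> r \<in> borel_measurable P" "\<zeta> s \<in> borel_measurable P"
    using assms \<zeta>_measurable by auto
  show "(\<lambda>\<omega>. (norm (\<zeta> r \<omega> - \<zeta> s \<omega>))\<^sup>2) \<in> borel_measurable P" by measurable
  show "AE \<omega> in P. norm ((norm (\<zeta> r \<omega> - \<zeta> s \<omega>))\<^sup>2) \<le> (2 * C)\<^sup>2"
  proof (rule AE_I2)
    fix \<omega> assume "\<omega> \<in> space P"
    then have "norm (\<zeta> r \<omega> - \<zeta> s \<omega>) \<le> 2 * C"
      using norm_triangle_ineq4[of "\<zeta> r \<omega>" "\<zeta> s \<omega>"] \<zeta>_bounded[OF assms(1)] \<zeta>_bounded[OF assms(2)] by fastforce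
    then have "(norm (\<zeta> r \<omega> - \<zeta> s \<omega>))\<^sup>2 \<le> (2 * C)\<^sup>2" by (intro power_mono) auto
    then show "norm ((norm (\<zeta> r \<omega> - \<zeta> s \<omega>))\<^sup>2) \<le> (2 * C)\<^sup>2" by simp
  qed
qed

lemma integrable_osc_sum: "0 \<le> d \<Longrightarrow> integrable P (osc_sum d n m)"
  unfolding osc_sum_def by (intro Bochner_Integration.integrable_sum integrable_mult_left integrable_\<zeta>_diff) auto

text \<open>All weighted Ito errors form one stochastic sum over the fine grid. A weight known at
  the start of its block keeps the integrand adapted; this freedom covers the phase factors, plain
  partial sums and single blocks.\<close>

lemma ito_error_second_moment:
  assumes d: "0 \<le> d" and m: "m > 0"
    and H: "\<And>j. j < n \<Longrightarrow> H j \<in> borel_measurable (F (real (j * m) * d))"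
    and Hb: "\<And>j \<omega>. j < n \<Longrightarrow> \<omega> \<in> space P \<Longrightarrow> norm (H j \<omega> :: complex) \<le> 1"
  shows "integrable P (\<lambda>\<omega>. (norm (\<Sum>j<n. H j \<omega> * ito_error (\<lambda>s. W s \<omega>) (\<lambda>s. \<zeta> s \<omega>) d m j))\<^sup>2)"
    "expectation (\<lambda>\<omega>. (norm (\<Sum>j<n. H j \<omega> * ito_error (\<lambda>s. W s \<omega>) (\<lambda>s. \<zeta> s \<omega>) d m j))\<^sup>2) =
      (\<Sum>k<n * m. expectation (\<lambda>\<omega>. (norm (H (k div m) \<omega> * (\<zeta> (real k * d) \<omega> - \<zeta> (real (k div m * m) * d) \<omega>)))\<^sup>2) * d)"
proof -
  define \<xi> where "\<xi> k \<omega> = H (k div m) \<omega> * (\<zeta> (real k * d) \<omega> - \<zeta> (real (k div m * m) * d) \<omega>)" for k \<omega>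
  have S: "(\<Sum>j<n. H j \<omega> * ito_error (\<lambda>s. W s \<omega>) (\<lambda>s. \<zeta> s \<omega>) d m j) =
    (\<Sum>k<n * m. (W (real (Suc k) * d) \<omega> - W (real k * d) \<omega>) *\<^sub>R \<xi> k \<omega>)" for \<omega>
    unfolding sum_blocks ito_error_def sum_distrib_left
  proof (intro sum.cong refl)
    fix j r assume "r \<in> {..<m}"
    then have "(j * m + r) div m = j" using m by simp
    then show "H j \<omega> * (W (real (Suc (j * m + r)) * d) \<omega> - W (real (j * m + r) * d) \<omega>) *\<^sub>R
        (\<zeta> (real (j * m + r) * d) \<omega> - \<zeta> (real (j * m) * d) \<omega>) =
       (W (real (Suc (j * m + r)) * d) \<omega> - W (real (j * m + r) * d) \<omega>) *\<^sub>R \<xi> (j * m + r) \<omega>"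
      by (simp add: \<xi>_def del: of_nat_Suc of_nat_add of_nat_mult)
  qed
  have \<xi>m: "\<xi> k \<in> borel_measurable (F (real k * d))" if "k < n * m" for k
  proof -
    have k: "k div m < n" using that by (simp add: less_mult_imp_div_less)
    have le: "real (k div m * m) * d \<le> real k * d" by (rule mult_right_mono[OF of_nat_mono[OF div_times_less_eq_dividend] d])
    have "H (k div m) \<in> borel_measurable (F (real k * d))"
      by (rule measurable_F_mono[OF H[OF k] le])
    moreover have "\<zeta> (real (k div m * m) * d) \<in> borel_measurable (F (real k * d))"
      by (rule measurable_F_mono[OF \<zeta>_measurable_F le]) (use d in simp)
    moreover have "\<zeta> (real k * d) \<in> borel_measurable (F (real k * d))"
      by (rule \<zeta>_measurable_F) (use d in simp)
    ultimately show ?thesis unfolding \<xi>_def by measurable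
  qed
  have \<xi>b: "norm (\<xi> k \<omega>) \<le> 1 * (2 * C)" if "k < n * m" "\<omega> \<in> space P" for k \<omega>
    unfolding \<xi>_def norm_mult
  proof (intro mult_mono)
    show "norm (H (k div m) \<omega>) \<le> 1" using that by (intro Hb) (simp add: less_mult_imp_div_less)
    show "norm (\<zeta> (real k * d) \<omega> - \<zeta> (real (k div m * m) * d) \<omega>) \<le> 2 * C"
      using norm_triangle_ineq4[of "\<zeta> (real k * d) \<omega>" "\<zeta> (real (k div m * m) * d) \<omega>"]
        \<zeta>_bounded[of "real k * d" \<omega>] \<zeta>_bounded[of "real (k div m * m) * d" \<omega>] d that(2) by simp
  qed auto
  have mono: "real k * d \<le> real (Suc k) * d" "0 \<le> real 0 * d" for k
    using d by (auto intro: mult_right_mono)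
  note iso = ito_isometry_complex[where \<tau>="\<lambda>k. real k * d" and n="n * m" and \<xi>=\<xi>, OF mono \<xi>m \<xi>b]
  show "integrable P (\<lambda>\<omega>. (norm (\<Sum>j<n. H j \<omega> * ito_error (\<lambda>s. W s \<omega>) (\<lambda>s. \<zeta> s \<omega>) d m j))\<^sup>2)"
    unfolding S by (rule iso(1))
  have "expectation (\<lambda>\<omega>. (norm (\<Sum>j<n. H j \<omega> * ito_error (\<lambda>s. W s \<omega>) (\<lambda>s. \<zeta> s \<omega>) d m j))\<^sup>2) =
    (\<Sum>k<n * m. expectation (\<lambda>\<omega>. (norm (\<xi> k \<omega>))\<^sup>2) * (real (Suc k) * d - real k * d))"
    unfolding S by (rule iso(2))
  also have "\<dots> = (\<Sum>k<n * m. expectation (\<lambda>\<omega>. (norm (H (k div m) \<omega> * (\<zeta> (real k * d) \<omega> - \<zeta> (real (k div m * m) * d) \<omega>)))\<^sup>2) * d)"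
    by (intro sum.cong refl) (simp add: \<xi>_def algebra_simps)
  finally show "expectation (\<lambda>\<omega>. (norm (\<Sum>j<n. H j \<omega> * ito_error (\<lambda>s. W s \<omega>) (\<lambda>s. \<zeta> s \<omega>) d m j))\<^sup>2) =
      (\<Sum>k<n * m. expectation (\<lambda>\<omega>. (norm (H (k div m) \<omega> * (\<zeta> (real k * d) \<omega> - \<zeta> (real (k div m * m) * d) \<omega>)))\<^sup>2) * d)" .
qed

text \<open>Weights of norm at most 1 can only decrease the second moment. Passing from
  \<open>n\<close> to the full range \<open>n'\<close> lets one limit serve all partial sums that
  end at a dyadic point.\<close>

lemma ito_error_sum_le:
  assumes d: "0 \<le> d" and m: "m > 0" and n: "n \<le> n'"
    and H: "\<And>j. j < n \<Longrightarrow> H j \<in> borel_measurable (F (real (j * m) * d))"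
    and Hb: "\<And>j \<omega>. j < n \<Longrightarrow> \<omega> \<in> space P \<Longrightarrow> norm (H j \<omega> :: complex) \<le> 1"
  shows "expectation (\<lambda>\<omega>. (norm (\<Sum>j<n. H j \<omega> * ito_error (\<lambda>s. W s \<omega>) (\<lambda>s. \<zeta> s \<omega>) d m j))\<^sup>2) \<le> expectation (osc_sum d n' m)"
proof -
  have zi: "integrable P (\<lambda>\<omega>. (norm (\<zeta> (real k * d) \<omega> - \<zeta> (real (k div m * m) * d) \<omega>))\<^sup>2)" for k
    by (rule integrable_\<zeta>_diff) (use d in auto)
  have "expectation (\<lambda>\<omega>. (norm (\<Sum>j<n. H j \<omega> * ito_error (\<lambda>s. W s \<omega>) (\<lambda>s. \<zeta> s \<omega>) d m j))\<^sup>2) =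
    (\<Sum>k<n * m. expectation (\<lambda>\<omega>. (norm (H (k div m) \<omega> * (\<zeta> (real k * d) \<omega> - \<zeta> (real (k div m * m) * d) \<omega>)))\<^sup>2) * d)"
    by (rule ito_error_second_moment(2)[OF d m H Hb])
  also have "\<dots> \<le> (\<Sum>k<n * m. expectation (\<lambda>\<omega>. (norm (\<zeta> (real k * d) \<omega> - \<zeta> (real (k div m * m) * d) \<omega>))\<^sup>2) * d)"
  proof (intro sum_mono mult_right_mono d integral_mono' zi)
    fix k \<omega> assume "k \<in> {..<n * m}" "\<omega> \<in> space P"
    then have "norm (H (k div m) \<omega>) \<le> 1" by (intro Hb) (simp_all add: less_mult_imp_div_less)
    then have "norm (H (k div m) \<omega> * (\<zeta> (real k * d) \<omega> - \<zeta> (real (k div m * m) * d) \<omega>)) \<le>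
      norm (\<zeta> (real k * d) \<omega> - \<zeta> (real (k div m * m) * d) \<omega>)"
      unfolding norm_mult by (rule mult_left_le_one_le[rotated 2]) auto
    then show "(norm (H (k div m) \<omega> * (\<zeta> (real k * d) \<omega> - \<zeta> (real (k div m * m) * d) \<omega>)))\<^sup>2 \<le>
      (norm (\<zeta> (real k * d) \<omega> - \<zeta> (real (k div m * m) * d) \<omega>))\<^sup>2" by (intro power_mono) auto
  qed auto
  also have "\<dots> \<le> (\<Sum>k<n' * m. expectation (\<lambda>\<omega>. (norm (\<zeta> (real k * d) \<omega> - \<zeta> (real (k div m * m) * d) \<omega>))\<^sup>2) * d)"
    using n d by (intro sum_mono2) (auto intro: less_le_trans)
  also have "\<dots> = expectation (osc_sum d n' m)"
    unfolding osc_sum_def using zi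
    by (subst Bochner_Integration.integral_sum) auto
  finally show ?thesis .
qed

text \<open>Taking the indicator of block \<open>i\<close> as the weight isolates its second moment;
  these moments add up to the whole oscillation.\<close>

lemma ito_error_squares:
  assumes d: "0 \<le> d" and m: "m > 0"
  shows "integrable P (\<lambda>\<omega>. \<Sum>j<n. (norm (ito_error (\<lambda>s. W s \<omega>) (\<lambda>s. \<zeta> s \<omega>) d m j))\<^sup>2)"
    "expectation (\<lambda>\<omega>. \<Sum>j<n. (norm (ito_error (\<lambda>s. W s \<omega>) (\<lambda>s. \<zeta> s \<omega>) d m j))\<^sup>2) = expectation (osc_sum d n m)"
proof -
  have zi: "integrable P (\<lambda>\<omega>. (norm (\<zeta> (real k * d) \<omega> - \<zeta> (real (k div m * m) * d) \<omega>))\<^sup>2)" for k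
    by (rule integrable_\<zeta>_diff) (use d in auto)
  have *: "integrable P (\<lambda>\<omega>. (norm (ito_error (\<lambda>s. W s \<omega>) (\<lambda>s. \<zeta> s \<omega>) d m i))\<^sup>2) \<and>
    expectation (\<lambda>\<omega>. (norm (ito_error (\<lambda>s. W s \<omega>) (\<lambda>s. \<zeta> s \<omega>) d m i))\<^sup>2) =
    (\<Sum>r<m. expectation (\<lambda>\<omega>. (norm (\<zeta> (real (i * m + r) * d) \<omega> - \<zeta> (real ((i * m + r) div m * m) * d) \<omega>))\<^sup>2) * d)"
    if i: "i < n" for i
  proof -
    define H where "H j = (\<lambda>\<omega>::'w. of_bool (j = i) :: complex)" for j
    have sum: "(\<Sum>j<n. H j \<omega> * f j) = f i" for f :: "nat \<Rightarrow> complex" and \<omega>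
      using i by (simp add: H_def of_bool_def if_distrib[of "\<lambda>x. x * _"] sum.delta cong: if_cong)
    note sm = ito_error_second_moment[OF d m, of n H]
    have "integrable P (\<lambda>\<omega>. (norm (ito_error (\<lambda>s. W s \<omega>) (\<lambda>s. \<zeta> s \<omega>) d m i))\<^sup>2)"
      "expectation (\<lambda>\<omega>. (norm (ito_error (\<lambda>s. W s \<omega>) (\<lambda>s. \<zeta> s \<omega>) d m i))\<^sup>2) =
       (\<Sum>k<n * m. expectation (\<lambda>\<omega>. (norm (H (k div m) \<omega> * (\<zeta> (real k * d) \<omega> - \<zeta> (real (k div m * m) * d) \<omega>)))\<^sup>2) * d)"
      using sm unfolding sum by (auto simp: H_def)
    moreover have "(\<Sum>k<n * m. expectation (\<lambda>\<omega>. (norm (H (k div m) \<omega> * (\<zeta> (real k * d) \<omega> - \<zeta> (real (k div m * m) * d) \<omega>)))\<^sup>2) * d)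
      = (\<Sum>j<n. if j = i then (\<Sum>r<m. expectation (\<lambda>\<omega>. (norm (\<zeta> (real (i * m + r) * d) \<omega> - \<zeta> (real ((i * m + r) div m * m) * d) \<omega>))\<^sup>2) * d) else 0)"
      unfolding sum_blocks
    proof (intro sum.cong refl)
      fix j
      have "(j * m + r) div m = j" if "r \<in> {..<m}" for r using that m by simp
      then show "(\<Sum>r<m. expectation (\<lambda>\<omega>. (norm (H ((j * m + r) div m) \<omega> * (\<zeta> (real (j * m + r) * d) \<omega> - \<zeta> (real ((j * m + r) div m * m) * d) \<omega>)))\<^sup>2) * d)
        = (if j = i then (\<Sum>r<m. expectation (\<lambda>\<omega>. (norm (\<zeta> (real (i * m + r) * d) \<omega> - \<zeta> (real ((i * m + r) div m * m) * d) \<omega>))\<^sup>2) * d) else 0)"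
        by (cases "j = i") (simp_all add: H_def del: of_nat_add of_nat_mult)
    qed
    ultimately show ?thesis using i by (simp add: sum.delta del: of_nat_add of_nat_mult)
  qed
  show "integrable P (\<lambda>\<omega>. \<Sum>j<n. (norm (ito_error (\<lambda>s. W s \<omega>) (\<lambda>s. \<zeta> s \<omega>) d m j))\<^sup>2)"
    using * by (intro Bochner_Integration.integrable_sum) auto
  have "expectation (\<lambda>\<omega>. \<Sum>j<n. (norm (ito_error (\<lambda>s. W s \<omega>) (\<lambda>s. \<zeta> s \<omega>) d m j))\<^sup>2) =
    (\<Sum>j<n. expectation (\<lambda>\<omega>. (norm (ito_error (\<lambda>s. W s \<omega>) (\<lambda>s. \<zeta> s \<omega>) d m j))\<^sup>2))"
    using * by (intro Bochner_Integration.integral_sum) auto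
  also have "\<dots> = (\<Sum>k<n * m. expectation (\<lambda>\<omega>. (norm (\<zeta> (real k * d) \<omega> - \<zeta> (real (k div m * m) * d) \<omega>))\<^sup>2) * d)"
    unfolding sum_blocks using * by (intro sum.cong refl) auto
  also have "\<dots> = expectation (osc_sum d n m)"
    unfolding osc_sum_def using zi by (subst Bochner_Integration.integral_sum) auto
  finally show "expectation (\<lambda>\<omega>. \<Sum>j<n. (norm (ito_error (\<lambda>s. W s \<omega>) (\<lambda>s. \<zeta> s \<omega>) d m j))\<^sup>2) = expectation (osc_sum d n m)" .
qed

text \<open>Dominated convergence: by uniform continuity of the path, the oscillation within blocks
  is small as soon as \<open>t / 2 ^ l\<close> is, whatever \<open>m\<close>. Hence \<open>m\<close>
  remains free to be dictated by the approximation of the integral.\<close>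

lemma osc_sum_tendsto_0:
  fixes m :: "nat \<Rightarrow> nat"
  assumes t: "t > 0" and m: "\<And>l. m l > 0"
  shows "(\<lambda>l. expectation (osc_sum (t / 2 ^ l / real (m l)) (2 ^ l) (m l))) \<longlonglongrightarrow> 0"
proof -
  define d where "d l = t / 2 ^ l / real (m l)" for l
  have d: "0 \<le> d l" for l using t by (simp add: d_def)
  have total: "real (2 ^ l * m l) * d l = t" for l using m[of l] by (simp add: d_def)
  have "(\<lambda>l. expectation (osc_sum (d l) (2 ^ l) (m l))) \<longlonglongrightarrow> expectation (\<lambda>\<omega>. 0)"
  proof (rule integral_dominated_convergence[where w="\<lambda>_. (2 * C)\<^sup>2 * t"])
    show "osc_sum (d l) (2 ^ l) (m l) \<in> borel_measurable P" for l
      using integrable_osc_sum[OF d] by auto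
    show "AE \<omega> in P. norm (osc_sum (d l) (2 ^ l) (m l) \<omega>) \<le> (2 * C)\<^sup>2 * t" for l
    proof (rule AE_I2)
      fix \<omega> assume \<omega>: "\<omega> \<in> space P"
      have "osc_sum (d l) (2 ^ l) (m l) \<omega> \<le> (\<Sum>k<2 ^ l * m l. (2 * C)\<^sup>2 * d l)"
        unfolding osc_sum_def
      proof (intro sum_mono mult_right_mono d power_mono)
        fix k show "norm (\<zeta> (real k * d l) \<omega> - \<zeta> (real (k div m l * m l) * d l) \<omega>) \<le> 2 * C"
          using norm_triangle_ineq4[of "\<zeta> (real k * d l) \<omega>" "\<zeta> (real (k div m l * m l) * d l) \<omega>"]
            \<zeta>_bounded[of "real k * d l" \<omega>] \<zeta>_bounded[of "real (k div m l * m l) * d l" \<omega>] d \<omega> by simp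
      qed auto
      also have "\<dots> = (2 * C)\<^sup>2 * (real (2 ^ l * m l) * d l)" by simp
      finally have "osc_sum (d l) (2 ^ l) (m l) \<omega> \<le> (2 * C)\<^sup>2 * t" unfolding total .
      moreover have "0 \<le> osc_sum (d l) (2 ^ l) (m l) \<omega>"
        unfolding osc_sum_def using d by (intro sum_nonneg) auto
      ultimately show "norm (osc_sum (d l) (2 ^ l) (m l) \<omega>) \<le> (2 * C)\<^sup>2 * t" by simp
    qed
    show "AE \<omega> in P. (\<lambda>l. osc_sum (d l) (2 ^ l) (m l) \<omega>) \<longlonglongrightarrow> 0"
      using \<zeta>_continuous
    proof eventually_elim
      case (elim \<omega>)
      have "continuous_on {0..t} (\<lambda>s. \<zeta> s \<omega>)" by (rule continuous_on_subset[OF elim]) auto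
      then have uc: "uniformly_continuous_on {0..t} (\<lambda>s. \<zeta> s \<omega>)"
        by (rule compact_uniformly_continuous) simp
      show ?case
      proof (rule LIMSEQ_I)
        fix r :: real assume r: "r > 0"
        \<comment> \<open>Chosen so that \<open>\<epsilon>\<^sup>2 * t\<close> equals r / 2.\<close>
        define \<epsilon> where "\<epsilon> = sqrt (r / (2 * t))"
        have \<epsilon>: "\<epsilon> > 0" "\<epsilon>\<^sup>2 * t < r" using r t by (auto simp: \<epsilon>_def)
        obtain \<delta> where \<delta>: "\<delta> > 0" "\<And>x y. x \<in> {0..t} \<Longrightarrow> y \<in> {0..t} \<Longrightarrow> dist y x < \<delta> \<Longrightarrow> dist (\<zeta> y \<omega>) (\<zeta> x \<omega>) < \<epsilon>"
          using uc \<epsilon>(1) unfolding uniformly_continuous_on_def by metis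
        obtain l0 :: nat where l0: "t / \<delta> < 2 ^ l0" using real_arch_pow[of 2 "t / \<delta>"] by auto
        show "\<exists>no. \<forall>l\<ge>no. norm (osc_sum (d l) (2 ^ l) (m l) \<omega> - 0) < r"
        proof (intro exI allI impI)
          fix l assume l: "l \<ge> l0"
          have "t / \<delta> < 2 ^ l"
            using l0 power_increasing[OF l, of "2::real"] by linarith
          then have step: "t / 2 ^ l < \<delta>" using \<delta>(1) by (simp add: field_simps)
          have "osc_sum (d l) (2 ^ l) (m l) \<omega> \<le> (\<Sum>k<2 ^ l * m l. \<epsilon>\<^sup>2 * d l)"
            unfolding osc_sum_def
          proof (intro sum_mono mult_right_mono d power_mono)
            fix k assume k: "k \<in> {..<2 ^ l * m l}"
            have "real k * d l \<le> real (2 ^ l * m l) * d l" using k d by (intro mult_right_mono) (auto simp del: of_nat_mult of_nat_power)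
            then have 1: "real k * d l \<in> {0..t}" unfolding total using d by simp
            have 2: "real (k div m l * m l) * d l \<le> real k * d l" by (rule mult_right_mono[OF of_nat_mono[OF div_times_less_eq_dividend] d])
            have "k - k div m l * m l \<le> m l" using m[of l] by (simp add: minus_div_mult_eq_mod less_imp_le)
            then have "real k - real (k div m l * m l) \<le> real (m l)"
              by (metis of_nat_diff of_nat_le_iff div_times_less_eq_dividend)
            then have "(real k - real (k div m l * m l)) * d l \<le> real (m l) * d l"
              using d by (intro mult_right_mono) auto
            also have "\<dots> < \<delta>" using step m[of l] by (simp add: d_def)
            finally have "dist (real k * d l) (real (k div m l * m l) * d l) < \<delta>"
              using 2 by (simp add: dist_real_def left_diff_distrib del: of_nat_mult)
            then show "norm (\<zeta> (real k * d l) \<omega> - \<zeta> (real (k div m l * m l) * d l) \<omega>) \<le> \<epsilon>"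
              using \<delta>(2)[of "real (k div m l * m l) * d l" "real k * d l"] 1 2 d[of l]
              by (simp add: dist_norm less_imp_le)
          qed auto
          also have "\<dots> = \<epsilon>\<^sup>2 * (real (2 ^ l * m l) * d l)" by simp
          also have "\<dots> < r" unfolding total by (rule \<epsilon>)
          finally have "osc_sum (d l) (2 ^ l) (m l) \<omega> < r" .
          moreover have "0 \<le> osc_sum (d l) (2 ^ l) (m l) \<omega>"
            unfolding osc_sum_def using d by (intro sum_nonneg) auto
          ultimately show "norm (osc_sum (d l) (2 ^ l) (m l) \<omega> - 0) < r" by simp
        qed
      qed
    qed
  qed auto
  then show ?thesis by (simp add: d_def)
qed

end

context stratonovich_functional begin

text \<open>\<open>J * m\<close> steps of length \<open>t / 2 ^ l / real m\<close> form a uniform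
  partition up to the J-th coarse point, so \<open>I_limit\<close> applies at each of the finitely
  many coarse points and one \<open>m\<close> serves them all.\<close>

lemma exists_fine_scale:
  assumes t: "t > 0"
  shows "\<exists>m>0. prob {\<omega>\<in>space P. (\<Sum>J\<le>2 ^ l. norm (I (real J * (t / 2 ^ l)) \<omega> -
     trapezoid (\<lambda>s. W s \<omega>) (\<lambda>s. \<zeta> s \<omega>) (t / 2 ^ l / real m) (J * m))) > (1/2) ^ l} < (1/2) ^ l"
proof -
  define X where "X J n \<omega> = norm (I (real J * (t / 2 ^ l)) \<omega> -
     trapezoid (\<lambda>s. W s \<omega>) (\<lambda>s. \<zeta> s \<omega>) (t / 2 ^ l / real (Suc n)) (J * Suc n))" for J n \<omega>
  have X: "X J n \<in> borel_measurable P" for J n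
  proof -
    have [measurable]: "I (real J * (t / 2 ^ l)) \<in> borel_measurable P"
      using t by (intro I_measurable) auto
    have [measurable]: "(\<lambda>\<omega>. trapezoid (\<lambda>s. W s \<omega>) (\<lambda>s. \<zeta> s \<omega>) (t / 2 ^ l / real (Suc n)) (J * Suc n)) \<in> borel_measurable P"
      using t by (intro trapezoid_measurable) auto
    show ?thesis unfolding X_def by measurable
  qed
  have "(\<lambda>n. prob {\<omega>\<in>space P. \<bar>X J n \<omega>\<bar> > \<epsilon>}) \<longlonglongrightarrow> 0" if "\<epsilon> > 0" for J \<epsilon>
  proof (cases "J = 0")
    case True
    then have "X J n \<omega> = 0" for n \<omega> by (simp add: X_def I_0 trapezoid_def)
    then show ?thesis using that by simp
  next
    case False
    have "filterlim (\<lambda>n. J * Suc n) at_top sequentially"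
    proof (rule filterlim_at_top_mono[OF filterlim_ident])
      have "x \<le> J * Suc x" for x using False by (cases J) auto
      then show "\<forall>\<^sub>F x in sequentially. x \<le> J * Suc x" by simp
    qed
    then have "(\<lambda>n. prob {\<omega>\<in>space P. norm (trapezoid (\<lambda>s. W s \<omega>) (\<lambda>s. \<zeta> s \<omega>)
        (real J * (t / 2 ^ l) / real (J * Suc n)) (J * Suc n) - I (real J * (t / 2 ^ l)) \<omega>) > \<epsilon>}) \<longlonglongrightarrow> 0"
      using t False that by (intro I_limit) auto
    moreover have "real J * (t / 2 ^ l) / real (J * Suc n) = t / 2 ^ l / real (Suc n)" for n
      using False by (simp only: of_nat_mult) (simp del: of_nat_Suc)
    ultimately show ?thesis unfolding X_def by (simp only: norm_minus_commute abs_norm_cancel)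
  qed
  then have "(\<lambda>n. prob {\<omega>\<in>space P. (\<Sum>J\<in>{..2 ^ l}. \<bar>X J n \<omega>\<bar>) > (1/2) ^ l}) \<longlonglongrightarrow> 0"
    by (intro tendsto_prob_sum X) auto
  then have "\<forall>\<^sub>F n in sequentially. prob {\<omega>\<in>space P. (\<Sum>J\<in>{..2 ^ l}. \<bar>X J n \<omega>\<bar>) > (1/2) ^ l} < (1/2) ^ l"
    by (rule order_tendstoD) simp
  from eventually_happens[OF this]
  obtain n where "prob {\<omega>\<in>space P. (\<Sum>J\<in>{..2 ^ l}. \<bar>X J n \<omega>\<bar>) > (1/2) ^ l} < (1/2) ^ l"
    by auto
  then show ?thesis unfolding X_def by (intro exI[of _ "Suc n"]) (simp del: of_nat_Suc)
qed

theorem explicit_solution: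
  assumes t: "t > 0"
  shows "AE \<omega> in P. \<zeta> t \<omega> = cis (\<kappa> * (W t \<omega> + a * t)) * \<zeta> 0 \<omega>"
proof -
  define w where "w \<omega> = (\<lambda>s. W s \<omega>)" for \<omega>
  define z where "z \<omega> = (\<lambda>s. \<zeta> s \<omega>)" for \<omega>
  define u where "u \<omega> s = cis (- (\<kappa> * (w \<omega> s + a * s)))" for \<omega> s
  define h where "h l = t / 2 ^ l" for l :: nat
  from choice[OF allI[OF exists_fine_scale[OF t]]]
  obtain m where m_fine: "\<forall>l. m l > 0 \<and> prob {\<omega>\<in>space P. (\<Sum>J\<le>2 ^ l. norm (I (real J * (t / 2 ^ l)) \<omega> -
     trapezoid (\<lambda>s. W s \<omega>) (\<lambda>s. \<zeta> s \<omega>) (t / 2 ^ l / real (m l)) (J * m l))) > (1/2) ^ l} < (1/2) ^ l"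
    by (rule exE)
  then have m: "m l > 0" and fine: "prob {\<omega>\<in>space P. (\<Sum>J\<le>2 ^ l. norm (I (real J * (t / 2 ^ l)) \<omega> -
     trapezoid (\<lambda>s. W s \<omega>) (\<lambda>s. \<zeta> s \<omega>) (t / 2 ^ l / real (m l)) (J * m l))) > (1/2) ^ l} < (1/2) ^ l" for l
    by auto
  define d where "d l = t / 2 ^ l / real (m l)" for l
  have d0: "d l \<ge> 0" and h0: "h l \<ge> 0" for l using t by (auto simp: d_def h_def)
  \<comment> \<open>The five families of errors that \<open>pathwise_solution\<close> asks about.
    \<open>X2\<close> and \<open>X5\<close> are squared because second moments control them;
    \<open>X5\<close> is set to 0 outside its range so that the expected oscillation bounds its
    expectation for every \<open>l\<close>.\<close>
  define X1 where "X1 l \<omega> = (\<Sum>J\<le>2 ^ l. norm (I (real J * h l) \<omega> - trapezoid (w \<omega>) (z \<omega>) (d l) (J * m l)))" for l \<omega>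
  define X2 where "X2 l \<omega> = (norm (\<Sum>j<2 ^ l. u \<omega> (real j * h l) * ito_error (w \<omega>) (z \<omega>) (d l) (m l) j))\<^sup>2" for l \<omega>
  define X3 where "X3 l \<omega> = (\<Sum>j<2 ^ l. (norm (ito_error (w \<omega>) (z \<omega>) (d l) (m l) j))\<^sup>2)" for l \<omega>
  define X4 where "X4 b B l \<omega> = norm (trapezoid (w \<omega>) (z \<omega>) (h l) (B * 2 ^ (l - b)) - I (real B * (t / 2 ^ b)) \<omega>)" for b B l \<omega>
  define X5 where "X5 b B l \<omega> = (if l \<ge> b \<and> B \<le> 2 ^ b then
    (norm (\<Sum>j<B * 2 ^ (l - b). ito_error (w \<omega>) (z \<omega>) (d l) (m l) j))\<^sup>2 else 0)" for b B l \<omega>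
  have [measurable]: "(\<lambda>\<omega>. trapezoid (w \<omega>) (z \<omega>) (d l) J) \<in> borel_measurable P"
    "(\<lambda>\<omega>. trapezoid (w \<omega>) (z \<omega>) (h l) J) \<in> borel_measurable P"
    "(\<lambda>\<omega>. ito_error (w \<omega>) (z \<omega>) (d l) (m l) J) \<in> borel_measurable P"
    "(\<lambda>\<omega>. u \<omega> (real J * h l)) \<in> borel_measurable P"
    "I (real J * h l) \<in> borel_measurable P" "I (real J * (t / 2 ^ l)) \<in> borel_measurable P" for l J
  proof -
    have [measurable]: "W (real J * h l) \<in> borel_measurable P" by (intro W_measurable) (simp add: h0)
    show "(\<lambda>\<omega>. u \<omega> (real J * h l)) \<in> borel_measurable P"
      unfolding u_def w_def cis_conv_exp by measurable
  qed (use t d0 h0 in \<open>auto simp: w_def z_def intro!: trapezoid_measurable ito_error_measurable I_measurable\<close>)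
  have X_measurable: "X1 l \<in> borel_measurable P" "X2 l \<in> borel_measurable P" "X3 l \<in> borel_measurable P"
    "X4 b B l \<in> borel_measurable P" "X5 b B l \<in> borel_measurable P" for b B l
    unfolding X1_def X2_def X3_def X4_def X5_def by measurable
  have osc: "(\<lambda>l. expectation (osc_sum (d l) (2 ^ l) (m l))) \<longlonglongrightarrow> 0"
    unfolding d_def by (rule osc_sum_tendsto_0[OF t m])
  have X1: "(\<lambda>l. prob {\<omega>\<in>space P. \<bar>X1 l \<omega>\<bar> > \<epsilon>}) \<longlonglongrightarrow> 0" if "\<epsilon> > 0" for \<epsilon>
  proof (rule tendsto_sandwich[OF _ _ tendsto_const])
    have half: "(\<lambda>l. (1/2::real) ^ l) \<longlonglongrightarrow> 0" by (rule LIMSEQ_power_zero) simp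
    have "\<forall>\<^sub>F l in sequentially. (1/2) ^ l < \<epsilon>" using order_tendstoD(2)[OF half that] .
    then show "\<forall>\<^sub>F l in sequentially. prob {\<omega>\<in>space P. \<bar>X1 l \<omega>\<bar> > \<epsilon>} \<le> (1/2) ^ l"
    proof eventually_elim
      case (elim l)
      have [measurable]: "X1 l \<in> borel_measurable P" by fact
      have "prob {\<omega>\<in>space P. \<bar>X1 l \<omega>\<bar> > \<epsilon>} \<le> prob {\<omega>\<in>space P. X1 l \<omega> > (1/2) ^ l}"
        using elim by (intro finite_measure_mono) (auto simp: X1_def abs_of_nonneg sum_nonneg)
      also have "\<dots> < (1/2) ^ l"
        using fine[of l] by (simp add: X1_def h_def d_def w_def z_def)
      finally show ?case by simp
    qed
    show "(\<lambda>l. (1/2::real) ^ l) \<longlonglongrightarrow> 0" by fact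
  qed simp
  have uF: "(\<lambda>\<omega>. u \<omega> (real j * h l)) \<in> borel_measurable (F (real (j * m l) * d l))" for j l
  proof -
    have eq: "real (j * m l) * d l = real j * h l" using m[of l] by (simp add: d_def h_def)
    have [measurable]: "W (real j * h l) \<in> borel_measurable (F (real j * h l))"
      by (intro W_measurable_F) (simp add: h0)
    show ?thesis
      unfolding eq u_def w_def cis_conv_exp by measurable
  qed
  have ub: "norm (u \<omega> s) \<le> 1" for \<omega> s by (simp add: u_def)
  have X2: "(\<lambda>l. prob {\<omega>\<in>space P. \<bar>X2 l \<omega>\<bar> > \<epsilon>}) \<longlonglongrightarrow> 0" if "\<epsilon> > 0" for \<epsilon>
  proof (rule tendsto_prob_of_expectation[OF _ _ _ that])
    show "integrable P (X2 l)" for l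
      unfolding X2_def w_def z_def
      using ito_error_second_moment(1)[OF d0 m uF[unfolded w_def] ub[unfolded w_def]] by simp
    have "expectation (X2 l) \<le> expectation (osc_sum (d l) (2 ^ l) (m l))" for l
      unfolding X2_def w_def z_def
      using ito_error_sum_le[OF d0 m order_refl uF[unfolded w_def] ub[unfolded w_def]] by simp
    moreover have "0 \<le> expectation (X2 l)" for l by (intro Bochner_Integration.integral_nonneg) (simp add: X2_def)
    ultimately show "(\<lambda>l. expectation (X2 l)) \<longlonglongrightarrow> 0"
      by (intro tendsto_sandwich[OF _ _ tendsto_const osc] always_eventually allI)
  qed (simp add: X2_def)
  have X3: "(\<lambda>l. prob {\<omega>\<in>space P. \<bar>X3 l \<omega>\<bar> > \<epsilon>}) \<longlonglongrightarrow> 0" if "\<epsilon> > 0" for \<epsilon>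
  proof (rule tendsto_prob_of_expectation[OF _ _ _ that])
    show "integrable P (X3 l)" for l
      unfolding X3_def w_def z_def by (rule ito_error_squares[OF d0 m])
    show "(\<lambda>l. expectation (X3 l)) \<longlonglongrightarrow> 0"
      using osc unfolding X3_def w_def z_def ito_error_squares(2)[OF d0 m] .
  qed (simp add: X3_def sum_nonneg)
  have X5: "(\<lambda>l. prob {\<omega>\<in>space P. \<bar>X5 b B l \<omega>\<bar> > \<epsilon>}) \<longlonglongrightarrow> 0" if "\<epsilon> > 0" for \<epsilon> b B
  proof (rule tendsto_prob_of_expectation[OF _ _ _ that])
    show "integrable P (X5 b B l)" for l
      unfolding X5_def w_def z_def
      using ito_error_second_moment(1)[where d="d l" and m="m l" and n="B * 2 ^ (l - b)" and H="\<lambda>_ _. 1", OF d0 m] by (cases "l \<ge> b \<and> B \<le> 2 ^ b") auto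
    have "expectation (X5 b B l) \<le> expectation (osc_sum (d l) (2 ^ l) (m l))" for l
    proof (cases "l \<ge> b \<and> B \<le> 2 ^ b")
      case True
      then have "B * 2 ^ (l - b) \<le> 2 ^ b * 2 ^ (l - b)" by (intro mult_right_mono) auto
      also have "\<dots> = 2 ^ l" using True by (simp add: power_add[symmetric])
      finally show ?thesis
        using True ito_error_sum_le[where d="d l" and m="m l" and n="B * 2 ^ (l - b)" and n'="2 ^ l" and H="\<lambda>_ _. 1", OF d0 m]
        by (simp add: X5_def[abs_def] w_def z_def)
    next
      case False
      then have "X5 b B l = (\<lambda>\<omega>. 0)" by (auto simp: X5_def fun_eq_iff)
      moreover have "0 \<le> expectation (osc_sum (d l) (2 ^ l) (m l))"
        by (intro Bochner_Integration.integral_nonneg) (simp add: osc_sum_def sum_nonneg d0)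
      ultimately show ?thesis by simp
    qed
    moreover have "0 \<le> expectation (X5 b B l)" for l by (intro Bochner_Integration.integral_nonneg) (simp add: X5_def)
    ultimately show "(\<lambda>l. expectation (X5 b B l)) \<longlonglongrightarrow> 0"
      by (intro tendsto_sandwich[OF _ _ tendsto_const osc] always_eventually allI)
  qed (simp add: X5_def)
  have X4: "(\<lambda>l. prob {\<omega>\<in>space P. \<bar>X4 b B l \<omega>\<bar> > \<epsilon>}) \<longlonglongrightarrow> 0" if "\<epsilon> > 0" for \<epsilon> b B
  proof (cases "B = 0")
    case True
    then have "X4 b B l \<omega> = 0" for l \<omega> by (simp add: X4_def I_0 trapezoid_def)
    then show ?thesis using that by simp
  next
    case False
    have "filterlim (\<lambda>l. B * 2 ^ (l - b)) at_top sequentially"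
    proof (rule filterlim_at_top_mono[where f="\<lambda>l. l - b"])
      show "filterlim (\<lambda>l. l - b) at_top sequentially" by (rule filterlim_minus_const_nat_at_top)
      have "x - b \<le> B * 2 ^ (x - b)" for x
        using False less_exp[of "x - b"] mult_le_mono[of 1 B "x - b" "2 ^ (x - b)"] by simp
      then show "\<forall>\<^sub>F x in sequentially. x - b \<le> B * 2 ^ (x - b)" by simp
    qed
    then have "(\<lambda>n. prob {\<omega>\<in>space P. norm (trapezoid (\<lambda>s. W s \<omega>) (\<lambda>s. \<zeta> s \<omega>)
        (real B * (t / 2 ^ b) / real (B * 2 ^ (n - b))) (B * 2 ^ (n - b)) - I (real B * (t / 2 ^ b)) \<omega>) > \<epsilon>}) \<longlonglongrightarrow> 0"
      using t False that by (intro I_limit) auto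
    then show ?thesis
    proof (rule Lim_transform_eventually)
      show "\<forall>\<^sub>F n in sequentially. prob {\<omega>\<in>space P. norm (trapezoid (\<lambda>s. W s \<omega>) (\<lambda>s. \<zeta> s \<omega>)
        (real B * (t / 2 ^ b) / real (B * 2 ^ (n - b))) (B * 2 ^ (n - b)) - I (real B * (t / 2 ^ b)) \<omega>) > \<epsilon>} =
        prob {\<omega>\<in>space P. \<bar>X4 b B n \<omega>\<bar> > \<epsilon>}"
        using eventually_ge_at_top[of b]
      proof eventually_elim
        case (elim n)
        have "(2::real) ^ n = 2 ^ b * 2 ^ (n - b)" using elim by (simp add: power_add[symmetric])
        then have "real B * (t / 2 ^ b) / real (B * 2 ^ (n - b)) = h n"
          using False by (simp add: h_def)
        then show ?case by (simp add: X4_def w_def z_def)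
      qed
    qed
  qed
  \<comment> \<open>Triples are countable, so one subsequence serves all dyadic levels
    \<open>b\<close> and points \<open>B\<close>. The codes 0 to 3 select \<open>X1\<close> to
    \<open>X4\<close>, every other code \<open>X5\<close>.\<close>
  define X :: "nat \<times> nat \<times> nat \<Rightarrow> nat \<Rightarrow> 'w \<Rightarrow> real" where
    "X = (\<lambda>(c, b, B). if c = 0 then X1 else if c = 1 then X2 else if c = 2 then X3 else if c = 3 then X4 b B else X5 b B)"
  have "\<exists>s. filterlim s at_top sequentially \<and> (AE \<omega> in P. \<forall>i. (\<lambda>n. X (from_nat i) (s n) \<omega>) \<longlonglongrightarrow> 0)"
  proof (rule AE_diagonal_subsequence)
    fix i
    obtain c b B where i: "from_nat i = (c :: nat, b :: nat, B :: nat)" by (metis prod_cases3)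
    show "X (from_nat i) n \<in> borel_measurable P" for n
      using X_measurable by (simp add: X_def i)
    show "(\<lambda>n. prob {\<omega>\<in>space P. \<bar>X (from_nat i) n \<omega>\<bar> > \<epsilon>}) \<longlonglongrightarrow> 0" if "\<epsilon> > 0" for \<epsilon>
      using X1 X2 X3 X4 X5 that by (simp add: X_def i)
  qed
  then obtain s where s: "filterlim s at_top sequentially"
    and "AE \<omega> in P. \<forall>i. (\<lambda>n. X (from_nat i) (s n) \<omega>) \<longlonglongrightarrow> 0" by blast
  then have conv: "AE \<omega> in P. \<forall>c b B. (\<lambda>n. X (c, b, B) (s n) \<omega>) \<longlonglongrightarrow> 0"
  proof (elim eventually_mono, intro allI)
    fix \<omega> and c b B :: nat assume "\<forall>i. (\<lambda>n. X (from_nat i) (s n) \<omega>) \<longlonglongrightarrow> 0"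
    then have "(\<lambda>n. X (from_nat (to_nat (c, b, B))) (s n) \<omega>) \<longlonglongrightarrow> 0" by blast
    then show "(\<lambda>n. X (c, b, B) (s n) \<omega>) \<longlonglongrightarrow> 0" unfolding from_nat_to_nat .
  qed
  have quad: "AE \<omega> in P. \<exists>K. \<exists>\<^sub>F i in sequentially.
     quad_sum (\<lambda>s. W s \<omega>) (\<lambda>s. \<zeta> s \<omega>) (d (s i)) (2 ^ s i * m (s i)) + quad_sum (\<lambda>s. W s \<omega>) (\<lambda>s. \<zeta> s \<omega>) (h (s i)) (2 ^ s i) \<le> K"
    using t m by (intro quad_frequently[OF t]) (auto simp: d_def h_def)
  \<comment> \<open>The exceptional set of the equation depends on the time; the dyadic times are
    countable, so a single null set serves them.\<close>
  have eqs: "AE \<omega> in P. \<forall>b J. \<zeta> (real J * (t / 2 ^ b)) \<omega> = \<zeta> 0 \<omega> + \<i> * of_real (\<kappa> * a) *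
     integral {0..real J * (t / 2 ^ b)} (\<lambda>s. \<zeta> s \<omega>) + \<i> * of_real \<kappa> * I (real J * (t / 2 ^ b)) \<omega>"
    unfolding AE_all_countable using t by (intro allI equation) auto
  have Wc: "AE \<omega> in P. continuous_on {0..} (\<lambda>s. W s \<omega>)" "AE \<omega> in P. W 0 \<omega> = 0"
    using wiener by (auto simp: wiener_process_def continuous_process_def)
  show ?thesis
    using conv quad eqs Wc \<zeta>_continuous
  proof eventually_elim
    case (elim \<omega>)
    obtain K where "\<exists>\<^sub>F i in sequentially.
      quad_sum (w \<omega>) (z \<omega>) (d (s i)) (2 ^ s i * m (s i)) + quad_sum (w \<omega>) (z \<omega>) (h (s i)) (2 ^ s i) \<le> K"
      using elim(2) unfolding w_def z_def by blast
    then have "infinite {i. quad_sum (w \<omega>) (z \<omega>) (d (s i)) (2 ^ s i * m (s i)) + quad_sum (w \<omega>) (z \<omega>) (h (s i)) (2 ^ s i) \<le> K}"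
      by (simp add: frequently_cofinite cofinite_eq_sequentially[symmetric])
    \<comment> \<open>The path now thins the common sequence of scales to those with bounded
      quadratic sums. The limits are already pathwise and survive this; it is the reason why
      \<open>pathwise_solution\<close> admits arbitrary sequences of levels.\<close>
    then obtain r :: "nat \<Rightarrow> nat" where r: "strict_mono r"
      "\<And>i. quad_sum (w \<omega>) (z \<omega>) (d (s (r i))) (2 ^ s (r i) * m (s (r i))) + quad_sum (w \<omega>) (z \<omega>) (h (s (r i))) (2 ^ s (r i)) \<le> K"
      by (metis (mono_tags, lifting) infinite_enumerate mem_Collect_eq)
    have r_top: "filterlim r at_top sequentially" using r(1) by (rule filterlim_subseq)
    have lim: "(\<lambda>i. X (c, b, B) (s (r i)) \<omega>) \<longlonglongrightarrow> 0" for c b B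
      using filterlim_compose[OF elim(1)[rule_format] r_top] .
    have sqrt_lim: "(\<lambda>i. f i) \<longlonglongrightarrow> 0" if "(\<lambda>i. (f i)\<^sup>2) \<longlonglongrightarrow> 0" for f :: "nat \<Rightarrow> real"
      using tendsto_real_sqrt[OF that] by (simp add: tendsto_rabs_zero_iff)
    have "u \<omega> t * z \<omega> t = u \<omega> 0 * z \<omega> 0"
      unfolding u_def
    proof (rule pathwise_solution[where l="\<lambda>i. s (r i)" and m="\<lambda>i. m (s (r i))" and I="\<lambda>s. I s \<omega>" and K=K and t=t])
      show "continuous_on {0..t} (w \<omega>)" "continuous_on {0..t} (z \<omega>)"
        unfolding w_def z_def using elim by (auto intro: continuous_on_subset)
      show "filterlim (\<lambda>i. s (r i)) at_top sequentially" by (rule filterlim_compose[OF s r_top])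
      show "1 \<le> m (s (r i))" for i using m[of "s (r i)"] by simp
      show "z \<omega> (real J * (t / 2 ^ b)) = z \<omega> 0 + \<i> * of_real (\<kappa> * a) * integral {0..real J * (t / 2 ^ b)} (z \<omega>) +
         \<i> * of_real \<kappa> * I (real J * (t / 2 ^ b)) \<omega>" for b J
        using elim(3) unfolding z_def by blast
      show "(\<lambda>i. \<Sum>J\<le>2 ^ s (r i). norm (I (real J * (t / 2 ^ s (r i))) \<omega> -
          trapezoid (w \<omega>) (z \<omega>) (t / 2 ^ s (r i) / real (m (s (r i)))) (J * m (s (r i))))) \<longlonglongrightarrow> 0"
        using lim[of 0] by (simp add: X_def X1_def h_def d_def)
      show "(\<lambda>i. norm (\<Sum>j<2 ^ s (r i). cis (- (\<kappa> * (w \<omega> (real j * (t / 2 ^ s (r i))) + a * (real j * (t / 2 ^ s (r i)))))) *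
          ito_error (w \<omega>) (z \<omega>) (t / 2 ^ s (r i) / real (m (s (r i)))) (m (s (r i))) j)) \<longlonglongrightarrow> 0"
        by (rule sqrt_lim) (use lim[of 1] in \<open>simp add: X_def X2_def h_def d_def u_def\<close>)
      show "(\<lambda>i. \<Sum>j<2 ^ s (r i). (norm (ito_error (w \<omega>) (z \<omega>) (t / 2 ^ s (r i) / real (m (s (r i)))) (m (s (r i))) j))\<^sup>2) \<longlonglongrightarrow> 0"
        using lim[of 2] by (simp add: X_def X3_def h_def d_def)
      show "(\<lambda>i. norm (trapezoid (w \<omega>) (z \<omega>) (t / 2 ^ s (r i)) (B * 2 ^ (s (r i) - b)) - I (real B * (t / 2 ^ b)) \<omega>)) \<longlonglongrightarrow> 0" for b B
        using lim[of 3 b B] by (simp add: X_def X4_def h_def d_def)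
      show "(\<lambda>i. norm (\<Sum>j<B * 2 ^ (s (r i) - b). ito_error (w \<omega>) (z \<omega>) (t / 2 ^ s (r i) / real (m (s (r i)))) (m (s (r i))) j)) \<longlonglongrightarrow> 0"
        if B: "B \<le> 2 ^ b" for b B
      proof (rule sqrt_lim, rule Lim_transform_eventually)
        show "(\<lambda>i. X (4, b, B) (s (r i)) \<omega>) \<longlonglongrightarrow> 0" by (rule lim)
        have "\<forall>\<^sub>F i in sequentially. s (r i) \<ge> b"
          using filterlim_compose[OF s r_top] by (simp add: filterlim_at_top)
        then show "\<forall>\<^sub>F i in sequentially. X (4, b, B) (s (r i)) \<omega> =
          (norm (\<Sum>j<B * 2 ^ (s (r i) - b). ito_error (w \<omega>) (z \<omega>) (t / 2 ^ s (r i) / real (m (s (r i)))) (m (s (r i))) j))\<^sup>2"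
          by eventually_elim (use B in \<open>simp add: X_def X5_def d_def\<close>)
      qed
      show "quad_sum (w \<omega>) (z \<omega>) (t / 2 ^ s (r i) / real (m (s (r i)))) (2 ^ s (r i) * m (s (r i))) +
         quad_sum (w \<omega>) (z \<omega>) (t / 2 ^ s (r i)) (2 ^ s (r i)) \<le> K" for i
        using r(2)[of i] by (simp add: d_def h_def)
    qed (rule t)
    then have "cis (- (\<kappa> * (W t \<omega> + a * t))) * \<zeta> t \<omega> = \<zeta> 0 \<omega>"
      using elim(5) by (simp add: u_def w_def z_def)
    then have "cis (\<kappa> * (W t \<omega> + a * t)) * (cis (- (\<kappa> * (W t \<omega> + a * t))) * \<zeta> t \<omega>) = cis (\<kappa> * (W t \<omega> + a * t)) * \<zeta> 0 \<omega>"
      by simp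
    then show ?case by (simp add: mult.assoc[symmetric] cis_mult)
  qed
qed

end

section \<open>From the vector equation to its scalar projections\<close>

lemma power2_norm_Basis: "(norm x)\<^sup>2 = (\<Sum>b\<in>Basis. (x \<bullet> b)\<^sup>2)" for x :: "'a::euclidean_space"
  unfolding power2_norm_eq_inner euclidean_inner[of x x] by (simp add: power2_eq_square)

lemma power2_norm_add_le: "(norm (x + y))\<^sup>2 \<le> 2 * (norm x)\<^sup>2 + 2 * (norm y)\<^sup>2" for x y :: "'a::real_normed_vector"
proof -
  have "(norm (x + y))\<^sup>2 \<le> (norm x + norm y)\<^sup>2" by (intro power_mono norm_triangle_ineq) auto
  also have "\<dots> \<le> 2 * (norm x)\<^sup>2 + 2 * (norm y)\<^sup>2"
    using sum_squares_bound[of "norm x" "norm y"] by (simp add: power2_sum)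
  finally show ?thesis .
qed

context filtered_prob begin

lemma martingale_inner:
  assumes "martingale P F X"
  shows "martingale P F (\<lambda>s \<omega>. X s \<omega> \<bullet> b)"
  unfolding martingale_def adapted_def
proof (intro conjI allI impI ballI)
  fix s :: real assume s: "0 \<le> s"
  then show "(\<lambda>\<omega>. X s \<omega> \<bullet> b) \<in> borel_measurable (F s)"
    using assms by (auto simp: martingale_def adapted_def)
  show "integrable P (\<lambda>\<omega>. X s \<omega> \<bullet> b)"
    using assms s by (auto simp: martingale_def)
next
  fix s t :: real and E assume st: "0 \<le> s \<and> s \<le> t" and E: "E \<in> sets (F s)"
  have E': "E \<in> sets P" using E sets_F by auto
  have *: "set_lebesgue_integral P E (\<lambda>\<omega>. X r \<omega> \<bullet> b) = set_lebesgue_integral P E (X r) \<bullet> b" if "0 \<le> r" for r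
  proof -
    have "integrable P (\<lambda>\<omega>. indicator E \<omega> *\<^sub>R X r \<omega>)"
      using assms that by (intro integrable_mult_indicator E') (auto simp: martingale_def)
    from integral_inner_left[OF this, of b] show ?thesis
      unfolding set_lebesgue_integral_def by simp
  qed
  show "set_lebesgue_integral P E (\<lambda>\<omega>. X t \<omega> \<bullet> b) = set_lebesgue_integral P E (\<lambda>\<omega>. X s \<omega> \<bullet> b)"
    using assms st E by (simp add: * martingale_def)
qed

end

lemma (in prob_space) AE_eq_0_of_prob:
  fixes f :: "'a \<Rightarrow> 'b::euclidean_space"
  assumes [measurable]: "f \<in> borel_measurable M" and "\<And>\<epsilon>. \<epsilon> > 0 \<Longrightarrow> prob {\<omega>\<in>space M. norm (f \<omega>) > \<epsilon>} = 0"
  shows "AE \<omega> in M. f \<omega> = 0"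
proof -
  have "AE \<omega> in M. \<forall>n. \<not> norm (f \<omega>) > 1 / real (Suc n)"
    unfolding AE_all_countable
  proof
    fix n
    have "prob {\<omega>\<in>space M. norm (f \<omega>) > 1 / real (Suc n)} = 0" by (rule assms(2)) simp
    then show "AE \<omega> in M. \<not> norm (f \<omega>) > 1 / real (Suc n)"
      by (subst (asm) prob_eq_0) auto
  qed
  then show ?thesis
  proof eventually_elim
    case (elim \<omega>)
    show ?case
    proof (rule ccontr)
      assume "f \<omega> \<noteq> 0"
      then have "norm (f \<omega>) > 0" by simp
      then obtain n where "1 / real (Suc n) < norm (f \<omega>)" using nat_approx_posE by (metis of_nat_Suc)
      then show False using elim by blast
    qed
  qed
qed

lemma stratonovich_integral_uniform:
  assumes I: "has_stratonovich_integral P Y W s I" and s: "s \<ge> 0"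
    and N: "filterlim N at_top sequentially" "\<And>n. N n > 0"
  shows "converges_in_prob P (\<lambda>n \<omega>. \<Sum>k<N n. (W (real (Suc k) * (s / real (N n))) \<omega> - W (real k * (s / real (N n))) \<omega>) *\<^sub>R
     ((1/2) *\<^sub>R (Y (real k * (s / real (N n))) \<omega> + Y (real (Suc k) * (s / real (N n))) \<omega>))) I"
proof (rule I[unfolded has_stratonovich_integral_def, rule_format, where \<tau>="\<lambda>n k. real k * (s / real (N n))"], intro conjI allI impI)
  fix n
  have "0 \<le> s / real (N n)" using s by simp
  then have "real k * (s / real (N n)) \<le> real (Suc k) * (s / real (N n))" for k
    by (intro mult_right_mono) auto
  then show "partition_upto s (\<lambda>k. real k * (s / real (N n))) (N n)"
    using N(2)[of n] by (simp add: partition_upto_def)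
next
  have eq: "real (Suc k) * x - real k * x = x" for k x by (simp add: algebra_simps)
  fix \<delta> :: real assume "\<delta> > 0"
  have "(\<lambda>n. s / real (N n)) \<longlonglongrightarrow> 0"
    using filterlim_compose[OF lim_const_over_n[of s] N(1)] .
  then have "\<forall>\<^sub>F n in sequentially. s / real (N n) < \<delta>"
    using \<open>\<delta> > 0\<close> by (rule order_tendstoD)
  then show "\<forall>\<^sub>F n in sequentially. \<forall>k<N n. real (Suc k) * (s / real (N n)) - real k * (s / real (N n)) < \<delta>"
    unfolding eq by eventually_elim simp
qed

context wiener_filtered begin

text \<open>On a path the finite variation part contributes at most the square of its variation. The
  local martingale part is stopped at \<open>T p\<close>, split into coordinates and truncated at
  \<open>c\<close>, which bounds its expected quadratic sums. Countably many pairs (p, c) are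
  prepared, and each path finds one for which stopping and truncation change nothing up to time
  \<open>t\<close>.\<close>

lemma semimartingale_quad_frequently:
  fixes Z :: "real \<Rightarrow> 'w \<Rightarrow> 'a::euclidean_space" and \<Lambda> :: "'a \<Rightarrow> complex" and n N :: "nat \<Rightarrow> nat"
  assumes Z: "continuous_semimartingale P F Z" and \<Lambda>: "bounded_linear \<Lambda>" and t: "t > 0"
    and grid: "\<And>i. d i \<ge> 0 \<and> e i \<ge> 0 \<and> real (n i) * d i = t \<and> real (N i) * e i = t"
  shows "AE \<omega> in P. \<exists>K. \<exists>\<^sub>F i in sequentially.
    quad_sum (\<lambda>s. W s \<omega>) (\<lambda>s. \<Lambda> (Z s \<omega>)) (d i) (n i) + quad_sum (\<lambda>s. W s \<omega>) (\<lambda>s. \<Lambda> (Z s \<omega>)) (e i) (N i) \<le> K"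
proof -
  obtain L V where L: "local_martingale P F L" "continuous_process P L"
    and V: "finite_variation_process P F V" and LV: "AE \<omega> in P. \<forall>s\<ge>0. Z s \<omega> = L s \<omega> + V s \<omega>"
    using Z unfolding continuous_semimartingale_def by blast
  obtain T :: "nat \<Rightarrow> 'w \<Rightarrow> real" where T: "AE \<omega> in P. filterlim (\<lambda>p. T p \<omega>) at_top sequentially"
    and mart: "\<And>p. martingale P F (\<lambda>s \<omega>. L (min s (T p \<omega>)) \<omega> - L 0 \<omega>)"
    using L(1) unfolding local_martingale_def by auto
  define M where "M p b s \<omega> = (L (min s (T p \<omega>)) \<omega> - L 0 \<omega>) \<bullet> b" for p b s \<omega>
  have M: "martingale P F (M p b)" for p b
    unfolding M_def by (rule martingale_inner[OF mart])
  define q where "q p c b d k \<omega> = (if \<bar>M p b (real k * d) \<omega>\<bar> \<le> c \<and> \<bar>M p b (real (Suc k) * d) \<omega>\<bar> \<le> c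
      then (M p b (real (Suc k) * d) \<omega> - M p b (real k * d) \<omega>)\<^sup>2 else 0)" for p c b d k \<omega>
  define Q where "Q p c d n \<omega> = (\<Sum>k<n. (W (real (Suc k) * d) \<omega> - W (real k * d) \<omega>)\<^sup>2) +
     (\<Sum>b\<in>Basis. \<Sum>k<n. q p c b d k \<omega>)" for p c d n \<omega>
  \<comment> \<open>\<open>t\<close> comes from the Wiener increments, the rest from the truncated
    quadratic variation of each coordinate; the bound is the same for every grid.\<close>
  define B where "B p c = t + (\<Sum>b\<in>Basis. 2 * c * expectation (\<lambda>\<omega>. \<bar>M p b t \<omega>\<bar>))" for p c
  have Q: "integrable P (Q p c d n)" "expectation (Q p c d n) \<le> B p c" "0 \<le> Q p c d n \<omega>"
    if d: "d \<ge> 0" "real n * d = t" and c: "c \<ge> 0" for p c d n \<omega>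
  proof -
    have W: "integrable P (\<lambda>\<omega>. (W (real (Suc k) * d) \<omega> - W (real k * d) \<omega>)\<^sup>2)"
      "expectation (\<lambda>\<omega>. (W (real (Suc k) * d) \<omega> - W (real k * d) \<omega>)\<^sup>2) = d" for k
    proof -
      have "0 \<le> real k * d" "real k * d \<le> real (Suc k) * d" using d by (auto intro: mult_right_mono)
      from W_increment_moments(3,4)[OF this]
      show "integrable P (\<lambda>\<omega>. (W (real (Suc k) * d) \<omega> - W (real k * d) \<omega>)\<^sup>2)"
        "expectation (\<lambda>\<omega>. (W (real (Suc k) * d) \<omega> - W (real k * d) \<omega>)\<^sup>2) = d"
        by (simp_all add: algebra_simps)
    qed
    have tqv: "integrable P (\<lambda>\<omega>. \<Sum>k<n. q p c b d k \<omega>)"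
      "expectation (\<lambda>\<omega>. \<Sum>k<n. q p c b d k \<omega>) \<le> 2 * c * expectation (\<lambda>\<omega>. \<bar>M p b t \<omega>\<bar>)" for b
    proof -
      have "real k * d \<le> real (Suc k) * d" for k using d by (auto intro: mult_right_mono)
      note qv = martingale_truncated_quadratic_variation[OF M c, of n "\<lambda>k. real k * d" p b, OF this]
      show "integrable P (\<lambda>\<omega>. \<Sum>k<n. q p c b d k \<omega>)" using qv(1) unfolding q_def by simp
      show "expectation (\<lambda>\<omega>. \<Sum>k<n. q p c b d k \<omega>) \<le> 2 * c * expectation (\<lambda>\<omega>. \<bar>M p b t \<omega>\<bar>)"
        using qv(2) d unfolding q_def by simp
    qed
    have iW: "integrable P (\<lambda>\<omega>. \<Sum>k<n. (W (real (Suc k) * d) \<omega> - W (real k * d) \<omega>)\<^sup>2)"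
      by (intro Bochner_Integration.integrable_sum W)
    have iq: "integrable P (\<lambda>\<omega>. \<Sum>b\<in>Basis. \<Sum>k<n. q p c b d k \<omega>)"
      by (rule Bochner_Integration.integrable_sum) (rule tqv)
    show "integrable P (Q p c d n)" unfolding Q_def by (intro Bochner_Integration.integrable_add iW iq)
    have "expectation (Q p c d n) = expectation (\<lambda>\<omega>. \<Sum>k<n. (W (real (Suc k) * d) \<omega> - W (real k * d) \<omega>)\<^sup>2) +
        expectation (\<lambda>\<omega>. \<Sum>b\<in>Basis. \<Sum>k<n. q p c b d k \<omega>)"
      unfolding Q_def by (rule Bochner_Integration.integral_add[OF iW iq])
    also have "expectation (\<lambda>\<omega>. \<Sum>k<n. (W (real (Suc k) * d) \<omega> - W (real k * d) \<omega>)\<^sup>2) = (\<Sum>k<n. d)"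
      by (subst Bochner_Integration.integral_sum) (auto simp: W simp del: of_nat_Suc)
    also have "expectation (\<lambda>\<omega>. \<Sum>b\<in>Basis. \<Sum>k<n. q p c b d k \<omega>) = (\<Sum>b\<in>Basis. expectation (\<lambda>\<omega>. \<Sum>k<n. q p c b d k \<omega>))"
      by (rule Bochner_Integration.integral_sum[OF tqv(1)])
    finally show "expectation (Q p c d n) \<le> B p c"
      unfolding B_def using d tqv(2) by (auto intro!: sum_mono)
    show "0 \<le> Q p c d n \<omega>" unfolding Q_def q_def by (intro add_nonneg_nonneg sum_nonneg) auto
  qed
  have freq: "AE \<omega> in P. \<forall>p c :: nat. \<exists>K. \<exists>\<^sub>F i in sequentially. Q p (real c) (d i) (n i) \<omega> + Q p (real c) (e i) (N i) \<omega> \<le> K"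
    unfolding AE_all_countable
  proof (intro allI)
    fix p c :: nat
    note g = grid[THEN conjunct1] grid[THEN conjunct2, THEN conjunct1]
      grid[THEN conjunct2, THEN conjunct2, THEN conjunct1] grid[THEN conjunct2, THEN conjunct2, THEN conjunct2]
    note Qd = Q[OF g(1) g(3) of_nat_0_le_iff] and Qe = Q[OF g(2) g(4) of_nat_0_le_iff]
    show "AE \<omega> in P. \<exists>K. \<exists>\<^sub>F i in sequentially. Q p (real c) (d i) (n i) \<omega> + Q p (real c) (e i) (N i) \<omega> \<le> K"
    proof (rule AE_frequently_bounded[where C="2 * B p (real c)"])
      show int: "integrable P (\<lambda>\<omega>. Q p (real c) (d i) (n i) \<omega> + Q p (real c) (e i) (N i) \<omega>)" for i
        using Qd(1) Qe(1) by (intro Bochner_Integration.integrable_add) auto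
      then show "(\<lambda>\<omega>. Q p (real c) (d i) (n i) \<omega> + Q p (real c) (e i) (N i) \<omega>) \<in> borel_measurable P" for i
        by auto
      show "0 \<le> Q p (real c) (d i) (n i) \<omega> + Q p (real c) (e i) (N i) \<omega>" for i \<omega>
        using Qd(3) Qe(3) by (intro add_nonneg_nonneg) auto
      have "expectation (\<lambda>\<omega>. Q p (real c) (d i) (n i) \<omega> + Q p (real c) (e i) (N i) \<omega>) =
        expectation (Q p (real c) (d i) (n i)) + expectation (Q p (real c) (e i) (N i))" for i
        using Qd(1) Qe(1) by (intro Bochner_Integration.integral_add) auto
      then show "expectation (\<lambda>\<omega>. Q p (real c) (d i) (n i) \<omega> + Q p (real c) (e i) (N i) \<omega>) \<le> 2 * B p (real c)" for i
        unfolding mult_2 by (simp only:) (intro add_mono Qd(2) Qe(2))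
    qed
  qed
  obtain \<beta> where \<beta>: "\<beta> > 0" "\<And>x. norm (\<Lambda> x) \<le> norm x * \<beta>"
    using bounded_linear.pos_bounded[OF \<Lambda>] by blast
  interpret \<Lambda>: bounded_linear \<Lambda> by fact
  have Lc: "AE \<omega> in P. continuous_on {0..} (\<lambda>s. L s \<omega>)" using L(2) by (simp add: continuous_process_def)
  have Vv: "AE \<omega> in P. \<forall>s\<ge>0. \<exists>C. \<forall>\<tau> N. partition_upto s \<tau> N \<longrightarrow> (\<Sum>k<N. norm (V (\<tau> (Suc k)) \<omega> - V (\<tau> k) \<omega>)) \<le> C"
    using V by (simp add: finite_variation_process_def)
  show ?thesis
    using LV T freq Lc Vv
  proof eventually_elim
    case (elim \<omega>)
    have "\<forall>\<^sub>F p in sequentially. T p \<omega> \<ge> t" using elim(2) by (simp add: filterlim_at_top)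
    then obtain p where p: "T p \<omega> \<ge> t" using eventually_happens by fastforce
    have "bounded ((\<lambda>s. L s \<omega>) ` {0..t})"
      by (intro compact_imp_bounded compact_continuous_image continuous_on_subset[OF elim(4)]) auto
    then obtain c0 where c0: "\<And>s. s \<in> {0..t} \<Longrightarrow> norm (L s \<omega>) \<le> c0"
      unfolding bounded_iff by blast
    \<comment> \<open>\<open>M\<close> measures \<open>L\<close> from its value at time 0, hence the
      factor 2.\<close>
    obtain c :: nat where c: "real c \<ge> 2 * c0" using real_arch_simple by blast
    obtain v where v: "\<And>\<tau> N. partition_upto t \<tau> N \<Longrightarrow> (\<Sum>k<N. norm (V (\<tau> (Suc k)) \<omega> - V (\<tau> k) \<omega>)) \<le> v"
      using elim(5) t by (meson less_imp_le)
    have M_eq: "M p b s \<omega> = (L s \<omega> - L 0 \<omega>) \<bullet> b" if "s \<in> {0..t}" for b s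
      using that p by (simp add: M_def min_def)
    have M_le: "\<bar>M p b s \<omega>\<bar> \<le> real c" if "s \<in> {0..t}" "b \<in> Basis" for b s
    proof -
      have "\<bar>M p b s \<omega>\<bar> \<le> norm (L s \<omega> - L 0 \<omega>)"
        unfolding M_eq[OF that(1)] by (rule Basis_le_norm[OF that(2)])
      also have "\<dots> \<le> c0 + c0"
        using that t by (intro order_trans[OF norm_triangle_ineq4] add_mono c0) auto
      finally show ?thesis using c by simp
    qed
    \<comment> \<open>The 1 covers the increments of \<open>W\<close>;
      \<open>2 * \<beta>\<^sup>2\<close> combines the operator bound of \<Lambda> with
      \<open>power2_norm_add_le\<close>.\<close>
    define G where "G = 1 + 2 * \<beta>\<^sup>2"
    have G: "G \<ge> 1" "2 * \<beta>\<^sup>2 \<le> G" by (auto simp: G_def)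
    have quad: "quad_sum (\<lambda>s. W s \<omega>) (\<lambda>s. \<Lambda> (Z s \<omega>)) d n \<le> G * Q p (real c) d n \<omega> + G * v\<^sup>2"
      if d: "d \<ge> 0" "real n * d = t" for d n
    proof -
      have in_t: "real k * d \<in> {0..t}" if "k \<le> n" for k
        using that d mult_right_mono[of "real k" "real n" d] by simp
      define dL where "dL k = L (real (Suc k) * d) \<omega> - L (real k * d) \<omega>" for k
      define dV where "dV k = V (real (Suc k) * d) \<omega> - V (real k * d) \<omega>" for k
      have "partition_upto t (\<lambda>k. real k * d) n"
        using d by (auto simp: partition_upto_def intro: mult_right_mono)
      from v[OF this] have sv: "(\<Sum>k<n. norm (dV k)) \<le> v" by (simp add: dV_def)
      have "(\<Sum>k<n. (norm (dV k))\<^sup>2) \<le> (\<Sum>k<n. norm (dV k))\<^sup>2"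
      proof -
        have "(\<Sum>k<n. (norm (dV k))\<^sup>2) \<le> (\<Sum>k<n. norm (dV k) * (\<Sum>k<n. norm (dV k)))"
          unfolding power2_eq_square by (intro sum_mono mult_left_mono member_le_sum) auto
        then show ?thesis by (simp add: power2_eq_square sum_distrib_right)
      qed
      also have "\<dots> \<le> v\<^sup>2" using sv by (intro power_mono sum_nonneg) auto
      finally have dV2: "(\<Sum>k<n. (norm (dV k))\<^sup>2) \<le> v\<^sup>2" .
      have dL2: "(norm (dL k))\<^sup>2 = (\<Sum>b\<in>Basis. q p (real c) b d k \<omega>)" if "k < n" for k
        unfolding power2_norm_Basis
      proof (intro sum.cong refl)
        fix b :: 'a assume b: "b \<in> Basis"
        have k: "real k * d \<in> {0..t}" "real (Suc k) * d \<in> {0..t}" by (rule in_t; use that in simp)+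
        show "(dL k \<bullet> b)\<^sup>2 = q p (real c) b d k \<omega>"
          using M_le[OF k(1) b] M_le[OF k(2) b]
          by (simp add: q_def M_eq[OF k(1)] M_eq[OF k(2)] dL_def inner_diff_left del: of_nat_Suc)
      qed
      have step: "(norm (\<Lambda> (Z (real (Suc k) * d) \<omega>) - \<Lambda> (Z (real k * d) \<omega>)))\<^sup>2 \<le>
          G * (\<Sum>b\<in>Basis. q p (real c) b d k \<omega>) + G * (norm (dV k))\<^sup>2" if "k < n" for k
      proof -
        have "0 \<le> real k * d" "0 \<le> real (Suc k) * d" using d by auto
        then have "Z (real (Suc k) * d) \<omega> - Z (real k * d) \<omega> = dL k + dV k"
          using elim(1) by (simp add: dL_def dV_def del: of_nat_Suc)
        then have "norm (\<Lambda> (Z (real (Suc k) * d) \<omega>) - \<Lambda> (Z (real k * d) \<omega>)) \<le> norm (dL k + dV k) * \<beta>"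
          using \<beta>(2)[of "dL k + dV k"] by (simp add: \<Lambda>.diff[symmetric] del: of_nat_Suc)
        then have "(norm (\<Lambda> (Z (real (Suc k) * d) \<omega>) - \<Lambda> (Z (real k * d) \<omega>)))\<^sup>2 \<le> (norm (dL k + dV k) * \<beta>)\<^sup>2"
          by (intro power_mono) auto
        also have "\<dots> = \<beta>\<^sup>2 * (norm (dL k + dV k))\<^sup>2" by (simp add: power_mult_distrib)
        also have "\<dots> \<le> \<beta>\<^sup>2 * (2 * (norm (dL k))\<^sup>2 + 2 * (norm (dV k))\<^sup>2)"
          by (intro mult_left_mono power2_norm_add_le) auto
        also have "\<dots> = (2 * \<beta>\<^sup>2) * (norm (dL k))\<^sup>2 + (2 * \<beta>\<^sup>2) * (norm (dV k))\<^sup>2" by (simp add: algebra_simps)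
        also have "\<dots> \<le> G * (norm (dL k))\<^sup>2 + G * (norm (dV k))\<^sup>2"
          using G by (intro add_mono mult_right_mono) auto
        finally show ?thesis unfolding dL2[OF that] .
      qed
      have "quad_sum (\<lambda>s. W s \<omega>) (\<lambda>s. \<Lambda> (Z s \<omega>)) d n \<le>
        (\<Sum>k<n. G * (W (real (Suc k) * d) \<omega> - W (real k * d) \<omega>)\<^sup>2 + (G * (\<Sum>b\<in>Basis. q p (real c) b d k \<omega>) + G * (norm (dV k))\<^sup>2))"
        unfolding quad_sum_def
      proof (intro sum_mono add_mono)
        fix k
        show "(W (real (Suc k) * d) \<omega> - W (real k * d) \<omega>)\<^sup>2 \<le> G * (W (real (Suc k) * d) \<omega> - W (real k * d) \<omega>)\<^sup>2"
          using mult_right_mono[OF G(1), of "(W (real (Suc k) * d) \<omega> - W (real k * d) \<omega>)\<^sup>2"] by simp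
      qed (use step in auto)
      also have "\<dots> = G * Q p (real c) d n \<omega> + G * (\<Sum>k<n. (norm (dV k))\<^sup>2)"
        unfolding Q_def sum.swap[of _ "{..<n}" Basis]
        by (simp add: sum.distrib sum_distrib_left distrib_left del: of_nat_Suc)
      also have "\<dots> \<le> G * Q p (real c) d n \<omega> + G * v\<^sup>2"
        using dV2 G by (intro add_left_mono mult_left_mono) auto
      finally show ?thesis .
    qed
    obtain K where "\<exists>\<^sub>F i in sequentially. Q p (real c) (d i) (n i) \<omega> + Q p (real c) (e i) (N i) \<omega> \<le> K"
      using elim(3) by blast
    then have "\<exists>\<^sub>F i in sequentially. quad_sum (\<lambda>s. W s \<omega>) (\<lambda>s. \<Lambda> (Z s \<omega>)) (d i) (n i) +
       quad_sum (\<lambda>s. W s \<omega>) (\<lambda>s. \<Lambda> (Z s \<omega>)) (e i) (N i) \<le> G * K + 2 * (G * v\<^sup>2)"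
    proof (rule frequently_elim1)
      fix i assume "Q p (real c) (d i) (n i) \<omega> + Q p (real c) (e i) (N i) \<omega> \<le> K"
      then have "G * (Q p (real c) (d i) (n i) \<omega> + Q p (real c) (e i) (N i) \<omega>) \<le> G * K"
        using G by (intro mult_left_mono) auto
      then show "quad_sum (\<lambda>s. W s \<omega>) (\<lambda>s. \<Lambda> (Z s \<omega>)) (d i) (n i) +
       quad_sum (\<lambda>s. W s \<omega>) (\<lambda>s. \<Lambda> (Z s \<omega>)) (e i) (N i) \<le> G * K + 2 * (G * v\<^sup>2)"
        using quad[of "d i" "n i"] quad[of "e i" "N i"] grid[of i] by (simp add: distrib_left)
    qed
    then show ?case by blast
  qed
qed


text \<open>If \<Lambda> kills every trapezoidal sum, it kills their limit in probability. At time 0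
  this identifies the initial value; for positive times it serves the functional with eigenvalue
  0.\<close>

lemma stratonovich_integral_annihilated:
  fixes Y :: "real \<Rightarrow> 'w \<Rightarrow> 'a::euclidean_space" and \<Lambda> :: "'a \<Rightarrow> 'b::euclidean_space"
  assumes I: "has_stratonovich_integral P Y W s I" and s: "s \<ge> 0" and \<Lambda>: "bounded_linear \<Lambda>"
    and zero: "s = 0 \<or> (\<forall>r \<omega>. \<Lambda> (Y r \<omega>) = 0)"
  shows "AE \<omega> in P. \<Lambda> (I \<omega>) = 0"
proof -
  interpret \<Lambda>: bounded_linear \<Lambda> by fact
  define X where "X n \<omega> = (\<Sum>k<Suc n. (W (real (Suc k) * (s / real (Suc n))) \<omega> - W (real k * (s / real (Suc n))) \<omega>) *\<^sub>R
     ((1/2) *\<^sub>R (Y (real k * (s / real (Suc n))) \<omega> + Y (real (Suc k) * (s / real (Suc n))) \<omega>)))" for n \<omega>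
  have conv: "converges_in_prob P X I"
    unfolding X_def by (rule stratonovich_integral_uniform[OF I s filterlim_Suc]) simp
  have X0: "\<Lambda> (X n \<omega>) = 0" for n \<omega>
    using zero by (auto simp: X_def \<Lambda>.sum \<Lambda>.scaleR \<Lambda>.add simp del: of_nat_Suc)
  obtain \<beta> where \<beta>: "\<beta> > 0" "\<And>x. norm (\<Lambda> x) \<le> norm x * \<beta>"
    using \<Lambda>.pos_bounded by blast
  have [measurable]: "I \<in> borel_measurable P" "X n \<in> borel_measurable P" for n
    using conv by (auto simp: converges_in_prob_def)
  show ?thesis
  proof (rule AE_eq_0_of_prob)
    show meas: "(\<lambda>\<omega>. \<Lambda> (I \<omega>)) \<in> borel_measurable P"
      using borel_measurable_continuous_onI[OF \<Lambda>.continuous_on[OF continuous_on_id]] by measurable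
    note [measurable] = meas
    fix \<epsilon> :: real assume \<epsilon>: "\<epsilon> > 0"
    have "prob {\<omega>\<in>space P. norm (\<Lambda> (I \<omega>)) > \<epsilon>} \<le> prob {\<omega>\<in>space P. norm (X n \<omega> - I \<omega>) > \<epsilon> / \<beta>}" for n
    proof (rule finite_measure_mono)
      show "{\<omega>\<in>space P. norm (\<Lambda> (I \<omega>)) > \<epsilon>} \<subseteq> {\<omega>\<in>space P. norm (X n \<omega> - I \<omega>) > \<epsilon> / \<beta>}"
      proof safe
        fix \<omega> assume "norm (\<Lambda> (I \<omega>)) > \<epsilon>"
        also have "norm (\<Lambda> (I \<omega>)) = norm (\<Lambda> (X n \<omega> - I \<omega>))" by (simp add: \<Lambda>.diff X0)
        also have "\<dots> \<le> norm (X n \<omega> - I \<omega>) * \<beta>" by (rule \<beta>)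
        finally show "norm (X n \<omega> - I \<omega>) > \<epsilon> / \<beta>" using \<beta>(1) by (simp add: field_simps)
      qed
    qed measurable
    moreover have "(\<lambda>n. prob {\<omega>\<in>space P. norm (X n \<omega> - I \<omega>) > \<epsilon> / \<beta>}) \<longlonglongrightarrow> 0"
      using conv divide_pos_pos[OF \<epsilon> \<beta>(1)] unfolding converges_in_prob_def by blast
    ultimately have "prob {\<omega>\<in>space P. norm (\<Lambda> (I \<omega>)) > \<epsilon>} \<le> 0"
      by (intro tendsto_lowerbound) auto
    then show "prob {\<omega>\<in>space P. norm (\<Lambda> (I \<omega>)) > \<epsilon>} = 0"
      using measure_nonneg[of P "{\<omega>\<in>space P. norm (\<Lambda> (I \<omega>)) > \<epsilon>}"] by linarith
  qed
qed

text \<open>Applying \<Lambda> to the equation gives a scalar one whose integral is \<Lambda> of the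
  vector integral, divided by i \<kappa>. For \<kappa> = 0 this division is impossible, but then
  drift and integral both vanish under \<Lambda>, which is conserved.\<close>

theorem linear_functional_of_solution:
  fixes Z :: "real \<Rightarrow> 'w \<Rightarrow> 'a::euclidean_space" and \<Lambda> :: "'a \<Rightarrow> complex"
  assumes sol: "stratonovich_solution P F W act K A B z Z"
    and K: "bounded K" and A: "bounded_linear (act A)" and \<Lambda>: "bounded_linear \<Lambda>"
    and \<Lambda>B: "\<And>x. \<Lambda> (act B x) = \<i> * of_real \<kappa> * \<Lambda> x"
    and \<Lambda>A: "\<And>x. \<Lambda> (act A x) = \<i> * of_real (\<kappa> * a) * \<Lambda> x"
    and t: "t \<ge> 0"
  shows "AE \<omega> in P. \<Lambda> (Z t \<omega>) = cis (\<kappa> * (W t \<omega> + a * t)) * \<Lambda> z"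
proof -
  interpret \<Lambda>: bounded_linear \<Lambda> by fact
  interpret A: bounded_linear "act A" by fact
  have semi: "continuous_semimartingale P F Z" and ZK: "\<And>s \<omega>. 0 \<le> s \<Longrightarrow> \<omega> \<in> space P \<Longrightarrow> Z s \<omega> \<in> K"
    using sol by (auto simp: stratonovich_solution_def)
  have Zc: "AE \<omega> in P. continuous_on {0..} (\<lambda>s. Z s \<omega>)" and ZF: "\<And>s. 0 \<le> s \<Longrightarrow> Z s \<in> borel_measurable (F s)"
    using semi by (auto simp: continuous_semimartingale_def continuous_process_def adapted_def)
  have "\<forall>s. \<exists>I. 0 \<le> s \<longrightarrow> has_stratonovich_integral P (\<lambda>s \<omega>. act B (Z s \<omega>)) W s I \<and>
     (AE \<omega> in P. Z s \<omega> = z + integral {0..s} (\<lambda>s. act A (Z s \<omega>)) + I \<omega>)"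
    using sol by (auto simp: stratonovich_solution_def)
  from choice[OF this] obtain IZ where IZ: "\<And>s. 0 \<le> s \<Longrightarrow> has_stratonovich_integral P (\<lambda>s \<omega>. act B (Z s \<omega>)) W s (IZ s)"
     "\<And>s. 0 \<le> s \<Longrightarrow> AE \<omega> in P. Z s \<omega> = z + integral {0..s} (\<lambda>s. act A (Z s \<omega>)) + IZ s \<omega>"
    by blast
  have Z0: "AE \<omega> in P. Z 0 \<omega> = z"
    using IZ(2)[OF order_refl] stratonovich_integral_annihilated[OF IZ(1)[OF order_refl] order_refl bounded_linear_ident]
    by auto
  have \<Lambda>eq: "AE \<omega> in P. \<Lambda> (Z s \<omega>) = \<Lambda> z + \<i> * of_real (\<kappa> * a) * integral {0..s} (\<lambda>s. \<Lambda> (Z s \<omega>)) + \<Lambda> (IZ s \<omega>)"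
    if "0 \<le> s" for s
    using IZ(2)[OF that] Zc
  proof eventually_elim
    case (elim \<omega>)
    have c: "continuous_on {0..s} (\<lambda>s. Z s \<omega>)" by (rule continuous_on_subset[OF elim(2)]) auto
    have "(\<lambda>s. act A (Z s \<omega>)) integrable_on {0..s}"
      by (intro integrable_continuous_interval A.continuous_on c)
    then have "\<Lambda> (integral {0..s} (\<lambda>s. act A (Z s \<omega>))) = integral {0..s} (\<lambda>s. \<Lambda> (act A (Z s \<omega>)))"
      using integral_linear[OF _ \<Lambda>, of "\<lambda>s. act A (Z s \<omega>)" "{0..s}"] by (simp add: comp_def)
    then show ?case by (subst elim(1)) (simp add: \<Lambda>.add \<Lambda>A)
  qed
  consider "t = 0" | "\<kappa> = 0" | "t > 0" "\<kappa> \<noteq> 0" using t by linarith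
  then show ?thesis
  proof cases
    case 1
    have "AE \<omega> in P. W 0 \<omega> = 0" using wiener by (simp add: wiener_process_def)
    with Z0 show ?thesis unfolding 1 by eventually_elim simp
  next
    case 2
    have "AE \<omega> in P. \<Lambda> (IZ t \<omega>) = 0"
      by (rule stratonovich_integral_annihilated[OF IZ(1)[OF t] t \<Lambda>]) (simp add: \<Lambda>B 2)
    with \<Lambda>eq[OF t] show ?thesis by eventually_elim (simp add: 2)
  next
    case 3
    obtain C where C: "\<And>x. x \<in> K \<Longrightarrow> norm x \<le> C" using K unfolding bounded_iff by blast
    obtain \<beta> where \<beta>: "\<beta> > 0" "\<And>x. norm (\<Lambda> x) \<le> norm x * \<beta>"
      using \<Lambda>.pos_bounded by blast
    \<comment> \<open>Integrals are determined only almost surely; prescribing the value at time 0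
      yields \<open>I_0\<close> for every \<omega>.\<close>
    define I where "I s \<omega> = (if s = 0 then 0 else \<Lambda> (IZ s \<omega>) / (\<i> * of_real \<kappa>))" for s \<omega>
    have \<Lambda>_borel [measurable]: "\<Lambda> \<in> borel_measurable borel"
      by (rule borel_measurable_continuous_onI[OF \<Lambda>.continuous_on[OF continuous_on_id]])
    interpret stratonovich_functional P F W "\<lambda>s \<omega>. \<Lambda> (Z s \<omega>)" I "C * \<beta>" a \<kappa>
    proof
      fix s :: real assume s: "0 \<le> s"
      have [measurable]: "Z s \<in> borel_measurable (F s)" by (rule ZF[OF s])
      show "(\<lambda>\<omega>. \<Lambda> (Z s \<omega>)) \<in> borel_measurable (F s)" by measurable
      show "norm (\<Lambda> (Z s \<omega>)) \<le> C * \<beta>" if "\<omega> \<in> space P" for \<omega>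
        by (rule order_trans[OF \<beta>(2)]) (intro mult_right_mono C ZK s that, use \<beta> in simp)
      have "IZ s \<in> borel_measurable P"
        using stratonovich_integral_uniform[OF IZ(1)[OF s] s filterlim_Suc] by (simp add: converges_in_prob_def)
      then show "I s \<in> borel_measurable P" unfolding I_def by measurable
      show "AE \<omega> in P. \<Lambda> (Z s \<omega>) = \<Lambda> (Z 0 \<omega>) + \<i> * of_real (\<kappa> * a) * integral {0..s} (\<lambda>s. \<Lambda> (Z s \<omega>)) + \<i> * of_real \<kappa> * I s \<omega>"
        using \<Lambda>eq[OF s] Z0 by eventually_elim (use 3 in \<open>auto simp: I_def\<close>)
    next
      show "AE \<omega> in P. continuous_on {0..} (\<lambda>s. \<Lambda> (Z s \<omega>))"
        using Zc by eventually_elim (rule \<Lambda>.continuous_on)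
      show "I 0 \<omega> = 0" for \<omega> by (simp add: I_def)
    next
      fix t :: real and d e :: "nat \<Rightarrow> real" and n N :: "nat \<Rightarrow> nat"
      assume "t > 0" "\<And>i. d i \<ge> 0 \<and> e i \<ge> 0 \<and> real (n i) * d i = t \<and> real (N i) * e i = t"
      then show "AE \<omega> in P. \<exists>K. \<exists>\<^sub>F i in sequentially.
        quad_sum (\<lambda>s. W s \<omega>) (\<lambda>s. \<Lambda> (Z s \<omega>)) (d i) (n i) + quad_sum (\<lambda>s. W s \<omega>) (\<lambda>s. \<Lambda> (Z s \<omega>)) (e i) (N i) \<le> K"
        by (rule semimartingale_quad_frequently[OF semi \<Lambda>])
    next
      fix s \<epsilon> :: real and N :: "nat \<Rightarrow> nat"
      assume s: "0 < s" and \<epsilon>: "\<epsilon> > 0" and N: "filterlim N at_top sequentially" "\<And>n. N n > 0"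
      define X where "X n \<omega> = (\<Sum>k<N n. (W (real (Suc k) * (s / real (N n))) \<omega> - W (real k * (s / real (N n))) \<omega>) *\<^sub>R
         ((1/2) *\<^sub>R (act B (Z (real k * (s / real (N n))) \<omega>) + act B (Z (real (Suc k) * (s / real (N n))) \<omega>))))" for n \<omega>
      have conv: "converges_in_prob P X (IZ s)"
        unfolding X_def by (rule stratonovich_integral_uniform[OF IZ(1)[OF less_imp_le[OF s]] less_imp_le[OF s] N])
      have [measurable]: "IZ s \<in> borel_measurable P" "X n \<in> borel_measurable P" for n
        using conv by (auto simp: converges_in_prob_def)
      have \<Lambda>X: "\<Lambda> (X n \<omega>) = \<i> * of_real \<kappa> * trapezoid (\<lambda>s. W s \<omega>) (\<lambda>s. \<Lambda> (Z s \<omega>)) (s / real (N n)) (N n)" for n \<omega>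
        unfolding X_def trapezoid_def \<Lambda>.sum \<Lambda>.scaleR \<Lambda>.add \<Lambda>B sum_distrib_left
        by (intro sum.cong refl) (simp add: scaleR_conv_of_real algebra_simps)
      define \<epsilon>' where "\<epsilon>' = \<epsilon> * \<bar>\<kappa>\<bar> / \<beta>"
      have \<epsilon>': "\<epsilon>' > 0" using \<epsilon> \<beta>(1) 3 by (simp add: \<epsilon>'_def)
      have "prob {\<omega>\<in>space P. norm (trapezoid (\<lambda>s. W s \<omega>) (\<lambda>s. \<Lambda> (Z s \<omega>)) (s / real (N n)) (N n) - I s \<omega>) > \<epsilon>}
        \<le> prob {\<omega>\<in>space P. norm (X n \<omega> - IZ s \<omega>) > \<epsilon>'}" for n
      proof (rule finite_measure_mono)
        show "{\<omega>\<in>space P. norm (trapezoid (\<lambda>s. W s \<omega>) (\<lambda>s. \<Lambda> (Z s \<omega>)) (s / real (N n)) (N n) - I s \<omega>) > \<epsilon>}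
          \<subseteq> {\<omega>\<in>space P. norm (X n \<omega> - IZ s \<omega>) > \<epsilon>'}"
        proof safe
          fix \<omega> assume "norm (trapezoid (\<lambda>s. W s \<omega>) (\<lambda>s. \<Lambda> (Z s \<omega>)) (s / real (N n)) (N n) - I s \<omega>) > \<epsilon>"
          then have "\<epsilon> * \<bar>\<kappa>\<bar> < norm (trapezoid (\<lambda>s. W s \<omega>) (\<lambda>s. \<Lambda> (Z s \<omega>)) (s / real (N n)) (N n) - I s \<omega>) * \<bar>\<kappa>\<bar>"
            using 3 by (intro mult_strict_right_mono) auto
          also have "\<dots> = norm (\<i> * of_real \<kappa> * (trapezoid (\<lambda>s. W s \<omega>) (\<lambda>s. \<Lambda> (Z s \<omega>)) (s / real (N n)) (N n) - I s \<omega>))"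
            by (simp add: norm_mult)
          also have "\<i> * of_real \<kappa> * (trapezoid (\<lambda>s. W s \<omega>) (\<lambda>s. \<Lambda> (Z s \<omega>)) (s / real (N n)) (N n) - I s \<omega>) = \<Lambda> (X n \<omega> - IZ s \<omega>)"
            using s 3 by (simp add: \<Lambda>.diff \<Lambda>X I_def right_diff_distrib)
          also have "norm \<dots> \<le> norm (X n \<omega> - IZ s \<omega>) * \<beta>" by (rule \<beta>)
          finally show "norm (X n \<omega> - IZ s \<omega>) > \<epsilon>'" using \<beta>(1) by (simp add: \<epsilon>'_def field_simps)
        qed
      qed measurable
      moreover have "(\<lambda>n. prob {\<omega>\<in>space P. norm (X n \<omega> - IZ s \<omega>) > \<epsilon>'}) \<longlonglongrightarrow> 0"
        using conv \<epsilon>' unfolding converges_in_prob_def by blast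
      ultimately have le: "\<And>n. prob {\<omega>\<in>space P. norm (trapezoid (\<lambda>s. W s \<omega>) (\<lambda>s. \<Lambda> (Z s \<omega>)) (s / real (N n)) (N n) - I s \<omega>) > \<epsilon>}
          \<le> prob {\<omega>\<in>space P. norm (X n \<omega> - IZ s \<omega>) > \<epsilon>'}"
        and lim: "(\<lambda>n. prob {\<omega>\<in>space P. norm (X n \<omega> - IZ s \<omega>) > \<epsilon>'}) \<longlonglongrightarrow> 0" by blast+
      show "(\<lambda>n. prob {\<omega>\<in>space P. norm (trapezoid (\<lambda>s. W s \<omega>) (\<lambda>s. \<Lambda> (Z s \<omega>)) (s / real (N n)) (N n) - I s \<omega>) > \<epsilon>}) \<longlonglongrightarrow> 0"
      proof (rule tendsto_sandwich[OF _ _ tendsto_const lim])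
        show "\<forall>\<^sub>F n in sequentially. 0 \<le> prob {\<omega>\<in>space P. norm (trapezoid (\<lambda>s. W s \<omega>) (\<lambda>s. \<Lambda> (Z s \<omega>)) (s / real (N n)) (N n) - I s \<omega>) > \<epsilon>}"
          by simp
      qed (intro always_eventually allI le)
    qed
    from explicit_solution[OF 3(1)] Z0 show ?thesis by (rule eventually_elim2) (simp only:)
  qed
qed

end

section \<open>Haar measure and isometric circle actions\<close>

text \<open>Isometry keeps the distance to an orbit constant along the action; compactness provides
  a support point for every law. Continuity on the whole space makes \<open>S\<close> Borel
  measurable in both arguments, without restriction to the circle and to \<open>K\<close>.\<close>

locale circle_action =
  fixes S :: "complex \<Rightarrow> 'a::euclidean_space \<Rightarrow> 'a" and K :: "'a set"
  assumes K_compact: "compact K"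
    and S_continuous: "continuous_on UNIV (\<lambda>x. S (fst x) (snd x))"
    and S_in: "p \<in> circle \<Longrightarrow> z \<in> K \<Longrightarrow> S p z \<in> K"
    and S_one: "z \<in> K \<Longrightarrow> S 1 z = z"
    and S_mult: "p \<in> circle \<Longrightarrow> q \<in> circle \<Longrightarrow> z \<in> K \<Longrightarrow> S (p * q) z = S p (S q z)"
    and S_dist: "p \<in> circle \<Longrightarrow> x \<in> K \<Longrightarrow> y \<in> K \<Longrightarrow> dist (S p x) (S p y) = dist x y"
begin

lemma S_measurable [measurable (raw)]:
  assumes [measurable]: "f \<in> borel_measurable M" "g \<in> borel_measurable M"
  shows "(\<lambda>x. S (f x) (g x)) \<in> borel_measurable M"
proof -
  have "(\<lambda>x. S (fst x) (snd x)) \<in> borel_measurable (borel \<Otimes>\<^sub>M borel)"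
    unfolding borel_prod by (rule borel_measurable_continuous_onI[OF S_continuous])
  then have "(\<lambda>x. (\<lambda>x. S (fst x) (snd x)) (f x, g x)) \<in> borel_measurable M"
    by measurable
  then show ?thesis by simp
qed

lemma K_borel [measurable, simp]: "K \<in> sets borel"
  using K_compact by (simp add: compact_imp_closed)

lemma sets_K_iff: "sets \<nu> = sets (restrict_space borel K) \<Longrightarrow> J \<in> sets \<nu> \<longleftrightarrow> J \<in> sets borel \<and> J \<subseteq> K"
  by (auto simp: sets_restrict_space_iff)

lemma space_K: "sets \<nu> = sets (restrict_space borel K) \<Longrightarrow> space \<nu> = K"
  by (metis K_borel sets_eq_imp_space_eq space_restrict_space2)

lemma id_measurable: "sets \<nu> = sets (restrict_space borel K) \<Longrightarrow> (\<lambda>z. z) \<in> borel_measurable \<nu>"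
  by (simp add: measurable_cong_sets[of \<nu> "restrict_space borel K"] measurable_restrict_space1)

definition orbit :: "'a \<Rightarrow> 'a set" where
  "orbit u = (\<lambda>p. S p u) ` circle"

definition act_invariant :: "'a measure \<Rightarrow> bool" where
  "act_invariant \<nu> \<longleftrightarrow> borel_prob_on K \<nu> \<and>
     (\<forall>p\<in>circle. \<forall>J\<in>sets \<nu>. emeasure \<nu> {z\<in>K. S p z \<in> J} = emeasure \<nu> J)"

lemma act_preimage_sets:
  assumes "sets \<nu> = sets (restrict_space borel K)" "J \<in> sets \<nu>"
  shows "{z\<in>K. S p z \<in> J} \<in> sets \<nu>"
proof -
  have [measurable]: "J \<in> sets borel" using assms sets_K_iff by auto
  have "{z\<in>space borel. z \<in> K \<and> S p z \<in> J} \<in> sets borel" by measurable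
  then show ?thesis using sets_K_iff[OF assms(1)] by auto
qed

text \<open>Fubini: the invariance identity is averaged over \<open>p\<close> with law \<mu> and the
  integrals are exchanged. For \<mu> the Haar measure, the integrand is the mass of \<open>J\<close>
  under the orbit measure through \<open>z\<close>. Both uniqueness results below rest on
  this.\<close>

lemma invariant_average:
  fixes \<mu> :: "complex measure"
  assumes \<nu>: "act_invariant \<nu>" and \<mu>: "borel_prob_on circle \<mu>" and J: "J \<in> sets \<nu>"
  shows "emeasure \<nu> J = (\<integral>\<^sup>+z. emeasure \<mu> {p\<in>circle. S p z \<in> J} \<partial>\<nu>)"
proof -
  have s\<nu>: "sets \<nu> = sets (restrict_space borel K)" and s\<mu>: "sets \<mu> = sets (restrict_space borel circle)"
    using \<nu> \<mu> by (auto simp: act_invariant_def borel_prob_on_def)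
  interpret \<nu>: prob_space \<nu> using \<nu> by (auto simp: act_invariant_def borel_prob_on_def)
  interpret \<mu>: prob_space \<mu> using \<mu> by (auto simp: borel_prob_on_def)
  interpret pair_sigma_finite \<mu> \<nu> ..
  have sp: "space \<mu> = circle" "space \<nu> = K"
    using sets_eq_imp_space_eq[OF s\<mu>] space_K[OF s\<nu>] by auto
  have [measurable]: "(\<lambda>z. z) \<in> borel_measurable \<nu>" "(\<lambda>z. z) \<in> borel_measurable \<mu>"
    using id_measurable[OF s\<nu>] measurable_restrict_space1[of "\<lambda>z. z" borel borel circle]
    by (auto simp: measurable_cong_sets[OF s\<mu> refl])
  have Jb [measurable]: "J \<in> sets borel" using J sets_K_iff[OF s\<nu>] by auto
  have fst_b: "fst \<in> borel_measurable (\<mu> \<Otimes>\<^sub>M \<nu>)" and snd_b: "snd \<in> borel_measurable (\<mu> \<Otimes>\<^sub>M \<nu>)"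
    by (auto intro: measurable_compose[OF measurable_fst] measurable_compose[OF measurable_snd])
  have "(\<lambda>x. indicator J (S (fst x) (snd x)) :: ennreal) \<in> borel_measurable (\<mu> \<Otimes>\<^sub>M \<nu>)"
    using fst_b snd_b by measurable
  then have f: "(\<lambda>(p, z). indicator J (S p z) :: ennreal) \<in> borel_measurable (\<mu> \<Otimes>\<^sub>M \<nu>)"
    by (simp add: case_prod_beta')
  have inner1: "(\<integral>\<^sup>+z. indicator J (S p z) \<partial>\<nu>) = emeasure \<nu> {z\<in>K. S p z \<in> J}" for p
  proof -
    have "(\<integral>\<^sup>+z. indicator J (S p z) \<partial>\<nu>) = (\<integral>\<^sup>+z. indicator {z\<in>K. S p z \<in> J} z \<partial>\<nu>)"
      by (rule nn_integral_cong) (auto simp: sp split: split_indicator)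
    then show ?thesis using act_preimage_sets[OF s\<nu> J] by simp
  qed
  have inner2: "(\<integral>\<^sup>+p. indicator J (S p z) \<partial>\<mu>) = emeasure \<mu> {p\<in>circle. S p z \<in> J}" for z
  proof -
    have "{p\<in>space \<mu>. S p z \<in> J} \<in> sets \<mu>" by measurable
    then have "{p\<in>circle. S p z \<in> J} \<in> sets \<mu>" by (simp add: sp)
    moreover have "(\<integral>\<^sup>+p. indicator J (S p z) \<partial>\<mu>) = (\<integral>\<^sup>+p. indicator {p\<in>circle. S p z \<in> J} p \<partial>\<mu>)"
      by (rule nn_integral_cong) (auto simp: sp split: split_indicator)
    ultimately show ?thesis by simp
  qed
  have "emeasure \<nu> J = (\<integral>\<^sup>+p. emeasure \<nu> J \<partial>\<mu>)" by (simp add: \<mu>.emeasure_space_1)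
  also have "\<dots> = (\<integral>\<^sup>+p. emeasure \<nu> {z\<in>K. S p z \<in> J} \<partial>\<mu>)"
    using \<nu> J by (intro nn_integral_cong) (simp add: sp act_invariant_def)
  also have "\<dots> = (\<integral>\<^sup>+p. (\<integral>\<^sup>+z. indicator J (S p z) \<partial>\<nu>) \<partial>\<mu>)" unfolding inner1 ..
  also have "\<dots> = (\<integral>\<^sup>+z. (\<integral>\<^sup>+p. indicator J (S p z) \<partial>\<mu>) \<partial>\<nu>)"
    using Fubini'[OF f] by simp
  finally show ?thesis unfolding inner2 .
qed

end

section \<open>Haar measure of the circle\<close>

interpretation circle_self: circle_action "(*)" circle
  by unfold_locales (auto simp: norm_mult dist_norm right_diff_distrib[symmetric] intro!: continuous_intros)

text \<open>Seen as an invariant probability of the circle acting on itself, Haar measure falls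
  under \<open>invariant_average\<close>.\<close>

lemma is_haar_circle_iff: "is_haar_circle \<mu> \<longleftrightarrow> circle_self.act_invariant \<mu>"
proof (cases "borel_prob_on circle \<mu>")
  case True
  then have s: "sets \<mu> = sets (restrict_space borel circle)" by (simp add: borel_prob_on_def)
  have sp: "space \<mu> = circle" using circle_self.space_K[OF s] .
  have "distr \<mu> \<mu> ((*) p) = \<mu> \<longleftrightarrow> (\<forall>J\<in>sets \<mu>. emeasure \<mu> {z\<in>circle. p * z \<in> J} = emeasure \<mu> J)"
    if p: "p \<in> circle" for p
  proof -
    have "(*) p \<in> measurable \<mu> (restrict_space borel circle)"
    proof (rule measurable_restrict_space2)
      show "(*) p \<in> space \<mu> \<rightarrow> circle" using p by (auto simp: sp norm_mult)
      show "(*) p \<in> borel_measurable \<mu>"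
        using circle_self.id_measurable[OF s] by measurable
    qed
    then have m: "(*) p \<in> measurable \<mu> \<mu>" using measurable_cong_sets[OF refl s, of \<mu>] by simp
    have e: "emeasure (distr \<mu> \<mu> ((*) p)) J = emeasure \<mu> {z\<in>circle. p * z \<in> J}" if "J \<in> sets \<mu>" for J
      using emeasure_distr[OF m that] by (simp add: sp vimage_def Int_def conj_commute)
    show ?thesis
    proof
      assume "distr \<mu> \<mu> ((*) p) = \<mu>"
      then show "\<forall>J\<in>sets \<mu>. emeasure \<mu> {z\<in>circle. p * z \<in> J} = emeasure \<mu> J" using e by metis
    next
      assume "\<forall>J\<in>sets \<mu>. emeasure \<mu> {z\<in>circle. p * z \<in> J} = emeasure \<mu> J"
      then show "distr \<mu> \<mu> ((*) p) = \<mu>" using e by (intro measure_eqI) auto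
    qed
  qed
  then show ?thesis using True by (simp add: is_haar_circle_def circle_self.act_invariant_def)
qed (auto simp: is_haar_circle_def circle_self.act_invariant_def)

text \<open>One measure is averaged over the other. Since multiplication commutes,
  \<open>{p\<in>circle. p * z \<in> J}\<close> is the preimage of \<open>J\<close> under a rotation
  also as a set of \<open>p\<close>, so its mass does not depend on \<open>z\<close>.\<close>

lemma haar_circle_unique:
  assumes "is_haar_circle \<mu>" "is_haar_circle \<nu>"
  shows "\<mu> = \<nu>"
proof (rule measure_eqI)
  have \<mu>: "circle_self.act_invariant \<mu>" "borel_prob_on circle \<mu>" and \<nu>: "circle_self.act_invariant \<nu>" "borel_prob_on circle \<nu>"
    using assms by (auto simp: is_haar_circle_iff circle_self.act_invariant_def)
  have s: "sets \<mu> = sets (restrict_space borel circle)" "sets \<nu> = sets (restrict_space borel circle)"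
    using \<mu>(2) \<nu>(2) by (auto simp: borel_prob_on_def)
  then show "sets \<mu> = sets \<nu>" by simp
  interpret \<mu>: prob_space \<mu> using \<mu>(2) by (simp add: borel_prob_on_def)
  fix J assume J: "J \<in> sets \<mu>"
  then have J': "J \<in> sets \<nu>" using s by simp
  have "emeasure \<mu> J = (\<integral>\<^sup>+z. emeasure \<nu> {p\<in>circle. p * z \<in> J} \<partial>\<mu>)"
    by (rule circle_self.invariant_average[OF \<mu>(1) \<nu>(2) J])
  also have "\<dots> = (\<integral>\<^sup>+z. emeasure \<nu> J \<partial>\<mu>)"
    using \<nu>(1) J' circle_self.space_K[OF s(1)]
    by (intro nn_integral_cong) (simp add: circle_self.act_invariant_def mult.commute)
  finally show "emeasure \<mu> J = emeasure \<nu> J" by (simp add: \<mu>.emeasure_space_1)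
qed

lemma emeasure_lborel_shift:
  assumes [measurable]: "E \<in> sets borel"
  shows "emeasure lborel {x::real. c + x \<in> E} = emeasure lborel E"
proof -
  have "emeasure lborel E = emeasure (distr lborel borel ((+) c)) E" by (simp add: lborel_distr_plus)
  also have "\<dots> = emeasure lborel {x. c + x \<in> E}"
    by (subst emeasure_distr) (auto simp: vimage_def)
  finally show ?thesis ..
qed

text \<open>The shifted window of length \<open>T\<close> is cut at \<open>T\<close>, and its second
  piece is moved back by one period.\<close>

lemma emeasure_periodic_shift:
  fixes E :: "real set"
  assumes [measurable]: "E \<in> sets borel" and per: "\<And>x. x + T \<in> E \<longleftrightarrow> x \<in> E" and \<alpha>: "0 \<le> \<alpha>" "\<alpha> < T"
  shows "emeasure lborel ({0..<T} \<inter> {x. \<alpha> + x \<in> E}) = emeasure lborel ({0..<T} \<inter> E)"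
proof -
  have "{0..<T} \<inter> {x. \<alpha> + x \<in> E} = {x. \<alpha> + x \<in> {\<alpha>..<\<alpha> + T} \<inter> E}" by auto
  then have "emeasure lborel ({0..<T} \<inter> {x. \<alpha> + x \<in> E}) = emeasure lborel ({\<alpha>..<\<alpha> + T} \<inter> E)"
    by (simp add: emeasure_lborel_shift del: Int_iff)
  also have "{\<alpha>..<\<alpha> + T} \<inter> E = ({\<alpha>..<T} \<inter> E) \<union> ({T..<\<alpha> + T} \<inter> E)" using \<alpha> by auto
  also have "emeasure lborel \<dots> = emeasure lborel ({\<alpha>..<T} \<inter> E) + emeasure lborel ({T..<\<alpha> + T} \<inter> E)"
    by (rule plus_emeasure[symmetric]) auto
  also have "emeasure lborel ({T..<\<alpha> + T} \<inter> E) = emeasure lborel {x. T + x \<in> {T..<\<alpha> + T} \<inter> E}"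
    by (rule emeasure_lborel_shift[symmetric]) auto
  also have "{x. T + x \<in> {T..<\<alpha> + T} \<inter> E} = {0..<\<alpha>} \<inter> E"
    using per by (auto simp: add.commute)
  also have "emeasure lborel ({\<alpha>..<T} \<inter> E) + emeasure lborel ({0..<\<alpha>} \<inter> E) = emeasure lborel (({\<alpha>..<T} \<inter> E) \<union> ({0..<\<alpha>} \<inter> E))"
    by (rule plus_emeasure) auto
  also have "({\<alpha>..<T} \<inter> E) \<union> ({0..<\<alpha>} \<inter> E) = {0..<T} \<inter> E" using \<alpha> by auto
  finally show ?thesis .
qed

lemma circle_eq_cis: "p \<in> circle \<Longrightarrow> \<exists>\<alpha>. 0 \<le> \<alpha> \<and> \<alpha> < 2 * pi \<and> p = cis \<alpha>"
  using Arg2pi[of p] by (auto simp: cis_conv_exp is_Arg_def intro!: exI[of _ "Arg2pi p"])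

text \<open>The image under \<open>cis\<close> of the uniform law on one period: rotations become
  shifts of the angle.\<close>

lemma haar_circle_exists: "\<exists>\<mu>. is_haar_circle \<mu>"
proof -
  define U where "U = uniform_measure lborel {0..<2 * pi :: real}"
  define \<mu> where "\<mu> = distr U (restrict_space borel circle) cis"
  have em: "emeasure lborel {0..<2 * pi :: real} = ennreal (2 * pi)" by simp
  interpret U: prob_space U
    unfolding U_def by (rule prob_space_uniform_measure) (simp_all add: ennreal_eq_0_iff not_le)
  have cis_m [measurable]: "cis \<in> borel_measurable borel"
    unfolding cis_conv_exp[abs_def] by measurable
  have m: "cis \<in> measurable U (restrict_space borel circle)"
    by (rule measurable_restrict_space2) (auto simp: U_def)
  interpret \<mu>: prob_space \<mu> unfolding \<mu>_def by (rule U.prob_space_distr[OF m])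
  have s: "sets \<mu> = sets (restrict_space borel circle)" by (simp add: \<mu>_def)
  have \<mu>J: "emeasure \<mu> J = emeasure lborel ({0..<2 * pi} \<inter> {x. cis x \<in> J}) / ennreal (2 * pi)" if J: "J \<in> sets \<mu>" for J
  proof -
    have [measurable]: "J \<in> sets borel" using J circle_self.sets_K_iff[OF s] by auto
    have "emeasure \<mu> J = emeasure U {x. cis x \<in> J}"
      unfolding \<mu>_def using J s emeasure_distr[OF m, of J] by (simp add: U_def vimage_def)
    also have "{x. cis x \<in> J} = {x\<in>space borel. cis x \<in> J}" by simp
    also have "emeasure U \<dots> = emeasure lborel ({0..<2 * pi} \<inter> {x. cis x \<in> J}) / ennreal (2 * pi)"
      unfolding U_def by (subst emeasure_uniform_measure) (simp_all, measurable)
    finally show ?thesis .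
  qed
  have "circle_self.act_invariant \<mu>"
    unfolding circle_self.act_invariant_def
  proof (intro conjI ballI)
    show "borel_prob_on circle \<mu>" using s \<mu>.prob_space_axioms by (simp add: borel_prob_on_def)
    fix p :: complex and J assume p: "p \<in> circle" and J: "J \<in> sets \<mu>"
    have Jb [measurable]: "J \<in> sets borel" and Jc: "J \<subseteq> circle" using J circle_self.sets_K_iff[OF s] by auto
    obtain \<alpha> where \<alpha>: "0 \<le> \<alpha>" "\<alpha> < 2 * pi" "p = cis \<alpha>" using circle_eq_cis[OF p] by blast
    have "emeasure \<mu> {z\<in>circle. p * z \<in> J} = emeasure lborel ({0..<2 * pi} \<inter> {x. cis x \<in> {z\<in>circle. p * z \<in> J}}) / ennreal (2 * pi)"
      by (rule \<mu>J[OF circle_self.act_preimage_sets[OF s J]])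
    also have "{x. cis x \<in> {z\<in>circle. p * z \<in> J}} = {x. \<alpha> + x \<in> {x. cis x \<in> J}}"
      by (auto simp: \<alpha>(3) cis_mult)
    also have "emeasure lborel ({0..<2 * pi} \<inter> {x. \<alpha> + x \<in> {x. cis x \<in> J}}) = emeasure lborel ({0..<2 * pi} \<inter> {x. cis x \<in> J})"
    proof (rule emeasure_periodic_shift[OF _ _ \<alpha>(1,2)])
      have "{x\<in>space borel. cis x \<in> J} \<in> sets borel" by measurable
      then show "{x. cis x \<in> J} \<in> sets borel" by simp
      show "x + 2 * pi \<in> {x. cis x \<in> J} \<longleftrightarrow> x \<in> {x. cis x \<in> J}" for x
        by (simp add: cis_mult[symmetric])
    qed
    finally show "emeasure \<mu> {z\<in>circle. p * z \<in> J} = emeasure \<mu> J" using \<mu>J[OF J] by simp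
  qed
  then show ?thesis using is_haar_circle_iff by blast
qed

lemma haar_circle: "is_haar_circle haar_circle"
  unfolding haar_circle_def using haar_circle_exists haar_circle_unique by (metis theI')

lemma haar_circle_invariant: "circle_self.act_invariant haar_circle"
  using haar_circle is_haar_circle_iff by blast

lemma haar_circle_prob: "borel_prob_on circle haar_circle"
  using haar_circle by (simp add: is_haar_circle_def)

section \<open>Orbit measures, extremality and the zero-one law\<close>

context circle_action begin

lemma act_invariantD:
  "act_invariant \<nu> \<Longrightarrow> p \<in> circle \<Longrightarrow> J \<in> sets \<nu> \<Longrightarrow> emeasure \<nu> {z\<in>K. S p z \<in> J} = emeasure \<nu> J"
  by (auto simp only: act_invariant_def)

lemma orbit_subset: "u \<in> K \<Longrightarrow> orbit u \<subseteq> K"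
  by (auto simp: orbit_def S_in)

lemma orbit_self: "u \<in> K \<Longrightarrow> u \<in> orbit u"
  by (auto simp: orbit_def S_one intro!: image_eqI[of _ _ 1])

lemma continuous_S_left: "continuous_on A (\<lambda>p. S p u)"
  using continuous_on_compose2[OF S_continuous, of A "\<lambda>p. (p, u)"] by (simp add: continuous_intros)

lemma orbit_compact: "compact (orbit u)"
  unfolding orbit_def by (intro compact_continuous_image continuous_S_left) simp

lemma orbit_borel [measurable, simp]: "orbit u \<in> sets borel"
  by (simp add: orbit_compact compact_imp_closed)

lemma act_in_orbit: "u \<in> K \<Longrightarrow> p \<in> circle \<Longrightarrow> z \<in> orbit u \<Longrightarrow> S p z \<in> orbit u"
  by (auto simp: orbit_def S_mult[symmetric] norm_mult)

definition haar_orbit :: "'a \<Rightarrow> 'a measure" where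
  "haar_orbit u = distr haar_circle (restrict_space borel K) (\<lambda>p. S p u)"

lemma haar_circle_sets: "sets haar_circle = sets (restrict_space borel circle)"
  and haar_circle_space: "space haar_circle = circle"
  using haar_circle_prob circle_self.space_K by (auto simp: borel_prob_on_def)

lemma haar_orbit_measurable: "u \<in> K \<Longrightarrow> (\<lambda>p. S p u) \<in> measurable haar_circle (restrict_space borel K)"
proof (rule measurable_restrict_space2)
  show "u \<in> K \<Longrightarrow> (\<lambda>p. S p u) \<in> space haar_circle \<rightarrow> K" by (auto simp: haar_circle_space S_in)
  show "(\<lambda>p. S p u) \<in> borel_measurable haar_circle"
    using circle_self.id_measurable[OF haar_circle_sets] by measurable
qed

lemma emeasure_haar_orbit:
  assumes "u \<in> K" "J \<in> sets (restrict_space borel K)"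
  shows "emeasure (haar_orbit u) J = emeasure haar_circle {p\<in>circle. S p u \<in> J}"
  unfolding haar_orbit_def
  by (subst emeasure_distr[OF haar_orbit_measurable[OF assms(1)] assms(2)])
     (simp add: haar_circle_space vimage_def Int_def conj_commute)

lemma sets_haar_orbit: "sets (haar_orbit u) = sets (restrict_space borel K)"
  by (simp add: haar_orbit_def)

text \<open>The new base point only multiplies the parameter by \<open>q\<close>, which Haar measure
  ignores.\<close>

lemma haar_shift:
  assumes J: "J \<in> sets (restrict_space borel K)" and u: "u \<in> K" and q: "q \<in> circle"
  shows "emeasure haar_circle {p\<in>circle. S p (S q u) \<in> J} = emeasure haar_circle {p\<in>circle. S p u \<in> J}"
proof -
  have [measurable]: "J \<in> sets borel" using sets_K_iff[OF refl] J by blast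
  have "{p\<in>space borel. p \<in> circle \<and> S p u \<in> J} \<in> sets borel" by measurable
  then have "{p\<in>circle. S p u \<in> J} \<in> sets haar_circle"
    by (simp add: haar_circle_sets sets_restrict_space_iff subset_iff)
  then have "emeasure haar_circle {r\<in>circle. q * r \<in> {p\<in>circle. S p u \<in> J}} = emeasure haar_circle {p\<in>circle. S p u \<in> J}"
    by (rule circle_self.act_invariantD[OF haar_circle_invariant q])
  moreover have "{r\<in>circle. q * r \<in> {p\<in>circle. S p u \<in> J}} = {p\<in>circle. S p (S q u) \<in> J}"
    using q u by (auto simp: norm_mult S_mult[symmetric] mult.commute)
  ultimately show ?thesis by simp
qed

lemma haar_orbit_base:
  assumes "u \<in> K" "z \<in> orbit u"
  shows "haar_orbit z = haar_orbit u"
proof -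
  obtain q where q: "q \<in> circle" "z = S q u" using assms by (auto simp: orbit_def)
  have z: "z \<in> K" using assms orbit_subset by blast
  show ?thesis
    by (rule measure_eqI)
       (use assms q z haar_shift in \<open>auto simp: sets_haar_orbit emeasure_haar_orbit\<close>)
qed

lemma haar_orbit_prob: "u \<in> K \<Longrightarrow> borel_prob_on K (haar_orbit u)"
  using haar_circle_prob haar_orbit_measurable
  by (auto simp: borel_prob_on_def sets_haar_orbit haar_orbit_def intro!: prob_space.prob_space_distr)

lemma haar_orbit_invariant:
  assumes u: "u \<in> K"
  shows "act_invariant (haar_orbit u)"
  unfolding act_invariant_def
proof (intro conjI ballI haar_orbit_prob u)
  fix q :: complex and J assume q: "q \<in> circle" and J: "J \<in> sets (haar_orbit u)"
  then have J': "J \<in> sets (restrict_space borel K)" by (simp add: sets_haar_orbit)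
  have "emeasure (haar_orbit u) {z \<in> K. S q z \<in> J} = emeasure haar_circle {p\<in>circle. S p u \<in> {z \<in> K. S q z \<in> J}}"
    using act_preimage_sets[OF sets_haar_orbit J] by (intro emeasure_haar_orbit u) (simp add: sets_haar_orbit)
  also have "{p\<in>circle. S p u \<in> {z \<in> K. S q z \<in> J}} = {p\<in>circle. S p (S q u) \<in> J}"
    using q u by (auto simp: S_in S_mult[symmetric] mult.commute)
  also have "emeasure haar_circle \<dots> = emeasure haar_circle {p\<in>circle. S p u \<in> J}" by (rule haar_shift[OF J' u q])
  finally show "emeasure (haar_orbit u) {z \<in> K. S q z \<in> J} = emeasure (haar_orbit u) J"
    by (simp add: emeasure_haar_orbit[OF u J'])
qed

lemma haar_orbit_concentrated:
  assumes u: "u \<in> K"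
  shows "emeasure (haar_orbit u) (orbit u) = 1"
proof -
  interpret prob_space haar_circle using haar_circle_prob by (simp add: borel_prob_on_def)
  have "orbit u \<in> sets (restrict_space borel K)"
    using orbit_subset[OF u] by (simp add: sets_restrict_space_iff)
  then have "emeasure (haar_orbit u) (orbit u) = emeasure haar_circle {p\<in>circle. S p u \<in> orbit u}"
    by (rule emeasure_haar_orbit[OF u])
  also have "{p\<in>circle. S p u \<in> orbit u} = space haar_circle"
    by (auto simp: haar_circle_space orbit_def)
  finally show ?thesis by (simp add: emeasure_space_1)
qed

text \<open>In \<open>invariant_average\<close> with Haar measure the integrand is the mass of
  \<open>J\<close> under \<open>haar_orbit z\<close>, and this is the same for all \<open>z\<close>
  of the orbit that carries \<nu>.\<close>

lemma invariant_concentrated_eq: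
  assumes \<nu>: "act_invariant \<nu>" and u: "u \<in> K" and c: "emeasure \<nu> (orbit u) = 1"
  shows "\<nu> = haar_orbit u"
proof (rule measure_eqI)
  have s: "sets \<nu> = sets (restrict_space borel K)" using \<nu> by (simp add: act_invariant_def borel_prob_on_def)
  then show "sets \<nu> = sets (haar_orbit u)" by (simp add: sets_haar_orbit)
  interpret prob_space \<nu> using \<nu> by (simp add: act_invariant_def borel_prob_on_def)
  fix J assume J: "J \<in> sets \<nu>"
  then have J': "J \<in> sets (restrict_space borel K)" using s by simp
  have orb: "orbit u \<in> sets \<nu>" using orbit_subset[OF u] by (simp add: sets_K_iff[OF s])
  have "prob (orbit u) = 1" using c by (simp add: emeasure_eq_measure)
  then have AE: "AE z in \<nu>. z \<in> orbit u" using AE_in_set_eq_1[OF orb] by simp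
  have "emeasure \<nu> J = (\<integral>\<^sup>+z. emeasure haar_circle {p\<in>circle. S p z \<in> J} \<partial>\<nu>)"
    by (rule invariant_average[OF \<nu> haar_circle_prob J])
  also have "\<dots> = (\<integral>\<^sup>+z. emeasure (haar_orbit u) J \<partial>\<nu>)"
  proof (rule nn_integral_cong_AE)
    show "AE z in \<nu>. emeasure haar_circle {p\<in>circle. S p z \<in> J} = emeasure (haar_orbit u) J"
      using AE
    proof eventually_elim
      case (elim z)
      then have "z \<in> K" using orbit_subset[OF u] by blast
      then show ?case using emeasure_haar_orbit[OF _ J', of z] haar_orbit_base[OF u elim] by simp
    qed
  qed
  finally show "emeasure \<nu> J = emeasure (haar_orbit u) J" by (simp add: emeasure_space_1)
qed

definition act_ergodic :: "'a measure \<Rightarrow> bool" where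
  "act_ergodic \<nu> \<longleftrightarrow> act_invariant \<nu> \<and>
     (\<forall>\<nu>1 \<nu>2 r. act_invariant \<nu>1 \<and> act_invariant \<nu>2 \<and> 0 < r \<and> r < 1 \<and> convex_combination r \<nu>1 \<nu>2 \<nu> \<longrightarrow> \<nu>1 = \<nu>2)"

text \<open>A set of full mass has full mass for both components of a proper convex combination. So
  both live on the orbit, where only one invariant probability exists.\<close>

lemma haar_orbit_ergodic:
  assumes u: "u \<in> K"
  shows "act_ergodic (haar_orbit u)"
  unfolding act_ergodic_def
proof (intro conjI allI impI haar_orbit_invariant u)
  fix \<nu>1 \<nu>2 r
  assume *: "act_invariant \<nu>1 \<and> act_invariant \<nu>2 \<and> 0 < r \<and> r < 1 \<and> convex_combination r \<nu>1 \<nu>2 (haar_orbit u)"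
  have s: "sets \<nu>1 = sets (restrict_space borel K)" "sets \<nu>2 = sets (restrict_space borel K)"
    using * by (auto simp: act_invariant_def borel_prob_on_def)
  interpret N1: prob_space \<nu>1 using * by (simp add: act_invariant_def borel_prob_on_def)
  interpret N2: prob_space \<nu>2 using * by (simp add: act_invariant_def borel_prob_on_def)
  have orb: "orbit u \<in> sets (restrict_space borel K)"
    using orbit_subset[OF u] by (simp add: sets_restrict_space_iff)
  have "measure (haar_orbit u) (orbit u) = 1"
    using haar_orbit_concentrated[OF u] by (simp add: measure_def)
  then have eq: "1 = (1 - r) * measure \<nu>1 (orbit u) + r * measure \<nu>2 (orbit u)"
    using * orb by (auto simp: convex_combination_def sets_haar_orbit)
  have le: "(1 - r) * measure \<nu>1 (orbit u) \<le> 1 - r" "r * measure \<nu>2 (orbit u) \<le> r"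
    using * N1.prob_le_1[of "orbit u"] N2.prob_le_1[of "orbit u"] mult_left_mono[of "measure \<nu>1 (orbit u)" 1 "1 - r"]
      mult_left_mono[of "measure \<nu>2 (orbit u)" 1 r] by auto
  have "(1 - r) * measure \<nu>1 (orbit u) = (1 - r) * 1" "r * measure \<nu>2 (orbit u) = r * 1"
  proof -
    have "X = 1 - r \<and> Y = r" if "1 = X + Y" "X \<le> 1 - r" "Y \<le> r" for X Y :: real using that by linarith
    from this[OF eq le] show "(1 - r) * measure \<nu>1 (orbit u) = (1 - r) * 1" "r * measure \<nu>2 (orbit u) = r * 1" by simp_all
  qed
  then have "measure \<nu>1 (orbit u) = 1" "measure \<nu>2 (orbit u) = 1"
    using * by (auto simp del: mult_1_right)
  then have "emeasure \<nu>1 (orbit u) = 1" "emeasure \<nu>2 (orbit u) = 1"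
    by (auto simp: N1.emeasure_eq_measure N2.emeasure_eq_measure)
  then show "\<nu>1 = \<nu>2" using invariant_concentrated_eq u * by metis
qed

lemma uniform_measure_invariant:
  assumes \<nu>: "act_invariant \<nu>" and J: "J \<in> sets \<nu>" and inv: "\<And>p z. p \<in> circle \<Longrightarrow> z \<in> K \<Longrightarrow> S p z \<in> J \<longleftrightarrow> z \<in> J"
    and pos: "emeasure \<nu> J \<noteq> 0"
  shows "act_invariant (uniform_measure \<nu> J)"
proof -
  have s: "sets \<nu> = sets (restrict_space borel K)" using \<nu> by (simp add: act_invariant_def borel_prob_on_def)
  interpret prob_space \<nu> using \<nu> by (simp add: act_invariant_def borel_prob_on_def)
  show ?thesis
    unfolding act_invariant_def
  proof (intro conjI ballI)
    show "borel_prob_on K (uniform_measure \<nu> J)"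
      unfolding borel_prob_on_def using s pos by (auto intro!: prob_space_uniform_measure)
    fix p :: complex and E assume p: "p \<in> circle" and E: "E \<in> sets (uniform_measure \<nu> J)"
    then have E: "E \<in> sets \<nu>" by simp
    have JK: "J \<subseteq> K" using J sets_K_iff[OF s] by auto
    have "J \<inter> {z\<in>K. S p z \<in> E} = {z\<in>K. S p z \<in> J \<inter> E}" using inv[OF p] JK by auto
    then have "emeasure \<nu> (J \<inter> {z\<in>K. S p z \<in> E}) = emeasure \<nu> (J \<inter> E)"
      using act_invariantD[OF \<nu> p, of "J \<inter> E"] E J by simp
    then show "emeasure (uniform_measure \<nu> J) {z\<in>K. S p z \<in> E} = emeasure (uniform_measure \<nu> J) E"
      using E J act_preimage_sets[OF s E] by simp
  qed
qed

text \<open>Otherwise conditioning on \<open>J\<close> and on its complement would present \<nu> as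
  a proper mixture of two invariant probabilities that differ on \<open>J\<close>.\<close>

lemma ergodic_zero_one:
  assumes \<nu>: "act_ergodic \<nu>" and J: "J \<in> sets \<nu>" and inv: "\<And>p z. p \<in> circle \<Longrightarrow> z \<in> K \<Longrightarrow> S p z \<in> J \<longleftrightarrow> z \<in> J"
  shows "measure \<nu> J = 0 \<or> measure \<nu> J = 1"
proof (rule ccontr)
  have \<nu>i: "act_invariant \<nu>" using \<nu> by (simp add: act_ergodic_def)
  have s: "sets \<nu> = sets (restrict_space borel K)" using \<nu>i by (simp add: act_invariant_def borel_prob_on_def)
  interpret prob_space \<nu> using \<nu>i by (simp add: act_invariant_def borel_prob_on_def)
  have sp: "space \<nu> = K" using space_K[OF s] .
  assume "\<not> (prob J = 0 \<or> prob J = 1)"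
  then have J01: "0 < prob J" "prob J < 1" using prob_le_1[of J] by (auto simp: less_le)
  define J' where "J' = space \<nu> - J"
  have J': "J' \<in> sets \<nu>" "prob J' = 1 - prob J" using J prob_compl[OF J] by (auto simp: J'_def)
  have ne: "emeasure \<nu> J \<noteq> 0" "emeasure \<nu> J' \<noteq> 0" using J01 J' by (auto simp: emeasure_eq_measure ennreal_eq_0_iff)
  have m: "measure (uniform_measure \<nu> J) E = prob (J \<inter> E) / prob J" "measure (uniform_measure \<nu> J') E = prob (J' \<inter> E) / prob J'"
    if "E \<in> sets \<nu>" for E
    using that J J' ne J01 by (auto simp: measure_uniform_measure)
  have "uniform_measure \<nu> J = uniform_measure \<nu> J'"
  proof -
    have "act_invariant (uniform_measure \<nu> J)" by (rule uniform_measure_invariant[OF \<nu>i J inv ne(1)])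
    moreover have "act_invariant (uniform_measure \<nu> J')"
      by (rule uniform_measure_invariant[OF \<nu>i J'(1) _ ne(2)]) (auto simp: J'_def sp S_in inv simp del: mem_sphere)
    moreover have "convex_combination (prob J') (uniform_measure \<nu> J) (uniform_measure \<nu> J') \<nu>"
      unfolding convex_combination_def
    proof
      fix E assume E: "E \<in> sets \<nu>"
      have "E = (J \<inter> E) \<union> (J' \<inter> E)" using sets.sets_into_space[OF E] by (auto simp: J'_def)
      then have "prob E = prob (J \<inter> E) + prob (J' \<inter> E)"
        using finite_measure_Union[of "J \<inter> E" "J' \<inter> E"] E J J' by (auto simp: J'_def)
      then show "prob E = (1 - prob J') * measure (uniform_measure \<nu> J) E + prob J' * measure (uniform_measure \<nu> J') E"
        using J01 J'(2) by (simp add: m[OF E])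
    qed
    ultimately show ?thesis using \<nu> J01 J'(2) unfolding act_ergodic_def by (metis add_diff_cancel_left' diff_gt_0_iff_gt diff_add_cancel less_add_same_cancel2)
  qed
  then have "measure (uniform_measure \<nu> J) J = measure (uniform_measure \<nu> J') J" by simp
  moreover have "J' \<inter> J = {}" by (auto simp: J'_def)
  ultimately show False using m[OF J] J01 by simp
qed

text \<open>By compactness the distance is attained at some point of the orbit; moving that point
  along with \<open>z\<close> gives one inequality, the inverse of \<open>p\<close> the
  other.\<close>

lemma infdist_orbit_invariant:
  assumes u: "u \<in> K" and p: "p \<in> circle" and z: "z \<in> K"
  shows "infdist (S p z) (orbit u) = infdist z (orbit u)"
proof -
  have le: "infdist (S p z) (orbit u) \<le> infdist z (orbit u)" if p: "p \<in> circle" and z: "z \<in> K" for p z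
  proof -
    obtain y where y: "y \<in> orbit u" "infdist z (orbit u) = dist z y"
      using infdist_attains_inf[of "orbit u" z] orbit_compact[of u] orbit_self[OF u] by (metis compact_imp_closed empty_iff)
    have "infdist (S p z) (orbit u) \<le> dist (S p z) (S p y)"
      by (rule infdist_le) (rule act_in_orbit[OF u p y(1)])
    also have "\<dots> = dist z y" using y orbit_subset[OF u] by (intro S_dist p z) auto
    finally show ?thesis using y by simp
  qed
  have p0: "p \<noteq> 0" using p by auto
  have "infdist (S (inverse p) (S p z)) (orbit u) \<le> infdist (S p z) (orbit u)"
    using p by (intro le S_in z) (auto simp: norm_inverse)
  moreover have "S (inverse p) (S p z) = z"
    using p p0 z by (subst S_mult[symmetric]) (auto simp: norm_inverse S_one)
  ultimately show ?thesis using le[OF p z] by simp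
qed

text \<open>Otherwise null balls around all points would cover \<open>K\<close>, and by compactness
  finitely many of them already would.\<close>

lemma exists_support_point:
  assumes "borel_prob_on K \<nu>"
  shows "\<exists>u\<in>K. \<forall>e>0. measure \<nu> (K \<inter> ball u e) > 0"
proof (rule ccontr)
  have s: "sets \<nu> = sets (restrict_space borel K)" using assms by (simp add: borel_prob_on_def)
  interpret prob_space \<nu> using assms by (simp add: borel_prob_on_def)
  assume "\<not> (\<exists>u\<in>K. \<forall>e>0. prob (K \<inter> ball u e) > 0)"
  then have "\<forall>u\<in>K. \<exists>e>0. prob (K \<inter> ball u e) = 0" by (metis measure_nonneg less_eq_real_def)
  then obtain e where e: "\<And>u. u \<in> K \<Longrightarrow> e u > 0" "\<And>u. u \<in> K \<Longrightarrow> prob (K \<inter> ball u (e u)) = 0" by metis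
  obtain D where D: "D \<subseteq> K" "finite D" "K \<subseteq> (\<Union>u\<in>D. ball u (e u))"
    using compactE_image[OF K_compact, of K "\<lambda>u. ball u (e u)"] e(1) by (metis (no_types, lifting) UN_iff centre_in_ball open_ball subsetI)
  have "prob K \<le> prob (\<Union>u\<in>D. K \<inter> ball u (e u))"
    using D by (intro finite_measure_mono sets.finite_UN) (auto simp: sets_K_iff[OF s])
  also have "\<dots> \<le> (\<Sum>u\<in>D. prob (K \<inter> ball u (e u)))"
    using D by (intro finite_measure_subadditive_finite) (auto simp: sets_K_iff[OF s])
  also have "\<dots> = 0" using D e(2) by (intro sum.neutral) auto
  finally show False using prob_space space_K[OF s] by simp
qed

lemma ergodic_is_haar_orbit:
  assumes \<nu>: "act_ergodic \<nu>"
  shows "\<exists>u\<in>K. \<nu> = haar_orbit u"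
proof -
  have \<nu>i: "act_invariant \<nu>" using \<nu> by (simp add: act_ergodic_def)
  have s: "sets \<nu> = sets (restrict_space borel K)" using \<nu>i by (simp add: act_invariant_def borel_prob_on_def)
  interpret prob_space \<nu> using \<nu>i by (simp add: act_invariant_def borel_prob_on_def)
  obtain u where u: "u \<in> K" and supp: "\<And>e. e > 0 \<Longrightarrow> prob (K \<inter> ball u e) > 0"
    using exists_support_point \<nu>i unfolding act_invariant_def by blast
  \<comment> \<open>Tubes around the orbit are invariant sets, have positive mass because each
    contains a ball around \<open>u\<close>, and intersect in the closed orbit.\<close>
  define N where "N n = {z\<in>K. infdist z (orbit u) < 1 / real (Suc n)}" for n
  have Ns: "N n \<in> sets \<nu>" for n
  proof -
    have [measurable]: "(\<lambda>z. infdist z (orbit u)) \<in> borel_measurable borel"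
      by (intro borel_measurable_continuous_onI continuous_intros)
    have "{z\<in>space borel. z \<in> K \<and> infdist z (orbit u) < 1 / real (Suc n)} \<in> sets borel" by measurable
    then show ?thesis using sets_K_iff[OF s] by (auto simp: N_def)
  qed
  have "prob (N n) = 1" for n
  proof -
    have "K \<inter> ball u (1 / real (Suc n)) \<subseteq> N n"
      using le_less_trans[OF infdist_le[OF orbit_self[OF u]]] by (auto simp: N_def dist_commute)
    then have "prob (K \<inter> ball u (1 / real (Suc n))) \<le> prob (N n)" by (intro finite_measure_mono Ns)
    moreover have "prob (K \<inter> ball u (1 / real (Suc n))) > 0" by (rule supp) simp
    ultimately have "prob (N n) \<noteq> 0" by linarith
    moreover have "prob (N n) = 0 \<or> prob (N n) = 1"
      by (rule ergodic_zero_one[OF \<nu> Ns]) (auto simp: N_def S_in infdist_orbit_invariant[OF u] simp del: mem_sphere)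
    ultimately show ?thesis by simp
  qed
  then have "AE z in \<nu>. \<forall>n. z \<in> N n" unfolding AE_all_countable using Ns by (simp add: AE_in_set_eq_1)
  then have "AE z in \<nu>. z \<in> orbit u"
  proof eventually_elim
    case (elim z)
    have "infdist z (orbit u) = 0"
    proof (rule ccontr)
      assume "infdist z (orbit u) \<noteq> 0"
      then have "infdist z (orbit u) > 0" using infdist_nonneg[of z "orbit u"] by simp
      then obtain n where "1 / real (Suc n) < infdist z (orbit u)" using nat_approx_posE by metis
      then show False using elim by (auto simp: N_def dest: spec[of _ n])
    qed
    then show ?case
      using in_closed_iff_infdist_zero[of "orbit u" z] orbit_compact[of u] orbit_self[OF u] by (auto simp: compact_imp_closed)
  qed
  then have "prob (orbit u) = 1"
    using orbit_subset[OF u] by (subst (asm) AE_in_set_eq_1) (auto simp: sets_K_iff[OF s])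
  then have "emeasure \<nu> (orbit u) = 1" by (simp add: emeasure_eq_measure)
  then show ?thesis using invariant_concentrated_eq[OF \<nu>i u] u by blast
qed

lemma act_ergodic_iff: "act_ergodic \<nu> \<longleftrightarrow> (\<exists>u\<in>K. \<nu> = haar_orbit u)"
  using haar_orbit_ergodic ergodic_is_haar_orbit by blast

end

section \<open>Random rotations\<close>

text \<open>A positive density charges every interval of positive length, so no nonempty open set
  can be avoided almost surely.\<close>

lemma open_AE_distributed_empty:
  fixes \<xi> :: "'w \<Rightarrow> real"
  assumes P: "prob_space P" and d: "distributed P lborel \<xi> f" and f: "\<And>x. f x > 0"
    and G: "open G" and AE: "AE \<omega> in P. \<xi> \<omega> \<notin> G"
  shows "G = {}"
proof -
  interpret prob_space P by fact
  have Ob [measurable]: "G \<in> sets borel" using G by simp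
  have \<xi> [measurable]: "\<xi> \<in> borel_measurable P" using d by (auto simp: distributed_def)
  have fm: "f \<in> borel_measurable lborel" using d by (auto simp: distributed_def)
  have "emeasure P (\<xi> -` G \<inter> space P) = (\<integral>\<^sup>+x. f x * indicator G x \<partial>lborel)"
    using distributed_emeasure[OF d, of G] by simp
  moreover have "emeasure P (\<xi> -` G \<inter> space P) = 0"
    using AE by (subst AE_iff_measurable[symmetric, where P="\<lambda>\<omega>. \<xi> \<omega> \<notin> G"]) auto
  ultimately have "(\<integral>\<^sup>+x. f x * indicator G x \<partial>lborel) = 0" by simp
  then have "AE x in lborel. f x * indicator G x = 0"
    using fm by (subst (asm) nn_integral_0_iff_AE) auto
  then have "AE x in lborel. x \<notin> G"
  proof eventually_elim
    case (elim x)
    then show ?case using f[of x] by (auto simp: zero_less_iff_neq_zero split: split_indicator_asm)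
  qed
  then have null: "emeasure lborel G = 0"
    by (subst AE_iff_measurable[symmetric, where P="\<lambda>x. x \<notin> G"]) auto
  show ?thesis
  proof (rule ccontr)
    assume "G \<noteq> {}"
    then obtain x e where "e > 0" "ball x e \<subseteq> G" using G by (meson ex_in_conv open_contains_ball)
    then have "{x - e<..<x + e} \<subseteq> G" by (simp add: ball_eq_greaterThanLessThan)
    then have "emeasure lborel {x - e<..<x + e} \<le> emeasure lborel G" by (intro emeasure_mono) auto
    then show False using null \<open>e > 0\<close> by (simp add: emeasure_lborel_Ioo ennreal_eq_0_iff)
  qed
qed

section \<open>Laws that are stationary under a random rotation\<close>

context circle_action begin

text \<open>Time is fixed here and the solution replaced by rotation through a random angle
  \<theta>. The starting point is drawn from \<nu> independently of it, which the product measure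
  expresses.\<close>

context
  fixes P :: "'w measure" and \<theta> :: "'w \<Rightarrow> real" and \<nu> :: "'a measure"
  assumes P: "prob_space P" and \<theta>: "\<theta> \<in> borel_measurable P" and \<nu>: "borel_prob_on K \<nu>"
begin

interpretation PS: prob_space P by (rule P)
interpretation \<nu>: prob_space \<nu> using \<nu> by (simp add: borel_prob_on_def)
interpretation pair_sigma_finite \<nu> P ..

lemma random_sets: "sets \<nu> = sets (restrict_space borel K)"
  using \<nu> by (simp add: borel_prob_on_def)

lemma random_space: "space \<nu> = K"
  by (rule space_K[OF random_sets])

lemma random_id: "(\<lambda>z. z) \<in> borel_measurable \<nu>"
  by (rule id_measurable[OF random_sets])

lemma random_rotation_measurable: "(\<lambda>x. S (cis (\<theta> (snd x))) (fst x)) \<in> borel_measurable (\<nu> \<Otimes>\<^sub>M P)"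
proof -
  have "fst \<in> borel_measurable (\<nu> \<Otimes>\<^sub>M P)" by (rule measurable_compose[OF measurable_fst random_id])
  moreover have "(\<lambda>x. cis (\<theta> (snd x))) \<in> borel_measurable (\<nu> \<Otimes>\<^sub>M P)"
    unfolding cis_conv_exp using measurable_compose[OF measurable_snd \<theta>] by measurable
  ultimately show ?thesis by measurable
qed

definition rotated :: "'a measure" where
  "rotated = distr (\<nu> \<Otimes>\<^sub>M P) borel (\<lambda>x. S (cis (\<theta> (snd x))) (fst x))"

text \<open>The two orders of integration have different readings: by starting point, the transition
  kernel integrated against \<nu>; by angle, an average of rotated copies of \<nu>.\<close>

lemma emeasure_rotated:
  assumes J: "J \<in> sets borel"
  shows "emeasure rotated J = (\<integral>\<^sup>+z. emeasure P {\<omega>\<in>space P. S (cis (\<theta> \<omega>)) z \<in> J} \<partial>\<nu>)"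
    "emeasure rotated J = (\<integral>\<^sup>+\<omega>. emeasure \<nu> {z\<in>K. S (cis (\<theta> \<omega>)) z \<in> J} \<partial>P)"
proof -
  let ?T = "\<lambda>x. S (cis (\<theta> (snd x))) (fst x)"
  have s: "?T -` J \<inter> space (\<nu> \<Otimes>\<^sub>M P) \<in> sets (\<nu> \<Otimes>\<^sub>M P)"
    by (rule measurable_sets[OF random_rotation_measurable J])
  have e: "emeasure rotated J = emeasure (\<nu> \<Otimes>\<^sub>M P) (?T -` J \<inter> space (\<nu> \<Otimes>\<^sub>M P))"
    unfolding rotated_def by (rule emeasure_distr[OF random_rotation_measurable J])
  show "emeasure rotated J = (\<integral>\<^sup>+z. emeasure P {\<omega>\<in>space P. S (cis (\<theta> \<omega>)) z \<in> J} \<partial>\<nu>)"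
    unfolding e PS.emeasure_pair_measure_alt[OF s]
    by (intro nn_integral_cong arg_cong[where f="emeasure P"]) (auto simp: space_pair_measure)
  show "emeasure rotated J = (\<integral>\<^sup>+\<omega>. emeasure \<nu> {z\<in>K. S (cis (\<theta> \<omega>)) z \<in> J} \<partial>P)"
    unfolding e emeasure_pair_measure_alt2[OF s]
    by (intro nn_integral_cong arg_cong[where f="emeasure \<nu>"]) (auto simp: space_pair_measure random_space)
qed

lemma rotated_prob: "prob_space rotated"
proof -
  interpret PP: pair_prob_space \<nu> P ..
  show ?thesis
    unfolding rotated_def by (rule PP.prob_space_distr[OF random_rotation_measurable])
qed

lemma measure_rotated:
  assumes J: "J \<in> sets borel"
  shows "measure rotated J = (\<integral>z. measure P {\<omega>\<in>space P. S (cis (\<theta> \<omega>)) z \<in> J} \<partial>\<nu>)"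
proof -
  have s: "(\<lambda>x. S (cis (\<theta> (snd x))) (fst x)) -` J \<inter> space (\<nu> \<Otimes>\<^sub>M P) \<in> sets (\<nu> \<Otimes>\<^sub>M P)"
    by (rule measurable_sets[OF random_rotation_measurable J])
  have "(\<lambda>z. emeasure P (Pair z -` ((\<lambda>x. S (cis (\<theta> (snd x))) (fst x)) -` J \<inter> space (\<nu> \<Otimes>\<^sub>M P)))) \<in> borel_measurable \<nu>"
    by (rule PS.measurable_emeasure_Pair[OF s])
  then have "(\<lambda>z. emeasure P {\<omega>\<in>space P. S (cis (\<theta> \<omega>)) z \<in> J}) \<in> borel_measurable \<nu>"
    by (rule measurable_cong[THEN iffD1, rotated]) (auto simp: space_pair_measure intro!: arg_cong[where f="emeasure P"])
  then have m: "(\<lambda>z. measure P {\<omega>\<in>space P. S (cis (\<theta> \<omega>)) z \<in> J}) \<in> borel_measurable \<nu>"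
    unfolding measure_def by measurable
  have "(\<integral>z. measure P {\<omega>\<in>space P. S (cis (\<theta> \<omega>)) z \<in> J} \<partial>\<nu>) =
    enn2real (\<integral>\<^sup>+z. ennreal (measure P {\<omega>\<in>space P. S (cis (\<theta> \<omega>)) z \<in> J}) \<partial>\<nu>)"
    by (rule integral_eq_nn_integral) (use m in auto)
  then show ?thesis
    unfolding measure_def[of rotated] emeasure_rotated(1)[OF J] by (simp add: PS.emeasure_eq_measure)
qed

lemma act_invariant_rotated:
  assumes "act_invariant \<nu>" and J: "J \<in> sets \<nu>"
  shows "(\<integral>z. measure P {\<omega>\<in>space P. S (cis (\<theta> \<omega>)) z \<in> J} \<partial>\<nu>) = measure \<nu> J"
proof -
  have Jb: "J \<in> sets borel" using J sets_K_iff[OF random_sets] by auto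
  have "emeasure rotated J = (\<integral>\<^sup>+\<omega>. emeasure \<nu> J \<partial>P)"
    unfolding emeasure_rotated(2)[OF Jb] by (intro nn_integral_cong act_invariantD assms) auto
  then have "emeasure rotated J = emeasure \<nu> J" by (simp add: PS.emeasure_space_1)
  then show ?thesis using measure_rotated[OF Jb] by (simp add: measure_def)
qed

context
  assumes inv: "\<And>J. J \<in> sets \<nu> \<Longrightarrow> (\<integral>z. measure P {\<omega>\<in>space P. S (cis (\<theta> \<omega>)) z \<in> J} \<partial>\<nu>) = measure \<nu> J"
begin

text \<open>Stationarity is known on subsets of \<open>K\<close> only.
  \<open>distr \<nu> borel\<close> extends \<nu> by zero to the whole space, and the rotated law has
  no mass outside \<open>K\<close> either.\<close>

lemma rotated_eq: "rotated = distr \<nu> borel (\<lambda>z. z)"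
proof (rule measure_eqI)
  show "sets rotated = sets (distr \<nu> borel (\<lambda>z. z))" by (simp add: rotated_def)
  interpret R: prob_space rotated by (rule rotated_prob)
  fix E assume "E \<in> sets rotated"
  then have E [measurable]: "E \<in> sets borel" by (simp add: rotated_def)
  have EK: "E \<inter> K \<in> sets \<nu>" "E \<inter> K \<in> sets borel" using sets_K_iff[OF random_sets] by auto
  have "emeasure rotated E = emeasure rotated (E \<inter> K)"
    unfolding emeasure_rotated(2)[OF E] emeasure_rotated(2)[OF EK(2)]
    by (intro nn_integral_cong arg_cong[where f="emeasure \<nu>"]) (auto simp: S_in)
  also have "\<dots> = emeasure \<nu> (E \<inter> K)"
    using measure_rotated[OF EK(2)] inv[OF EK(1)] by (simp add: R.emeasure_eq_measure \<nu>.emeasure_eq_measure)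
  also have "\<dots> = emeasure (distr \<nu> borel (\<lambda>z. z)) E"
    by (subst emeasure_distr[OF random_id E]) (simp add: random_space)
  finally show "emeasure rotated E = emeasure (distr \<nu> borel (\<lambda>z. z)) E" .
qed

context
  fixes f :: "'a \<Rightarrow> real" and C :: real
  assumes f_continuous: "continuous_on UNIV f" and f_bounded: "\<And>z. \<bar>f z\<bar> \<le> C"
begin

text \<open>The test function averaged against \<nu> rotated by \<alpha>: continuous and periodic in
  \<alpha>, and by \<open>rotation_mean_average\<close> harmonic for the random walk with step
  \<theta>.\<close>

definition rotation_mean :: "real \<Rightarrow> real" where
  "rotation_mean \<alpha> = (\<integral>z. f (S (cis \<alpha>) z) \<partial>\<nu>)"

lemma f_measurable [measurable]: "f \<in> borel_measurable borel"
  by (rule borel_measurable_continuous_onI[OF f_continuous])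

lemma rotation_mean_continuous: "continuous_on UNIV rotation_mean"
  unfolding continuous_on_eq_continuous_at[OF open_UNIV] continuous_at_sequentially
proof (intro ballI allI impI)
  fix x :: real and X assume X: "X \<longlonglongrightarrow> x"
  have [measurable]: "(\<lambda>z. z) \<in> borel_measurable \<nu>" by (rule random_id)
  show "(rotation_mean \<circ> X) \<longlonglongrightarrow> rotation_mean x"
    unfolding comp_def rotation_mean_def
  proof (rule integral_dominated_convergence[where w="\<lambda>_. C"])
    show "AE z in \<nu>. (\<lambda>n. f (S (cis (X n)) z)) \<longlonglongrightarrow> f (S (cis x) z)"
    proof (rule AE_I2)
      fix z
      have "continuous_on UNIV (\<lambda>\<alpha>. S (cis \<alpha>) z)"
        unfolding cis_conv_exp
        by (rule continuous_on_compose2[OF continuous_S_left[of UNIV]]) (auto intro!: continuous_intros)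
      then have "continuous_on UNIV (\<lambda>\<alpha>. f (S (cis \<alpha>) z))"
        by (rule continuous_on_compose2[OF f_continuous]) auto
      then have "isCont (\<lambda>\<alpha>. f (S (cis \<alpha>) z)) x" by (simp add: continuous_on_eq_continuous_at)
      then show "(\<lambda>n. f (S (cis (X n)) z)) \<longlonglongrightarrow> f (S (cis x) z)"
        using X by (rule isCont_tendsto_compose)
    qed
  qed (auto simp: f_bounded)
qed

lemma rotation_mean_average: "rotation_mean \<alpha> = (\<integral>\<omega>. rotation_mean (\<alpha> + \<theta> \<omega>) \<partial>P)"
proof -
  have [measurable]: "(\<lambda>z. z) \<in> borel_measurable \<nu>" by (rule random_id)
  note [measurable] = random_rotation_measurable
  interpret PP: pair_prob_space \<nu> P ..
  have "rotation_mean \<alpha> = (\<integral>z. f (S (cis \<alpha>) z) \<partial>distr \<nu> borel (\<lambda>z. z))"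
    unfolding rotation_mean_def by (subst integral_distr) auto
  also have "\<dots> = (\<integral>x. f (S (cis \<alpha>) (S (cis (\<theta> (snd x))) (fst x))) \<partial>(\<nu> \<Otimes>\<^sub>M P))"
    unfolding rotated_eq[symmetric] rotated_def by (subst integral_distr) auto
  also have "\<dots> = (\<integral>x. (\<lambda>(z, \<omega>). f (S (cis \<alpha>) (S (cis (\<theta> \<omega>)) z))) x \<partial>(\<nu> \<Otimes>\<^sub>M P))"
    by (simp add: case_prod_beta)
  also have "\<dots> = (\<integral>\<omega>. (\<integral>z. f (S (cis \<alpha>) (S (cis (\<theta> \<omega>)) z)) \<partial>\<nu>) \<partial>P)"
  proof (rule integral_snd[symmetric])
    show "integrable (\<nu> \<Otimes>\<^sub>M P) (\<lambda>(z, \<omega>). f (S (cis \<alpha>) (S (cis (\<theta> \<omega>)) z)))"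
      unfolding case_prod_beta by (rule PP.integrable_const_bound[where B=C]) (auto simp: f_bounded)
  qed
  also have "\<dots> = (\<integral>\<omega>. rotation_mean (\<alpha> + \<theta> \<omega>) \<partial>P)"
    unfolding rotation_mean_def
    by (intro Bochner_Integration.integral_cong refl) (auto simp: random_space cis_mult[symmetric] S_mult)
  finally show ?thesis .
qed

text \<open>Maximum principle: at a maximal angle the mean over the random step equals the maximum,
  so almost every step leads to another maximal angle. The steps that do not form an open set, null
  for a law of full support and hence empty; since \<open>c\<close> is nonzero, the steps
  \<open>c * (b + x)\<close> reach every angle.\<close>

lemma rotation_mean_constant:
  assumes \<theta>_eq: "\<And>\<omega>. \<theta> \<omega> = c * (b + \<xi> \<omega>)" and c: "c \<noteq> 0"
    and \<xi>: "distributed P lborel \<xi> g" "\<And>x. g x > 0"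
  shows "rotation_mean \<alpha> = rotation_mean 0"
proof -
  obtain \<alpha>0 where "\<forall>y\<in>{0..2 * pi}. rotation_mean y \<le> rotation_mean \<alpha>0"
    using continuous_attains_sup[of "{0..2 * pi}" rotation_mean] continuous_on_subset[OF rotation_mean_continuous]
    by (metis atLeastAtMost_iff compact_Icc empty_iff m2pi_less_pi le_less order_refl pi_ge_zero mult_nonneg_nonneg zero_le_numeral subset_UNIV)
  \<comment> \<open>Periodicity turns the maximum over one period into a global one.\<close>
  have max: "rotation_mean y \<le> rotation_mean \<alpha>0" for y
  proof -
    obtain y' where "0 \<le> y'" "y' < 2 * pi" "cis y = cis y'"
      using circle_eq_cis[of "cis y"] by auto
    then show ?thesis
      using \<open>\<forall>y\<in>{0..2 * pi}. rotation_mean y \<le> rotation_mean \<alpha>0\<close> by (auto simp: rotation_mean_def dest: bspec[of _ _ y'])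
  qed
  have [measurable]: "rotation_mean \<in> borel_measurable borel"
    by (rule borel_measurable_continuous_onI[OF rotation_mean_continuous])
  note [measurable] = \<theta>
  have bound: "\<bar>rotation_mean y\<bar> \<le> C" for y
  proof -
    have "norm (rotation_mean y) \<le> (\<integral>z. norm (f (S (cis y) z)) \<partial>\<nu>)"
      unfolding rotation_mean_def by (rule integral_norm_bound)
    also have "\<dots> \<le> C" using random_id by (intro \<nu>.integral_le_const) (auto simp: f_bounded intro!: \<nu>.integrable_const_bound[where B=C])
    finally show ?thesis by simp
  qed
  have int: "integrable P (\<lambda>\<omega>. rotation_mean (\<alpha>0 + \<theta> \<omega>))"
    by (rule PS.integrable_const_bound[where B=C]) (auto simp: bound)
  have "(\<integral>\<omega>. rotation_mean \<alpha>0 - rotation_mean (\<alpha>0 + \<theta> \<omega>) \<partial>P) = 0"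
    using rotation_mean_average[of \<alpha>0] int by (simp add: PS.prob_space)
  then have "AE \<omega> in P. rotation_mean \<alpha>0 - rotation_mean (\<alpha>0 + \<theta> \<omega>) = 0"
    using int max by (subst (asm) integral_nonneg_eq_0_iff_AE) auto
  then have "AE \<omega> in P. \<xi> \<omega> \<notin> {x. rotation_mean (\<alpha>0 + c * (b + x)) \<noteq> rotation_mean \<alpha>0}"
    by eventually_elim (simp add: \<theta>_eq)
  moreover have "open {x. rotation_mean (\<alpha>0 + c * (b + x)) \<noteq> rotation_mean \<alpha>0}"
    by (intro open_Collect_neq continuous_on_compose2[OF rotation_mean_continuous] continuous_intros) auto
  ultimately have "{x. rotation_mean (\<alpha>0 + c * (b + x)) \<noteq> rotation_mean \<alpha>0} = {}"
    by (intro open_AE_distributed_empty[OF P \<xi>]) auto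
  then have eq: "rotation_mean (\<alpha>0 + c * (b + x)) = rotation_mean \<alpha>0" for x by blast
  have "rotation_mean y = rotation_mean \<alpha>0" for y
  proof -
    have "\<alpha>0 + c * (b + ((y - \<alpha>0) / c - b)) = y" using c by simp
    then show ?thesis using eq[of "(y - \<alpha>0) / c - b"] by simp
  qed
  then show ?thesis by metis
qed

end

text \<open>Continuous functions decreasing to the indicator of a closed set turn the constancy of
  every \<open>rotation_mean\<close> into invariance on closed sets, which are stable under
  intersection and generate the Borel sets.\<close>

lemma act_invariant_of_rotated:
  assumes \<theta>_eq: "\<And>\<omega>. \<theta> \<omega> = c * (b + \<xi> \<omega>)" and c: "c \<noteq> 0"
    and \<xi>: "distributed P lborel \<xi> g" "\<And>x. g x > 0"
  shows "act_invariant \<nu>"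
  unfolding act_invariant_def
proof (intro conjI ballI \<nu>)
  fix p :: complex and J assume p: "p \<in> circle" and J: "J \<in> sets \<nu>"
  obtain \<alpha> where \<alpha>: "p = cis \<alpha>" using circle_eq_cis[OF p] by blast
  have [measurable]: "(\<lambda>z. z) \<in> borel_measurable \<nu>" by (rule random_id)
  have [measurable]: "S p \<in> borel_measurable \<nu>" by measurable
  have closed: "emeasure (distr \<nu> borel (S p)) X = emeasure (distr \<nu> borel (\<lambda>z. z)) X" if X: "closed X" for X
  proof (cases "X = {}")
    case False
    define f where "f n z = max 0 (1 - real n * infdist z X)" for n z
    have fc: "continuous_on UNIV (f n)" for n unfolding f_def by (intro continuous_intros)
    have fb: "\<bar>f n z\<bar> \<le> 1" for n z using infdist_nonneg[of z X] by (auto simp: f_def)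
    have [measurable]: "f n \<in> borel_measurable borel" for n by (rule borel_measurable_continuous_onI[OF fc])
    have eq: "(\<integral>z. f n (S p z) \<partial>\<nu>) = (\<integral>z. f n z \<partial>\<nu>)" for n
    proof -
      have "(\<integral>z. f n (S (cis \<alpha>) z) \<partial>\<nu>) = (\<integral>z. f n (S (cis 0) z) \<partial>\<nu>)"
        using rotation_mean_constant[OF fc[of n] fb[of n] \<theta>_eq c \<xi>, of \<alpha>] by (simp only: rotation_mean_def[OF fc[of n] fb[of n]])
      also have "\<dots> = (\<integral>z. f n z \<partial>\<nu>)"
        by (intro Bochner_Integration.integral_cong refl) (simp add: random_space S_one)
      finally show ?thesis by (simp add: \<alpha>)
    qed
    have lim: "(\<lambda>n. f n z) \<longlonglongrightarrow> indicator X z" for z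
    proof (cases "z \<in> X")
      case True
      then show ?thesis by (simp add: f_def)
    next
      case False
      then have "infdist z X > 0"
        using in_closed_iff_infdist_zero[OF X \<open>X \<noteq> {}\<close>] infdist_nonneg[of z X] by (simp add: less_le)
      then obtain n0 where n0: "1 / infdist z X < real n0" using reals_Archimedean2 by blast
      have "f n z = 0" if "n \<ge> n0" for n
      proof -
        have "1 \<le> real n * infdist z X"
          using n0 that \<open>infdist z X > 0\<close> by (simp add: field_simps) (meson less_imp_le mult_right_mono of_nat_le_iff order_trans infdist_nonneg)
        then show ?thesis by (simp add: f_def)
      qed
      then have "\<forall>\<^sub>F n in sequentially. f n z = indicator X z"
        using False by (auto simp: eventually_sequentially)
      then show ?thesis by (rule tendsto_eventually)
    qed
    have [measurable]: "X \<in> sets borel" using X by simp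
    have *: "(\<lambda>n. \<integral>z. f n (h z) \<partial>\<nu>) \<longlonglongrightarrow> (\<integral>z. indicator X (h z) \<partial>\<nu>)" if [measurable]: "h \<in> borel_measurable \<nu>" for h
      by (rule integral_dominated_convergence[where w="\<lambda>_. 1"]) (auto simp: lim fb)
    have ind: "(\<integral>z. indicator X (h z) \<partial>\<nu>) = measure (distr \<nu> borel h) X" if [measurable]: "h \<in> borel_measurable \<nu>" for h
    proof -
      have "(\<integral>z. indicator X (h z) \<partial>\<nu>) = (\<integral>z. (indicator X z :: real) \<partial>distr \<nu> borel h)"
        by (subst integral_distr) auto
      then show ?thesis by simp
    qed
    have "(\<integral>z. (indicator X (S p z) :: real) \<partial>\<nu>) = (\<integral>z. indicator X z \<partial>\<nu>)"
      using LIMSEQ_unique[OF *[of "S p"] *[of "\<lambda>z. z", folded eq]] by simp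
    then have "measure (distr \<nu> borel (S p)) X = measure (distr \<nu> borel (\<lambda>z. z)) X"
      using ind[of "S p"] ind[of "\<lambda>z. z"] by simp
    moreover have "prob_space (distr \<nu> borel (S p))" "prob_space (distr \<nu> borel (\<lambda>z. z))"
      by (intro \<nu>.prob_space_distr; measurable)+
    ultimately show ?thesis by (simp add: finite_measure.emeasure_eq_measure prob_space.finite_measure)
  qed simp
  have "distr \<nu> borel (S p) = distr \<nu> borel (\<lambda>z. z)"
  proof (rule measure_eqI_generator_eq[where E="Collect closed" and \<Omega>=UNIV and A="\<lambda>_. UNIV"])
    show "Int_stable (Collect closed)" by (auto simp: Int_stable_def)
    show "sets (distr \<nu> borel (S p)) = sigma_sets UNIV (Collect closed)"
      "sets (distr \<nu> borel (\<lambda>z. z)) = sigma_sets UNIV (Collect closed)"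
      by (simp_all add: borel_eq_closed)
    show "emeasure (distr \<nu> borel (S p)) UNIV \<noteq> \<infinity>" for i :: nat
      by (subst emeasure_distr) auto
  qed (auto simp: closed)
  then have "emeasure (distr \<nu> borel (S p)) J = emeasure (distr \<nu> borel (\<lambda>z. z)) J" by simp
  moreover have "J \<in> sets borel" "J \<subseteq> K" using J sets_K_iff[OF random_sets] by auto
  moreover have "S p -` J \<inter> K = {z\<in>K. S p z \<in> J}" by auto
  ultimately show "emeasure \<nu> {z \<in> K. S p z \<in> J} = emeasure \<nu> J"
    by (simp add: emeasure_distr random_space Int_absorb2)
qed

end

end

end

section \<open>Matrices and the main theorem\<close>

lemma bounded_bilinear_matrix_mult: "bounded_bilinear ((**) :: real^'n^'m \<Rightarrow> real^'p^'n \<Rightarrow> real^'p^'m)"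
  unfolding bilinear_conv_bounded_bilinear[symmetric] bilinear_def
  by (intro conjI allI linearI)
     (simp_all add: vec_eq_iff matrix_matrix_mult_def sum.distrib sum_distrib_left algebra_simps)

lemma bounded_bilinear_matrix_vector_mult: "bounded_bilinear ((*v) :: real^'n^'m \<Rightarrow> real^'n \<Rightarrow> real^'m)"
  unfolding bilinear_conv_bounded_bilinear[symmetric] bilinear_def
  by (intro conjI allI linearI)
     (simp_all add: vec_eq_iff matrix_vector_mult_def sum.distrib sum_distrib_left algebra_simps)

lemma antisymmetric_entries:
  fixes B :: "real^3^3"
  assumes "transpose B = - B"
  shows "B $ 1 $ 1 = 0" "B $ 2 $ 2 = 0" "B $ 3 $ 3 = 0"
    "B $ 2 $ 1 = - B $ 1 $ 2" "B $ 3 $ 1 = - B $ 1 $ 3" "B $ 3 $ 2 = - B $ 2 $ 3"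
proof -
  have "B $ i $ j = - B $ j $ i" for i j
    using arg_cong[OF assms, of "\<lambda>M. M $ j $ i"] by (simp add: transpose_def)
  from this[of 1 1] this[of 2 2] this[of 3 3] this[of 2 1] this[of 3 1] this[of 3 2]
  show "B $ 1 $ 1 = 0" "B $ 2 $ 2 = 0" "B $ 3 $ 3 = 0"
    "B $ 2 $ 1 = - B $ 1 $ 2" "B $ 3 $ 1 = - B $ 1 $ 3" "B $ 3 $ 2 = - B $ 2 $ 3" by simp_all
qed

lemma rho_squared:
  assumes "transpose B = - B"
  shows "(rho B)\<^sup>2 = (B $ 1 $ 2)\<^sup>2 + (B $ 1 $ 3)\<^sup>2 + (B $ 2 $ 3)\<^sup>2"
proof -
  have "(rho B)\<^sup>2 = (1/2) * (norm B)\<^sup>2" by (simp add: rho_def)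
  also have "\<dots> = (B $ 1 $ 2)\<^sup>2 + (B $ 1 $ 3)\<^sup>2 + (B $ 2 $ 3)\<^sup>2"
    unfolding power2_norm_eq_inner inner_vec_def
    by (simp add: sum_3 antisymmetric_entries[OF assms] power2_eq_square)
  finally show ?thesis .
qed

lemma rho_pos: "B \<noteq> 0 \<Longrightarrow> rho B > 0"
  by (simp add: rho_def)

text \<open>The Cayley-Hamilton identity for the eigenvalues 0 and plus or minus i
  \<open>rho B\<close>. It is the only spectral information on \<open>B\<close> that enters
  later.\<close>

lemma antisymmetric_cube:
  assumes "transpose B = - B"
  shows "B ** (B ** B) = - ((rho B)\<^sup>2 *\<^sub>R B)"
  unfolding rho_squared[OF assms]
  by (simp add: vec_eq_iff forall_3 matrix_matrix_mult_def sum_3 antisymmetric_entries[OF assms] power2_eq_square algebra_simps)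

text \<open>Antisymmetric matrices act as cross products with a vector, and their commutator belongs
  to the cross product of the two vectors; \<open>c\<close> says that it vanishes. The factor is the
  coefficient of the orthogonal projection of the vector of \<open>A\<close> onto that of
  \<open>B\<close>.\<close>

lemma commuting_antisymmetric:
  fixes A B :: "real^3^3"
  assumes A: "transpose A = - A" and B: "transpose B = - B" and AB: "A ** B - B ** A = 0" and nz: "B \<noteq> 0"
  shows "\<exists>a. A = a *\<^sub>R B"
proof -
  have comm: "(A ** B - B ** A) $ i $ j = 0" for i j using AB by simp
  note e = antisymmetric_entries[OF A] antisymmetric_entries[OF B]
  have c: "A $ 1 $ 3 * B $ 2 $ 3 = A $ 2 $ 3 * B $ 1 $ 3" "A $ 1 $ 2 * B $ 2 $ 3 = A $ 2 $ 3 * B $ 1 $ 2"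
    "A $ 1 $ 2 * B $ 1 $ 3 = A $ 1 $ 3 * B $ 1 $ 2"
    using comm[of 1 2] comm[of 1 3] comm[of 2 3]
    by (simp_all add: matrix_matrix_mult_def sum_3 e algebra_simps)
  have pos: "(B $ 1 $ 2)\<^sup>2 + (B $ 1 $ 3)\<^sup>2 + (B $ 2 $ 3)\<^sup>2 > 0"
    using rho_pos[OF nz] unfolding rho_squared[OF B, symmetric] by simp
  define a where "a = (A $ 1 $ 2 * B $ 1 $ 2 + A $ 1 $ 3 * B $ 1 $ 3 + A $ 2 $ 3 * B $ 2 $ 3) /
    ((B $ 1 $ 2)\<^sup>2 + (B $ 1 $ 3)\<^sup>2 + (B $ 2 $ 3)\<^sup>2)"
  have "x = a * y" if "x * ((B $ 1 $ 2)\<^sup>2 + (B $ 1 $ 3)\<^sup>2 + (B $ 2 $ 3)\<^sup>2) =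
      (A $ 1 $ 2 * B $ 1 $ 2 + A $ 1 $ 3 * B $ 1 $ 3 + A $ 2 $ 3 * B $ 2 $ 3) * y" for x y
    using that pos by (simp add: a_def field_simps)
  note this[of "A $ 1 $ 2" "B $ 1 $ 2"] this[of "A $ 1 $ 3" "B $ 1 $ 3"] this[of "A $ 2 $ 3" "B $ 2 $ 3"]
  moreover have "A $ 1 $ 2 * ((B $ 1 $ 2)\<^sup>2 + (B $ 1 $ 3)\<^sup>2 + (B $ 2 $ 3)\<^sup>2) =
      (A $ 1 $ 2 * B $ 1 $ 2 + A $ 1 $ 3 * B $ 1 $ 3 + A $ 2 $ 3 * B $ 2 $ 3) * B $ 1 $ 2"
    "A $ 1 $ 3 * ((B $ 1 $ 2)\<^sup>2 + (B $ 1 $ 3)\<^sup>2 + (B $ 2 $ 3)\<^sup>2) =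
      (A $ 1 $ 2 * B $ 1 $ 2 + A $ 1 $ 3 * B $ 1 $ 3 + A $ 2 $ 3 * B $ 2 $ 3) * B $ 1 $ 3"
    "A $ 2 $ 3 * ((B $ 1 $ 2)\<^sup>2 + (B $ 1 $ 3)\<^sup>2 + (B $ 2 $ 3)\<^sup>2) =
      (A $ 1 $ 2 * B $ 1 $ 2 + A $ 1 $ 3 * B $ 1 $ 3 + A $ 2 $ 3 * B $ 2 $ 3) * B $ 2 $ 3"
    using c by algebra+
  ultimately have "A $ 1 $ 2 = a * B $ 1 $ 2" "A $ 1 $ 3 = a * B $ 1 $ 3" "A $ 2 $ 3 = a * B $ 2 $ 3"
    by blast+
  then have "A = a *\<^sub>R B" by (simp add: vec_eq_iff forall_3 e)
  then show ?thesis ..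
qed

section \<open>The circle of rotations given by Rodrigues' formula\<close>

lemma s_matrix_one: "s_matrix B 1 = mat 1"
  by (simp add: s_matrix_def)

text \<open>For E = B / rho one has E^3 = - E, and \<open>s_matrix B (cis \<phi>)\<close> is
  Rodrigues' formula for exp(\<phi> E). All powers of E reduce to E and E^2, whose coefficients then
  follow complex multiplication.\<close>

lemma s_matrix_mult:
  assumes B: "transpose B = - B" and nz: "B \<noteq> 0"
  shows "s_matrix B p ** s_matrix B q = s_matrix B (p * q)"
proof -
  interpret M: bounded_bilinear "(**) :: real^3^3 \<Rightarrow> real^3^3 \<Rightarrow> real^3^3" by (rule bounded_bilinear_matrix_mult)
  define E where "E = (1 / rho B) *\<^sub>R B"
  have r: "rho B \<noteq> 0" using rho_pos[OF nz] by simp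
  have s: "s_matrix B p = (1 - Re p) *\<^sub>R (E ** E) + Im p *\<^sub>R E + mat 1" for p
    by (simp add: s_matrix_def E_def M.scaleR_left M.scaleR_right power2_eq_square)
  have E3: "E ** (E ** E) = - E"
    using r by (simp add: E_def M.scaleR_left M.scaleR_right antisymmetric_cube[OF B] power2_eq_square)
  then have E3': "(E ** E) ** E = - E" by (simp add: matrix_mul_assoc)
  have "(E ** E) ** (E ** E) = ((E ** E) ** E) ** E" by (simp add: matrix_mul_assoc)
  then have E4: "(E ** E) ** (E ** E) = - (E ** E)" by (simp add: E3' M.minus_left)
  have prod: "(x *\<^sub>R (E ** E) + y *\<^sub>R E + mat 1) ** (x' *\<^sub>R (E ** E) + y' *\<^sub>R E + mat 1) =
    (x + x' - x * x' + y * y') *\<^sub>R (E ** E) + (y + y' - x * y' - y * x') *\<^sub>R E + mat 1" for x y x' y'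
    by (simp add: M.add_left M.add_right M.scaleR_left M.scaleR_right E3 E3' E4 algebra_simps)
  show ?thesis unfolding s prod by (simp add: algebra_simps)
qed

lemma s_matrix_transpose:
  assumes B: "transpose B = - B"
  shows "transpose (s_matrix B p) = s_matrix B (cnj p)"
proof -
  have t: "transpose (X + Y) = transpose X + transpose Y" "transpose (c *\<^sub>R X) = c *\<^sub>R transpose X" for X Y :: "real^3^3" and c
    by (simp_all add: transpose_def vec_eq_iff)
  interpret M: bounded_bilinear "(**) :: real^3^3 \<Rightarrow> real^3^3 \<Rightarrow> real^3^3" by (rule bounded_bilinear_matrix_mult)
  show ?thesis
    by (simp add: s_matrix_def t matrix_transpose_mul B transpose_mat M.minus_left M.minus_right)
qed

text \<open>Orthogonality holds because transposition conjugates \<open>p\<close>. The determinant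
  is then plus or minus 1, and the sign is settled by writing the matrix as the square of the one
  for \<open>csqrt p\<close>.\<close>

lemma s_matrix_rotation:
  assumes B: "transpose B = - B" and nz: "B \<noteq> 0" and p: "p \<in> circle"
  shows "rotation_matrix (s_matrix B p)"
proof -
  have orth: "orthogonal_matrix (s_matrix B q)" if "norm q = 1" for q
  proof -
    have "cnj q * q = 1" using that by (metis complex_norm_square mult.commute of_real_1 power_one)
    then show ?thesis
      by (simp add: orthogonal_matrix s_matrix_transpose[OF B] s_matrix_mult[OF B nz] s_matrix_one)
  qed
  have q: "norm (csqrt p) = 1" using p by (simp add: norm_csqrt)
  have "s_matrix B p = s_matrix B (csqrt p) ** s_matrix B (csqrt p)"
    by (simp add: s_matrix_mult[OF B nz] power2_eq_square[symmetric])
  then have "det (s_matrix B p) = det (s_matrix B (csqrt p)) * det (s_matrix B (csqrt p))" by (simp add: det_mul)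
  also have "\<dots> = 1" using det_orthogonal_matrix[OF orth[OF q]] by auto
  finally show ?thesis using orth[of p] p by (simp add: rotation_matrix_def)
qed

lemma s_matrix_continuous: "continuous_on X (s_matrix B)"
  unfolding s_matrix_def divide_inverse
  by (intro continuous_on_add continuous_on_scaleR continuous_on_mult continuous_on_diff continuous_on_const
    continuous_on_Re continuous_on_Im continuous_on_id)

text \<open>Treats the sphere and the rotation group at once. The norm is preserved on the whole
  space, so that differences of points of \<open>K\<close> are covered and the action is
  isometric.\<close>

locale matrix_action =
  fixes act :: "real^3^3 \<Rightarrow> 'a::euclidean_space \<Rightarrow> 'a" and K :: "'a set"
  assumes bilinear: "bounded_bilinear act"
    and act_mult: "act (X ** Y) z = act X (act Y z)"
    and act_one: "act (mat 1) z = z"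
    and act_compact: "compact K"
    and act_in: "rotation_matrix Q \<Longrightarrow> z \<in> K \<Longrightarrow> act Q z \<in> K"
    and act_norm: "rotation_matrix Q \<Longrightarrow> norm (act Q z) = norm z"
begin

sublocale act: bounded_bilinear act by (rule bilinear)

lemma circle_action_S_map:
  assumes B: "transpose B = - B" and nz: "B \<noteq> 0"
  shows "circle_action (S_map act B) K"
proof
  show "compact K" by (rule act_compact)
  show "continuous_on UNIV (\<lambda>x. S_map act B (fst x) (snd x))"
    unfolding S_map_def
    by (intro act.continuous_on continuous_on_compose2[OF s_matrix_continuous[of UNIV]] continuous_intros) auto
  fix p q :: complex and x y z :: 'a
  show "p \<in> circle \<Longrightarrow> z \<in> K \<Longrightarrow> S_map act B p z \<in> K"
    unfolding S_map_def by (intro act_in s_matrix_rotation B nz)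
  show "S_map act B 1 z = z" by (simp add: S_map_def s_matrix_one act_one)
  show "S_map act B (p * q) z = S_map act B p (S_map act B q z)"
    by (simp add: S_map_def s_matrix_mult[OF B nz, symmetric] act_mult)
  show "p \<in> circle \<Longrightarrow> dist (S_map act B p x) (S_map act B p y) = dist x y"
    by (simp add: S_map_def dist_norm act.diff_right[symmetric] act_norm[OF s_matrix_rotation[OF B nz]])
qed

end

lemma (in wiener_filtered) stratonovich_solution_explicit:
  fixes act :: "real^3^3 \<Rightarrow> 'a::euclidean_space \<Rightarrow> 'a"
  assumes "matrix_action act K" and B: "transpose B = - B" and nz: "B \<noteq> 0" and A: "A = a *\<^sub>R B"
    and sol: "stratonovich_solution P F W act K A B z Z" and t: "t \<ge> 0"
  shows "AE \<omega> in P. Z t \<omega> = S_map act B (cis (rho B * (W t \<omega> + a * t))) z"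
proof -
  interpret matrix_action act K by fact
  define r where "r = rho B"
  have r: "r > 0" using rho_pos[OF nz] by (simp add: r_def)
  have cube: "act (B ** B) (act B x) = - (r\<^sup>2 *\<^sub>R act B x)" for x
  proof -
    have "act (B ** B) (act B x) = act (B ** (B ** B)) x" by (simp add: act_mult)
    then show ?thesis by (simp add: antisymmetric_cube[OF B] act.minus_left act.scaleR_left r_def)
  qed
  have Aact: "act A x = a *\<^sub>R act B x" for x by (simp add: A act.scaleR_left)
  have K: "bounded K" by (rule compact_imp_bounded[OF act_compact])
  have lin: "bounded_linear (act M)" for M by (rule act.bounded_linear_right)
  have comp: "AE \<omega> in P. Z t \<omega> \<bullet> b = S_map act B (cis (r * (W t \<omega> + a * t))) z \<bullet> b" for b
  proof -
    \<comment> \<open>Replacing \<open>x\<close> by \<open>act B x\<close> turns the two parts into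
      \<open>- r * (act B x \<bullet> b)\<close> and \<open>act (B ** B) x \<bullet> b\<close>,
      which amounts to multiplication by i r.\<close>
    define \<Lambda> where "\<Lambda> x = complex_of_real ((act (B ** B) x \<bullet> b) / r) + \<i> * of_real (act B x \<bullet> b)" for x
    \<comment> \<open>The coordinate of the projection onto the kernel of \<open>act B\<close>,
      conserved by the equation. Together with the real part of \<Lambda> it determines the
      coordinate of \<open>x\<close> itself.\<close>
    define \<Lambda>0 where "\<Lambda>0 x = complex_of_real (x \<bullet> b + (act (B ** B) x \<bullet> b) / r\<^sup>2)" for x
    have l: "bounded_linear \<Lambda>"
      unfolding \<Lambda>_def
      by (intro bounded_linear_add bounded_linear_const_mult bounded_linear_of_real[THEN bounded_linear_compose]
        bounded_linear_divide[THEN bounded_linear_compose] bounded_linear_inner_left[THEN bounded_linear_compose] lin)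
    have l0: "bounded_linear \<Lambda>0"
      unfolding \<Lambda>0_def
      by (intro bounded_linear_add bounded_linear_const_mult bounded_linear_of_real[THEN bounded_linear_compose]
        bounded_linear_divide[THEN bounded_linear_compose] bounded_linear_inner_left[THEN bounded_linear_compose] lin bounded_linear_inner_left)
    have \<Lambda>B: "\<Lambda> (act B x) = \<i> * of_real r * \<Lambda> x" for x
      using r unfolding \<Lambda>_def cube
      by (simp add: complex_eq_iff act_mult power2_eq_square)
    have \<Lambda>A: "\<Lambda> (act A x) = \<i> * of_real (r * a) * \<Lambda> x" for x
    proof -
      have "\<Lambda> (act A x) = a *\<^sub>R \<Lambda> (act B x)" unfolding Aact by (rule linear_scale[OF bounded_linear.linear[OF l]])
      then show ?thesis by (simp add: \<Lambda>B scaleR_conv_of_real mult_ac)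
    qed
    have \<Lambda>0B: "\<Lambda>0 (act B x) = \<i> * of_real 0 * \<Lambda>0 x" for x
      using r unfolding \<Lambda>0_def cube by simp
    have \<Lambda>0A: "\<Lambda>0 (act A x) = \<i> * of_real (0 * a) * \<Lambda>0 x" for x
    proof -
      have "\<Lambda>0 (act A x) = a *\<^sub>R \<Lambda>0 (act B x)" unfolding Aact by (rule linear_scale[OF bounded_linear.linear[OF l0]])
      then show ?thesis by (simp add: \<Lambda>0B)
    qed
    show ?thesis
      using linear_functional_of_solution[OF sol K lin l \<Lambda>B \<Lambda>A t] linear_functional_of_solution[OF sol K lin l0 \<Lambda>0B \<Lambda>0A t]
    proof eventually_elim
      case (elim \<omega>)
      let ?\<phi> = "r * (W t \<omega> + a * t)"
      have 1: "(act (B ** B) (Z t \<omega>) \<bullet> b) / r = cos ?\<phi> * ((act (B ** B) z \<bullet> b) / r) - sin ?\<phi> * (act B z \<bullet> b)"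
        using arg_cong[OF elim(1), of Re] by (simp add: \<Lambda>_def)
      have 2: "Z t \<omega> \<bullet> b + (act (B ** B) (Z t \<omega>) \<bullet> b) / r\<^sup>2 = z \<bullet> b + (act (B ** B) z \<bullet> b) / r\<^sup>2"
        using arg_cong[OF elim(2), of Re] by (simp add: \<Lambda>0_def)
      have "(act (B ** B) (Z t \<omega>) \<bullet> b) / r\<^sup>2 = ((act (B ** B) (Z t \<omega>) \<bullet> b) / r) / r" by (simp add: power2_eq_square)
      also have "\<dots> = cos ?\<phi> * (act (B ** B) z \<bullet> b) / r\<^sup>2 - sin ?\<phi> * (act B z \<bullet> b) / r"
        unfolding 1 by (simp add: power2_eq_square diff_divide_distrib)
      finally have "Z t \<omega> \<bullet> b = z \<bullet> b + (1 - cos ?\<phi>) / r\<^sup>2 * (act (B ** B) z \<bullet> b) + sin ?\<phi> / r * (act B z \<bullet> b)"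
        using 2 by (simp add: diff_divide_distrib left_diff_distrib)
      then show ?case
        unfolding S_map_def s_matrix_def
        by (simp add: act.add_left act.scaleR_left act_one inner_add_left r_def[symmetric])
    qed
  qed
  have "AE \<omega> in P. \<forall>b\<in>Basis. Z t \<omega> \<bullet> b = S_map act B (cis (r * (W t \<omega> + a * t))) z \<bullet> b"
    by (rule AE_finite_allI) (auto intro: comp)
  then show ?thesis by eventually_elim (auto simp: r_def intro: euclidean_eqI)
qed

text \<open>The solution enters \<open>ergodic\<close> only through its transition probabilities,
  and these are those of a random rotation. Hence invariance, and with it extremality, means the
  same for the equation and for the circle action.\<close>

lemma (in wiener_filtered) ergodic_iff_orbit_measure:
  fixes act :: "real^3^3 \<Rightarrow> 'a::euclidean_space \<Rightarrow> 'a" and Z :: "'a \<Rightarrow> real \<Rightarrow> 'w \<Rightarrow> 'a"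
  assumes act: "matrix_action act K" and B: "transpose B = - B" and nz: "B \<noteq> 0" and A: "A = a *\<^sub>R B"
    and sol: "\<And>z. z \<in> K \<Longrightarrow> stratonovich_solution P F W act K A B z (Z z)"
  shows "ergodic P Z K \<nu> \<longleftrightarrow> (\<exists>X\<in>orbit_space act B K. \<nu> = orbit_measure act B K X)"
proof -
  interpret matrix_action act K by fact
  interpret circle_action "S_map act B" K by (rule circle_action_S_map[OF B nz])
  have Z_measurable: "Z z t \<in> borel_measurable P" if "z \<in> K" "0 \<le> t" for z t
    using sol[OF that(1)] that(2) measurable_F
    by (auto simp: stratonovich_solution_def continuous_semimartingale_def adapted_def)
  \<comment> \<open>\<theta> need agree with the phase only almost surely, which permits a Wiener
    increment in place of \<open>W\<close> itself.\<close>
  have transition: "prob {\<omega>\<in>space P. Z z t \<omega> \<in> J} = prob {\<omega>\<in>space P. S_map act B (cis (\<theta> \<omega>)) z \<in> J}"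
    if z: "z \<in> K" and t: "0 \<le> t" and J: "J \<in> sets borel" and \<theta>: "\<theta> \<in> borel_measurable P"
      and AE: "AE \<omega> in P. \<theta> \<omega> = rho B * (W t \<omega> + a * t)" for z t J \<theta>
  proof (rule finite_measure_eq_AE)
    note [measurable] = Z_measurable[OF z t] \<theta> J
    show "{\<omega>\<in>space P. Z z t \<omega> \<in> J} \<in> events" by measurable
    have [measurable]: "(\<lambda>\<omega>. cis (\<theta> \<omega>)) \<in> borel_measurable P" unfolding cis_conv_exp by measurable
    show "{\<omega>\<in>space P. S_map act B (cis (\<theta> \<omega>)) z \<in> J} \<in> events" by measurable
    show "AE \<omega> in P. \<omega> \<in> {\<omega>\<in>space P. Z z t \<omega> \<in> J} \<longleftrightarrow> \<omega> \<in> {\<omega>\<in>space P. S_map act B (cis (\<theta> \<omega>)) z \<in> J}"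
      using stratonovich_solution_explicit[OF act B nz A sol[OF z] t] AE
      by eventually_elim auto
  qed
  have kernel: "(\<integral>z. prob {\<omega>\<in>space P. Z z t \<omega> \<in> J} \<partial>\<nu>) = (\<integral>z. prob {\<omega>\<in>space P. S_map act B (cis (\<theta> \<omega>)) z \<in> J} \<partial>\<nu>)"
    if \<nu>: "borel_prob_on K \<nu>" and t: "0 \<le> t" and J: "J \<in> sets (restrict_space borel K)" and \<theta>: "\<theta> \<in> borel_measurable P"
      and AE: "AE \<omega> in P. \<theta> \<omega> = rho B * (W t \<omega> + a * t)" for \<nu> t J \<theta>
  proof (intro Bochner_Integration.integral_cong refl transition t \<theta> AE)
    show "z \<in> K" if "z \<in> space \<nu>" for z
      using that space_K \<nu> by (auto simp: borel_prob_on_def)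
    show "J \<in> sets borel" using J sets_K_iff[OF refl] by blast
  qed
  have inv_iff: "invariant_prob P Z K \<nu> \<longleftrightarrow> act_invariant \<nu>" for \<nu>
  proof
    assume inv: "invariant_prob P Z K \<nu>"
    then have \<nu>: "borel_prob_on K \<nu>" by (simp add: invariant_prob_def)
    \<comment> \<open>The increment from time 0 has exactly a normal density, whereas
      \<open>W 0\<close> vanishes only almost surely. Time 1 alone already forces invariance under
      the whole circle.\<close>
    define \<xi> where "\<xi> \<omega> = W 1 \<omega> - W 0 \<omega>" for \<omega>
    define \<theta> where "\<theta> \<omega> = rho B * (a + \<xi> \<omega>)" for \<omega>
    have [measurable]: "W 1 \<in> borel_measurable P" "W 0 \<in> borel_measurable P" by (auto intro: W_measurable)
    have \<theta>: "\<theta> \<in> borel_measurable P" unfolding \<theta>_def \<xi>_def by measurable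
    have "AE \<omega> in P. W 0 \<omega> = 0" using wiener by (simp add: wiener_process_def)
    then have AE: "AE \<omega> in P. \<theta> \<omega> = rho B * (W 1 \<omega> + a * 1)"
      by eventually_elim (simp add: \<theta>_def \<xi>_def)
    have d: "distributed P lborel \<xi> (\<lambda>x. ennreal (normal_density 0 1 x))"
      using W_distributed[of 0 1] by (simp add: \<xi>_def[abs_def])
    show "act_invariant \<nu>"
    proof (rule act_invariant_of_rotated[OF prob_space_axioms \<theta> \<nu> _ _ _ d, where c="rho B" and b=a])
      fix J assume "J \<in> sets \<nu>"
      then have J: "J \<in> sets (restrict_space borel K)" using \<nu> by (simp add: borel_prob_on_def)
      show "(\<integral>z. prob {\<omega>\<in>space P. S_map act B (cis (\<theta> \<omega>)) z \<in> J} \<partial>\<nu>) = measure \<nu> J"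
        unfolding kernel[OF \<nu> zero_le_one J \<theta> AE, symmetric]
        using inv J zero_le_one unfolding invariant_prob_def by blast
    next
      show "rho B \<noteq> 0" using rho_pos[OF nz] by simp
      show "0 < ennreal (normal_density 0 1 x)" for x by (simp add: normal_density_pos)
    qed (simp add: \<theta>_def)
  next
    assume inv: "act_invariant \<nu>"
    then have \<nu>: "borel_prob_on K \<nu>" by (simp add: act_invariant_def)
    show "invariant_prob P Z K \<nu>"
      unfolding invariant_prob_def
    proof (intro conjI \<nu> allI impI ballI)
      fix t :: real and J assume t: "0 \<le> t" and J: "J \<in> sets (restrict_space borel K)"
      have [measurable]: "W t \<in> borel_measurable P" by (rule W_measurable[OF t])
      have \<theta>: "(\<lambda>\<omega>. rho B * (W t \<omega> + a * t)) \<in> borel_measurable P" by measurable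
      have "J \<in> sets \<nu>" using J \<nu> by (simp add: borel_prob_on_def)
      then show "(\<integral>z. prob {\<omega>\<in>space P. Z z t \<omega> \<in> J} \<partial>\<nu>) = measure \<nu> J"
        unfolding kernel[OF \<nu> t J \<theta> AE_I2[OF refl]]
        by (rule act_invariant_rotated[OF prob_space_axioms \<theta> \<nu> inv])
    qed
  qed
  have "ergodic P Z K \<nu> \<longleftrightarrow> act_ergodic \<nu>"
    by (simp only: ergodic_def act_ergodic_def inv_iff)
  also have "\<dots> \<longleftrightarrow> (\<exists>u\<in>K. \<nu> = haar_orbit u)" by (rule act_ergodic_iff)
  also have "\<dots> \<longleftrightarrow> (\<exists>X\<in>orbit_space act B K. \<nu> = orbit_measure act B K X)"
  proof -
    have "orbit_measure act B K (orbit u) = haar_orbit u" if u: "u \<in> K" for u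
    proof -
      have "(SOME v. v \<in> orbit u) \<in> orbit u" by (rule someI) (rule orbit_self[OF u])
      then show ?thesis using haar_orbit_base[OF u] by (simp add: orbit_measure_def haar_orbit_def)
    qed
    moreover have "orbit_space act B K = orbit ` K" by (auto simp: orbit_space_def orbit_def)
    ultimately show ?thesis by auto
  qed
  finally show ?thesis .
qed

section \<open>The two state spaces: sphere and rotation group\<close>

lemma norm_rotation_vector: "rotation_matrix Q \<Longrightarrow> norm (Q *v x) = norm x" for Q :: "real^3^3"
  using orthogonal_transformation_matrix[of "(*v) Q"] orthogonal_transformation_norm[of "(*v) Q"]
  by (simp add: rotation_matrix_def matrix_vector_mul_linear)

lemma matrix_action_S2: "matrix_action (*v) S2"
proof (rule matrix_action.intro)
  show "bounded_bilinear ((*v) :: real^3^3 \<Rightarrow> real^3 \<Rightarrow> real^3)" by (rule bounded_bilinear_matrix_vector_mult)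
qed (auto simp: S2_def matrix_vector_mul_assoc norm_rotation_vector)

lemma power2_norm_columns: "(norm M)\<^sup>2 = (\<Sum>j\<in>UNIV. (norm (column j M))\<^sup>2)" for M :: "real^3^3"
  by (simp add: power2_norm_eq_inner inner_vec_def column_def sum_3 algebra_simps)

text \<open>The Frobenius norm is computed column by column, and left multiplication rotates each
  column.\<close>

lemma norm_rotation_matrix: "rotation_matrix Q \<Longrightarrow> norm (Q ** M) = norm M" for Q M :: "real^3^3"
proof -
  assume Q: "rotation_matrix Q"
  have "column j (Q ** M) = Q *v column j M" for j
    by (simp add: vec_eq_iff column_def matrix_matrix_mult_def matrix_vector_mult_def)
  then have "(norm (Q ** M))\<^sup>2 = (norm M)\<^sup>2"
    by (simp add: power2_norm_columns norm_rotation_vector[OF Q])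
  then show ?thesis by simp
qed

lemma SO3_compact: "compact SO3"
proof -
  have "bounded SO3"
    unfolding bounded_iff
  proof (intro exI ballI)
    fix Q assume "Q \<in> SO3"
    then have "norm (Q ** mat 1) = norm (mat 1 :: real^3^3)" by (intro norm_rotation_matrix) (simp add: SO3_def)
    then show "norm Q \<le> norm (mat 1 :: real^3^3)" by simp
  qed
  moreover have "closed SO3"
  proof -
    have c: "continuous_on UNIV (\<lambda>Q. transpose Q ** Q :: real^3^3)"
      unfolding transpose_def
      by (intro bounded_bilinear.continuous_on[OF bounded_bilinear_matrix_mult] continuous_intros)
    have d: "continuous_on UNIV (\<lambda>Q :: real^3^3. det Q)"
      unfolding det_3[abs_def] by (intro continuous_intros)
    have eq: "SO3 = {Q. transpose Q ** Q = mat 1} \<inter> {Q. det Q = 1}"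
      by (auto simp: SO3_def rotation_matrix_def orthogonal_matrix)
    show ?thesis
      unfolding eq by (intro closed_Int closed_Collect_eq c d continuous_on_const)
  qed
  ultimately show ?thesis by (simp add: compact_eq_bounded_closed)
qed

lemma matrix_action_SO3: "matrix_action (**) SO3"
proof (rule matrix_action.intro)
  show "bounded_bilinear ((**) :: real^3^3 \<Rightarrow> real^3^3 \<Rightarrow> real^3^3)" by (rule bounded_bilinear_matrix_mult)
  show "compact SO3" by (rule SO3_compact)
qed (auto simp: SO3_def matrix_mul_assoc norm_rotation_matrix rotation_matrix_def orthogonal_matrix_mul det_mul)

theorem theorem3p7:
  fixes P :: "'w measure" and F :: "real \<Rightarrow> 'w measure" and W :: "real \<Rightarrow> 'w \<Rightarrow> real"
    and A B :: "real^3^3"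
  assumes "filtered_prob_space P F"
    and "wiener_process P F W"
    and "transpose A = - A"
    and "transpose B = - B"
    and "A ** B - B ** A = 0"
    and "B \<noteq> 0"
  shows
    "(\<forall>Z :: real^3 \<Rightarrow> real \<Rightarrow> 'w \<Rightarrow> real^3.
        (\<forall>z\<in>S2. stratonovich_solution P F W (*v) S2 A B z (Z z)) \<longrightarrow>
        (\<forall>\<nu>. borel_prob_on S2 \<nu> \<longrightarrow>
           (ergodic P Z S2 \<nu> \<longleftrightarrow>
              (\<exists>X\<in>orbit_space (*v) B S2. \<nu> = orbit_measure (*v) B S2 X)))) \<and>
     (\<forall>Z :: real^3^3 \<Rightarrow> real \<Rightarrow> 'w \<Rightarrow> real^3^3.
        (\<forall>z\<in>SO3. stratonovich_solution P F W (**) SO3 A B z (Z z)) \<longrightarrow>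
        (\<forall>\<nu>. borel_prob_on SO3 \<nu> \<longrightarrow>
           (ergodic P Z SO3 \<nu> \<longleftrightarrow>
              (\<exists>X\<in>orbit_space (**) B SO3. \<nu> = orbit_measure (**) B SO3 X))))"
proof -
  have F: "prob_space P" "filtration (space P) F" "\<And>t. subalgebra P (F t)"
    using assms(1) by (auto simp: filtered_prob_space_def)
  interpret prob_space P by (rule F(1))
  interpret wiener_filtered P F W
  proof
    show "space (F t) = space P" "sets (F t) \<subseteq> sets P" for t
      using F(3)[of t] by (auto simp: subalgebra_def)
    show "sets (F s) \<subseteq> sets (F t)" if "s \<le> t" for s t
      using F(2) that by (auto simp: filtration_def)
    show "wiener_process P F W" by (rule assms(2))
  qed
  obtain a where A: "A = a *\<^sub>R B" using commuting_antisymmetric assms by blast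
  show ?thesis
    using ergodic_iff_orbit_measure[OF matrix_action_S2 assms(4,6) A]
      ergodic_iff_orbit_measure[OF matrix_action_SO3 assms(4,6) A] by blast
qed

end
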